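(* Let $B,D\in\mathcal M_{d\times d}(\mathbb R)$ be constant matrices with $D$ symmetric positive semidefinite, and let $$Lf(x) = -(Bx)\cdot\nabla f(x) + \mathrm{div}(D\nabla f)(x)$$ be the generator of the corresponding Ornstein-Uhlenbeck process on $\mathbb R^d$, with semigroup $(P_t)_{t\ge 0}$. Suppose that $\ker D$ does not contain any non-trivial subspace which is invariant by $B^T$, and let $M$ be the number of Lie brackets necessary to fulfill Hörmander's condition. Suppose $\rho = \inf\{\Re(\lambda):\ \lambda\in\sigma(B)\}>0$, and let $N$ be the maximal dimension of a Jordan block of $B$ corresponding to an eigenvalue in $\{\lambda\in\sigma(B):\ \Re(\lambda)=\rho\}$. Then the process admits a unique invariant measure $\mu$, and there exist constants $c,\kappa>0$ such that for all admissible functions $a$, all $f$ with $\mathrm{Ent}_\mu^a f<\infty$ and all $t\geq 0$, $$\mathrm{Ent}_\mu^a(P_tf)\ \le\ \min\left(c\,(1+t^{2(N-1)})\,e^{-2\rho t}\,,\ e^{-\kappa t(1-e^{-t})^{2M}}\right)\mathrm{Ent}_\mu^a f .$$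
   Context: $\sigma(B)$ is the (complex) spectrum of $B$, and Jordan blocks are those of the complex Jordan decomposition. The number $M$ is the smallest integer such that $\sum_{k=0}^{M}B^kD(B^T)^k$ is positive definite. An admissible function is a strictly convex $\mathcal C^4$ function $a:\mathbb R_+\to\mathbb R_+$ such that $1/a''$ is (positive and) concave. For a probability measure $\nu$ and a non-negative function $f\in L^1(\nu)$, $\mathrm{Ent}_\nu^a f = \int a(f)\,d\nu - a\left(\int f\,d\nu\right)$. The constants $c,\kappa$ do not depend on $a$, $f$ or $t$. *)

theory Defs
  imports
    "Jordan_Normal_Form.Jordan_Normal_Form_Existence"
    "Jordan_Normal_Form.Spectral_Radius"
    "HOL-Probability.Probability"
begin

no_notation Matrix.vec_index (infixl "$" 100)
no_notation Matrix.scalar_prod (infix "\<bullet>" 70)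

section \<open>Matrices\<close>

text \<open>The class operation \<open>^\<close> on \<open>real^'n^'n\<close> is the entrywise power, hence a separate
  function for powers with respect to \<open>**\<close>.\<close>

primrec matpow :: "real^'n^'n \<Rightarrow> nat \<Rightarrow> real^'n^'n" where
  "matpow A 0 = Finite_Cartesian_Product.mat 1"
| "matpow A (Suc k) = A ** matpow A k"

definition psd_matrix :: "real^'n^'n \<Rightarrow> bool" where
  "psd_matrix A \<longleftrightarrow> transpose A = A \<and> (\<forall>x. 0 \<le> x \<bullet> (A *v x))"

definition pd_matrix :: "real^'n^'n \<Rightarrow> bool" where
  "pd_matrix A \<longleftrightarrow> transpose A = A \<and> (\<forall>x. x \<noteq> 0 \<longrightarrow> 0 < x \<bullet> (A *v x))"

definition kernel_nondegenerate :: "real^'n^'n \<Rightarrow> real^'n^'n \<Rightarrow> bool" where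
  "kernel_nondegenerate B D \<longleftrightarrow>
     (\<forall>S. Real_Vector_Spaces.subspace S \<and> S \<subseteq> {x. D *v x = 0} \<and>
          (\<forall>x\<in>S. transpose B *v x \<in> S) \<longrightarrow> S = {0})"

text \<open>The constant vector fields obtained from the columns of \<open>D\<close> by at most \<open>m\<close> brackets with
  the drift \<open>x \<mapsto> B x\<close> span the range of the sum below.\<close>

definition num_brackets :: "real^'n^'n \<Rightarrow> real^'n^'n \<Rightarrow> nat" where
  "num_brackets B D =
     (LEAST m. pd_matrix (\<Sum>k\<le>m. matpow B k ** D ** matpow (transpose B) k))"

text \<open>The same matrix as a complex matrix of type \<^typ>\<open>complex mat\<close>, rows and columns being
  numbered by a bijection from \<open>{..<CARD('n)}\<close> to \<open>'n\<close>. Spectrum and Jordan blocks do not depend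
  on the numbering.\<close>

definition complex_mat :: "real^'n^'n \<Rightarrow> complex mat" where
  "complex_mat A = Matrix.mat CARD('n) CARD('n)
     (\<lambda>(i, j). complex_of_real (A $ from_nat_into UNIV i $ from_nat_into UNIV j))"

definition min_re_spectrum :: "real^'n^'n \<Rightarrow> real" where
  "min_re_spectrum B = Inf (Re ` spectrum (complex_mat B))"

text \<open>A Jordan form is a list of pairs (block size, eigenvalue), unique up to reordering.\<close>

definition max_jordan_block :: "real^'n^'n \<Rightarrow> real \<Rightarrow> nat" where
  "max_jordan_block B r =
     Max {n. \<exists>n_as ev. jordan_nf (complex_mat B) n_as \<and> (n, ev) \<in> set n_as \<and> Re ev = r}"

section \<open>The generator\<close>

definition grad :: "(real^'n \<Rightarrow> real) \<Rightarrow> real^'n \<Rightarrow> real^'n" where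
  "grad f x = (\<chi> i. frechet_derivative f (at x) (axis i 1))"

definition divergence :: "(real^'n \<Rightarrow> real^'n) \<Rightarrow> real^'n \<Rightarrow> real" where
  "divergence v x = (\<Sum>i\<in>UNIV. frechet_derivative v (at x) (axis i 1) $ i)"

definition OU_generator ::
  "real^'n^'n \<Rightarrow> real^'n^'n \<Rightarrow> (real^'n \<Rightarrow> real) \<Rightarrow> real^'n \<Rightarrow> real" where
  "OU_generator B D f x = - ((B *v x) \<bullet> grad f x) + divergence (\<lambda>y. D *v grad f y) x"

text \<open>Twice continuously differentiable functions with compact support.\<close>

definition C2c :: "(real^'n \<Rightarrow> real) set" where
  "C2c = {f. (\<forall>x. f differentiable (at x)) \<and> (\<forall>x. grad f differentiable (at x)) \<and>
             (\<forall>v. continuous_on UNIV (\<lambda>x. frechet_derivative (grad f) (at x) v)) \<and>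
             compact (closure {x. f x \<noteq> 0})}"

text \<open>Continuous functions vanishing at infinity.\<close>

definition C0 :: "(real^'n \<Rightarrow> real) set" where
  "C0 = {f. continuous_on UNIV f \<and> (f \<longlongrightarrow> 0) at_infinity}"

section \<open>Transition semigroups\<close>

text \<open>A Markov process is given by its transition probabilities \<open>K t x\<close>, the law at time \<open>t\<close> of the
  process started at \<open>x\<close>; only times \<open>t \<ge> 0\<close> matter.\<close>

definition semigroup_op ::
  "(real \<Rightarrow> real^'n \<Rightarrow> (real^'n) measure) \<Rightarrow> real \<Rightarrow> (real^'n \<Rightarrow> real) \<Rightarrow> real^'n \<Rightarrow> real" where
  "semigroup_op K t f x = (\<integral>y. f y \<partial>K t x)"

definition markov_semigroup :: "(real \<Rightarrow> real^'n \<Rightarrow> (real^'n) measure) \<Rightarrow> bool" where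
  "markov_semigroup K \<longleftrightarrow>
     (\<forall>t\<ge>0. K t \<in> borel \<rightarrow>\<^sub>M prob_algebra borel) \<and>
     (\<forall>x. K 0 x = return borel x) \<and>
     (\<forall>s\<ge>0. \<forall>t\<ge>0. \<forall>x. K (s + t) x = K s x \<bind> K t)"

definition feller_semigroup :: "(real \<Rightarrow> real^'n \<Rightarrow> (real^'n) measure) \<Rightarrow> bool" where
  "feller_semigroup K \<longleftrightarrow> markov_semigroup K \<and>
     (\<forall>f\<in>C0. (\<forall>t\<ge>0. semigroup_op K t f \<in> C0) \<and>
             uniform_limit UNIV (\<lambda>t. semigroup_op K t f) f (at_right 0))"

text \<open>The Feller semigroup whose infinitesimal generator (for the uniform norm) extends the
  operator above on \<^const>\<open>C2c\<close>; this determines the transition probabilities uniquely.\<close>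

definition OU_semigroup ::
  "real^'n^'n \<Rightarrow> real^'n^'n \<Rightarrow> (real \<Rightarrow> real^'n \<Rightarrow> (real^'n) measure) \<Rightarrow> bool" where
  "OU_semigroup B D K \<longleftrightarrow> feller_semigroup K \<and>
     (\<forall>f\<in>C2c. uniform_limit UNIV (\<lambda>t x. (semigroup_op K t f x - f x) / t)
                 (OU_generator B D f) (at_right 0))"

definition invariant_measure ::
  "(real \<Rightarrow> real^'n \<Rightarrow> (real^'n) measure) \<Rightarrow> (real^'n) measure \<Rightarrow> bool" where
  "invariant_measure K \<mu> \<longleftrightarrow>
     prob_space \<mu> \<and> sets \<mu> = sets borel \<and> (\<forall>t\<ge>0. \<mu> \<bind> K t = \<mu>)"

section \<open>Entropies\<close>

text \<open>Regularity is only required on the open half-line, so that \<open>x ln x - x + 1\<close> is admissible; at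
  \<open>0\<close> the function is continuous. Values at negative arguments are irrelevant.\<close>

definition admissible :: "(real \<Rightarrow> real) \<Rightarrow> bool" where
  "admissible a \<longleftrightarrow>
     (\<forall>x\<ge>0. 0 \<le> a x) \<and> continuous_on {0..} a \<and>
     (\<forall>x\<ge>0. \<forall>y\<ge>0. \<forall>u. x \<noteq> y \<and> 0 < u \<and> u < 1 \<longrightarrow>
        a ((1 - u) * x + u * y) < (1 - u) * a x + u * a y) \<and>
     (\<forall>k<4. \<forall>x>0. (deriv ^^ k) a differentiable (at x)) \<and>
     continuous_on {0<..} ((deriv ^^ 4) a) \<and>
     (\<forall>x>0. 0 < (deriv ^^ 2) a x) \<and>
     concave_on {0<..} (\<lambda>x. 1 / (deriv ^^ 2) a x)"

text \<open>For admissible \<open>a\<close> and non-negative integrable \<open>f\<close> the first integral is well-defined in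
  \<open>[0, \<infinity>]\<close>; the entropy is \<open>\<infinity>\<close> iff \<open>a \<circ> f\<close> is not integrable.\<close>

definition Ent :: "(real \<Rightarrow> real) \<Rightarrow> 'a measure \<Rightarrow> ('a \<Rightarrow> real) \<Rightarrow> ereal" where
  "Ent a \<nu> f = enn2ereal (\<integral>\<^sup>+x. ennreal (a (f x)) \<partial>\<nu>) - ereal (a (\<integral>x. f x \<partial>\<nu>))"

end

theory Submission
  imports Defs
begin

text \<open>The transition law at time \<open>t\<close> from \<open>x\<close> is Gaussian with mean \<open>E x\<close>, where \<open>E = exp (- t B)\<close>, and
  covariance \<open>Q - E Q E\<^sup>T\<close>, where \<open>Q\<close> solves the Lyapunov equation \<open>B Q + Q B\<^sup>T = 2 D\<close>; the invariant
  measure is the centered Gaussian with covariance \<open>Q\<close>. If \<open>E Q E\<^sup>T \<le> \<theta> Q\<close> with \<open>\<theta> \<le> 1\<close>, the transition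
  kernel is a Markov kernel preserving \<open>\<mu>\<close> composed with the Mehler kernel \<open>f \<mapsto> \<integral> f (\<surd>\<theta> x + \<surd>(1 - \<theta>) y) d\<mu>(y)\<close>,
  so it suffices that the latter contracts every \<open>a\<close>-entropy by the factor \<open>\<theta>\<close>.

  For a Brownian motion \<open>W\<close> with \<open>W\<^sub>1\<close> distributed as \<open>\<mu>\<close> this says that \<open>t \<mapsto> E a(E[f(W\<^sub>1) | W\<^sub>t])\<close> lies below its
  chord on \<open>[0, 1]\<close>. The function is in fact convex: by exchangeability of two consecutive increments of equal
  length, midpoint convexity is the superadditivity of the entropy on a product space, which follows
  from the joint convexity of the Bregman divergence of \<open>a\<close>, that is from the concavity of \<open>1 / a''\<close>.

  It remains to bound \<open>\<theta>\<close>: the Jordan form gives the first term of the minimum, and a lower bound of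
  order \<open>t\<^sup>2\<^sup>M\<^sup>+\<^sup>1\<close> for \<open>Q - E Q E\<^sup>T\<close>, together with the semigroup property, gives the second one.\<close>


section \<open>Bregman divergences of admissible functions\<close>

text \<open>For degenerate \<open>D\<close> the entropy production only sees the gradient through
  \<open>D\<close> and can vanish on non-constant functions, so no differential inequality in t
  yields the decay. The comparison with the Mehler kernel is therefore made at a fixed time: that
  kernel carries the full covariance \<open>Q\<close>, and the degeneracy is moved into the number
  \<theta>. Both rates come from this one device, and as no prefactor arises, the second term of the
  minimum has constant 1. Convexity in t is shown by second differences, which asks for no
  smoothness of \<open>f\<close> and no integration by parts. Derivatives of \<open>a\<close> may
  blow up at 0, so functions with values in a compact interval of positive numbers are treated
  before the general case. Gaussian laws with given covariance are described by characteristic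
  functions, which admits the singular covariance left over when \<theta> is optimal. The transition
  law has to be recovered from the generator on compactly supported functions: plane waves solve the
  backward equation exactly but have no compact support, hence the cutoffs.\<close>

definition bregman :: "(real \<Rightarrow> real) \<Rightarrow> real \<Rightarrow> real \<Rightarrow> real" where
  "bregman a z t = a z - a t - deriv a t * (z - t)"

context
  fixes a :: "real \<Rightarrow> real"
  assumes a: "admissible a"
begin

lemma admissible_deriv:
  assumes "x > 0"
  shows "(a has_real_derivative deriv a x) (at x)"
    and "(deriv a has_real_derivative (deriv ^^ 2) a x) (at x)"
    and "((deriv ^^ 2) a has_real_derivative (deriv ^^ 3) a x) (at x)"
proof -
  have d: "((deriv ^^ k) a has_real_derivative (deriv ^^ Suc k) a x) (at x)" if "k < 4" for k
    using a assms that DERIV_deriv_iff_real_differentiable[of "(deriv ^^ k) a" x]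
    by (auto simp: admissible_def)
  show "(a has_real_derivative deriv a x) (at x)"
    "(deriv a has_real_derivative (deriv ^^ 2) a x) (at x)"
    "((deriv ^^ 2) a has_real_derivative (deriv ^^ 3) a x) (at x)"
    using d[of 0] d[of 1] d[of 2] by (auto simp: numeral_eq_Suc)
qed

lemma admissible_continuous: "continuous_on {0..} a"
  using a by (auto simp: admissible_def)

lemma admissible_nonneg: "x \<ge> 0 \<Longrightarrow> a x \<ge> 0"
  using a by (auto simp: admissible_def)

lemma admissible_convex: "convex_on {0..} a"
proof (rule convex_onI)
  fix t x y :: real assume "0 < t" "t < 1" "x \<in> {0..}" "y \<in> {0..}"
  then show "a ((1 - t) *\<^sub>R x + t *\<^sub>R y) \<le> (1 - t) * a x + t * a y"
  proof (cases "x = y")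
    case False
    then show ?thesis using a \<open>0 < t\<close> \<open>t < 1\<close> \<open>x \<in> {0..}\<close> \<open>y \<in> {0..}\<close>
      by (auto simp: admissible_def less_imp_le)
  qed (auto simp: algebra_simps)
qed auto

text \<open>Concavity of \<open>1 / a''\<close> at \<open>q\<close>, tested at \<open>p\<close>, bounds the third-order term of the Hessian of
  the divergence so that a perfect square remains.\<close>

lemma bregman_second_derivative_nonneg:
  assumes p: "p > 0" and q: "q > 0"
  shows "0 \<le> (deriv ^^ 2) a p * u\<^sup>2 - 2 * (deriv ^^ 2) a q * u * v + (deriv ^^ 2) a q * v\<^sup>2
               - (deriv ^^ 3) a q * (p - q) * v\<^sup>2"
proof -
  define b where "b x = 1 / (deriv ^^ 2) a x" for x
  have pos: "(deriv ^^ 2) a x > 0" if "x > 0" for x using a that by (auto simp: admissible_def)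
  have bpos: "b x > 0" if "x > 0" for x using pos[OF that] by (auto simp: b_def)
  have a2: "(deriv ^^ 2) a x = 1 / b x" for x by (simp add: b_def)
  define b' where "b' = - (deriv ^^ 3) a q / ((deriv ^^ 2) a q)\<^sup>2"
  have a3: "(deriv ^^ 3) a q = - b' / (b q)\<^sup>2"
    using pos[OF q] by (simp add: b'_def b_def field_simps)
  have db: "(b has_real_derivative b') (at q)"
    unfolding b_def b'_def using pos[OF q] admissible_deriv(3)[OF q]
    by (auto intro!: derivative_eq_intros simp: power2_eq_square)
  have "concave_on {0<..} b"
    using a by (auto simp: admissible_def b_def[abs_def])
  then have "convex_on {0<..} (\<lambda>x. - b x)" by (simp add: concave_on_def)
  then have "- b p \<ge> - b q + (- b') * (p - q)"
    using convex_on_imp_above_tangent[of "{0<..}" "\<lambda>x. - b x" q p "- b'"] p q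
      DERIV_subset[OF DERIV_minus[OF db], of "{0<..}"]
    by (auto simp: interior_open)
  then have le: "b p - b q \<le> b' * (p - q)" by simp
  have "0 \<le> (u / b p - v / b q)\<^sup>2 * b p" using bpos[OF p] by simp
  also have "\<dots> = u\<^sup>2 / b p - 2 * u * v / b q + v\<^sup>2 / b q + (b p - b q) * (v\<^sup>2 / (b q)\<^sup>2)"
    using bpos[OF p] bpos[OF q] by (simp add: field_simps power2_eq_square)
  also have "\<dots> \<le> u\<^sup>2 / b p - 2 * u * v / b q + v\<^sup>2 / b q + b' * (p - q) * (v\<^sup>2 / (b q)\<^sup>2)"
    using mult_right_mono[OF le, of "v\<^sup>2 / (b q)\<^sup>2"] by simp
  finally show ?thesis unfolding a2 a3 by (simp add: algebra_simps)
qed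

text \<open>On the segment from (p, q) to (z, t) the divergence is a function \<open>h\<close> of
  one variable with non-negative second derivative, so it lies above its tangent at l = 0; the
  coefficients on the left are the two partial derivatives at (p, q). Joint convexity enters the
  sequel only in this first-order form.\<close>

lemma bregman_above_tangent:
  assumes pos: "p > 0" "q > 0" "z > 0" "t > 0"
  shows "bregman a p q + (deriv a p - deriv a q) * (z - p) - (deriv ^^ 2) a q * (p - q) * (t - q)
           \<le> bregman a z t"
proof -
  define P where "P l = p + l * (z - p)" for l
  define Q where "Q l = q + l * (t - q)" for l
  define h where "h l = bregman a (P l) (Q l)" for l
  define h' where "h' l = (deriv a (P l) - deriv a (Q l)) * (z - p)
       - (deriv ^^ 2) a (Q l) * (P l - Q l) * (t - q)" for l
  define h'' where "h'' l = (deriv ^^ 2) a (P l) * (z - p)\<^sup>2 - 2 * (deriv ^^ 2) a (Q l) * (z - p) * (t - q)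
       + (deriv ^^ 2) a (Q l) * (t - q)\<^sup>2 - (deriv ^^ 3) a (Q l) * (P l - Q l) * (t - q)\<^sup>2" for l
  have PQ: "P l > 0" "Q l > 0" if "l \<in> {0..1}" for l
  proof -
    have "P l = (1 - l) * p + l * z" "Q l = (1 - l) * q + l * t"
      by (simp_all add: P_def Q_def algebra_simps)
    moreover have "(1 - l) * p + l * z > 0" "(1 - l) * q + l * t > 0"
      using that pos by (cases "l = 0"; simp add: add_nonneg_pos)+
    ultimately show "P l > 0" "Q l > 0" by simp_all
  qed
  have dP: "(P has_real_derivative (z - p)) (at l)" and dQ: "(Q has_real_derivative (t - q)) (at l)" for l
    unfolding P_def Q_def by (auto intro!: derivative_eq_intros)
  have "h' 0 * (1 - 0) \<le> h 1 - h 0"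
  proof (rule f''_imp_f'[where C = "{0..1}" and f'' = h''])
    fix l :: real assume l: "l \<in> {0..1}"
    note dc = DERIV_chain2[OF _ dP] DERIV_chain2[OF _ dQ]
    note d = dc(1)[OF admissible_deriv(1)[OF PQ(1)[OF l]]] dc(1)[OF admissible_deriv(2)[OF PQ(1)[OF l]]]
      dc(2)[OF admissible_deriv(1)[OF PQ(2)[OF l]]] dc(2)[OF admissible_deriv(2)[OF PQ(2)[OF l]]]
      dc(2)[OF admissible_deriv(3)[OF PQ(2)[OF l]]]
    show "(h has_real_derivative h' l) (at l)"
      unfolding h_def bregman_def h'_def
      by (rule derivative_eq_intros d dP dQ refl)+ (simp add: algebra_simps)
    show "(h' has_real_derivative h'' l) (at l)"
      unfolding h'_def h''_def
      by (rule derivative_eq_intros d dP dQ refl)+ (simp add: algebra_simps power2_eq_square)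
    show "0 \<le> h'' l"
      unfolding h''_def using bregman_second_derivative_nonneg[OF PQ[OF l], of "z - p" "t - q"] by simp
  qed auto
  then show ?thesis by (simp add: h_def h'_def P_def Q_def)
qed

text \<open>Case q = t = p of the preceding bound, where every term on the left vanishes.\<close>

lemma admissible_tangent_le:
  assumes "p > 0" "x > 0"
  shows "a p + deriv a p * (x - p) \<le> a x"
  using bregman_above_tangent[of p p x p] assms by (simp add: bregman_def)

lemma admissible_deriv_continuous:
  "continuous_on {0<..} (deriv a)"
  using admissible_deriv(2) by (auto intro!: DERIV_atLeastAtMost_imp_continuous_on DERIV_isCont
      continuous_at_imp_continuous_on)

end

section \<open>Integrals of bounded functions and Jensen's inequality\<close>

lemma continuous_on_measurable_Icc:
  fixes g :: "real \<Rightarrow> real"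
  assumes "continuous_on {l..u} g" "f \<in> borel_measurable M" "\<And>x. x \<in> space M \<Longrightarrow> f x \<in> {l..u}"
  shows "(\<lambda>x. g (f x)) \<in> borel_measurable M"
proof -
  have "(\<lambda>x. indicator {l..u} x *\<^sub>R g x) \<in> borel_measurable borel"
    by (rule borel_measurable_continuous_on_indicator[OF _ assms(1)]) auto
  from measurable_compose[OF assms(2) this]
  show ?thesis by (rule measurable_cong[THEN iffD1, rotated]) (use assms(3) in auto)
qed

lemma (in prob_space) integrable_continuous_Icc:
  fixes g :: "real \<Rightarrow> real"
  assumes "continuous_on {l..u} g" "f \<in> borel_measurable M" "\<And>x. x \<in> space M \<Longrightarrow> f x \<in> {l..u}"
  shows "integrable M (\<lambda>x. g (f x))"
proof -
  have "compact (g ` {l..u})" by (rule compact_continuous_image[OF assms(1)]) auto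
  then obtain B where "\<And>y. y \<in> g ` {l..u} \<Longrightarrow> norm y \<le> B"
    using compact_imp_bounded bounded_iff by metis
  then show ?thesis
    by (intro integrable_const_bound[where B = B] continuous_on_measurable_Icc[OF assms(1,2)])
       (use assms(3) in auto)
qed

lemma (in prob_space) integral_in_Icc:
  fixes f :: "'a \<Rightarrow> real"
  assumes "f \<in> borel_measurable M" "\<And>x. x \<in> space M \<Longrightarrow> f x \<in> {l..u}"
  shows "integral\<^sup>L M f \<in> {l..u}"
proof -
  have i: "integrable M f" using integrable_continuous_Icc[of l u "\<lambda>x. x" f] assms by auto
  show ?thesis using integral_ge_const[OF i, of l] integral_le_const[OF i, of u] assms(2) by auto
qed

text \<open>The tangent of \<open>a\<close> at the mean is integrated; the lower bound l > 0 keeps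
  the mean in the region where \<open>a\<close> is differentiable.\<close>

lemma (in prob_space) admissible_jensen:
  assumes a: "admissible a" and f: "f \<in> borel_measurable M" "\<And>x. x \<in> space M \<Longrightarrow> f x \<in> {l..u}" and l: "l > 0"
  shows "a (integral\<^sup>L M f) \<le> (\<integral>x. a (f x) \<partial>M)"
proof -
  have i: "integrable M f" using integrable_continuous_Icc[of l u "\<lambda>x. x" f] f by auto
  define p where "p = integral\<^sup>L M f"
  have p: "p \<ge> l" using integral_in_Icc[OF f] by (simp add: p_def)
  have ia: "integrable M (\<lambda>x. a (f x))"
    by (rule integrable_continuous_Icc[OF continuous_on_subset[OF admissible_continuous[OF a]] f]) (use l in auto)
  have "(\<integral>x. a p + deriv a p * (f x - p) \<partial>M) \<le> (\<integral>x. a (f x) \<partial>M)"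
  proof (rule integral_mono)
    show "integrable M (\<lambda>x. a p + deriv a p * (f x - p))" using i by auto
    show "a p + deriv a p * (f x - p) \<le> a (f x)" if "x \<in> space M" for x
      using admissible_tangent_le[OF a, of p "f x"] f(2)[OF that] p l by simp
  qed (rule ia)
  moreover have "(\<integral>x. a p + deriv a p * (f x - p) \<partial>M) = a p"
    using i by (simp add: prob_space p_def)
  ultimately show ?thesis by (simp add: p_def)
qed

text \<open>Integrate the tangent inequality for the divergence of \<open>Z (x, y)\<close> from \<open>\<integral> Z (x, y) \<partial>M2\<close> at the
  point given by \<open>\<integral> Z (x, y) \<partial>M1\<close> and \<open>\<integral>\<integral> Z\<close>: all first-order terms have mean zero.\<close>

lemma (in pair_prob_space) admissible_entropy_superadditive:
  fixes Z :: "'a \<times> 'b \<Rightarrow> real"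
  assumes a: "admissible a" and l: "l > 0"
    and Z: "Z \<in> borel_measurable (M1 \<Otimes>\<^sub>M M2)" "\<And>x. Z x \<in> {l..u}"
  shows "(\<integral>x. a (\<integral>y. Z (x, y) \<partial>M2) \<partial>M1) + (\<integral>y. a (\<integral>x. Z (x, y) \<partial>M1) \<partial>M2)
     \<le> (\<integral>x. \<integral>y. a (Z (x, y)) \<partial>M2 \<partial>M1) + a (\<integral>x. \<integral>y. Z (x, y) \<partial>M2 \<partial>M1)"
proof -
  define T where "T x = (\<integral>y. Z (x, y) \<partial>M2)" for x
  define P where "P y = (\<integral>x. Z (x, y) \<partial>M1)" for y
  define q where "q = (\<integral>x. T x \<partial>M1)"
  have mT[measurable]: "T \<in> borel_measurable M1" and mP[measurable]: "P \<in> borel_measurable M2"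
    unfolding T_def P_def using Z(1) by measurable
  have Tb: "T x \<in> {l..u}" if "x \<in> space M1" for x unfolding T_def
    using Z that by (intro M2.integral_in_Icc) auto
  have Pb: "P y \<in> {l..u}" if "y \<in> space M2" for y unfolding P_def
    using Z that by (intro M1.integral_in_Icc) auto
  have qb: "q \<in> {l..u}" unfolding q_def by (rule M1.integral_in_Icc[OF mT Tb])
  have ca: "continuous_on {l..u} a"
    by (rule continuous_on_subset[OF admissible_continuous[OF a]]) (use l in auto)
  have cd: "continuous_on {l..u} (deriv a)"
    by (rule continuous_on_subset[OF admissible_deriv_continuous[OF a]]) (use l in auto)
  let ?M = "M1 \<Otimes>\<^sub>M M2"
  have mZ[measurable]: "Z \<in> borel_measurable ?M" by (rule Z(1))
  have iZ: "integrable ?M g" if "g \<in> borel_measurable ?M" "\<forall>w\<in>space ?M. g w \<in> {l..u}" for g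
    using P.integrable_continuous_Icc[of l u "\<lambda>x. x" g] that by auto
  have icZ: "integrable ?M (\<lambda>w. c (g w))" if "continuous_on {l..u} c" "g \<in> borel_measurable ?M"
      "\<forall>w\<in>space ?M. g w \<in> {l..u}" for g and c :: "real \<Rightarrow> real"
    using P.integrable_continuous_Icc[of l u c g] that by auto
  have bdd: "\<exists>B. \<forall>w\<in>space ?M. norm (c (g w)) \<le> B" if "continuous_on {l..u} c" 
      "\<forall>w\<in>space ?M. g w \<in> {l..u}" for g and c :: "real \<Rightarrow> real"
  proof -
    have "compact (c ` {l..u})" by (rule compact_continuous_image[OF that(1)]) auto
    then obtain B where "\<And>y. y \<in> c ` {l..u} \<Longrightarrow> norm y \<le> B"
      using compact_imp_bounded bounded_iff by metis
    with that(2) show ?thesis by blast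
  qed
  \<comment> \<open>Continuous functions of \<open>T\<close> and \<open>P\<close> are bounded, so
    they may multiply any integrable factor; this covers every mixed term below.\<close>
  have imul: "integrable ?M (\<lambda>w. c (g w) * k w)" 
    if c: "continuous_on {l..u} c" and gm: "g \<in> borel_measurable ?M" and g: "\<forall>w\<in>space ?M. g w \<in> {l..u}"
      and "integrable ?M k" for g and c :: "real \<Rightarrow> real" and k :: "'a \<times> 'b \<Rightarrow> real"
  proof -
    have "\<exists>B. \<forall>w\<in>space ?M. norm (c (g w)) \<le> B" by (rule bdd[OF c g])
    then obtain B where B: "\<forall>w\<in>space ?M. norm (c (g w)) \<le> B" by blast
    show ?thesis
    proof (rule Bochner_Integration.integrable_bound[OF integrable_mult_right[OF integrable_norm[OF that(4)], of B]])
      have [measurable]: "(\<lambda>w. c (g w)) \<in> borel_measurable ?M" "k \<in> borel_measurable ?M"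
        using continuous_on_measurable_Icc[OF c gm] g that(4) by auto
      show "(\<lambda>w. c (g w) * k w) \<in> borel_measurable ?M" by measurable
      have "norm (c (g w) * k w) \<le> norm (B * norm (k w))" if "w \<in> space ?M" for w
      proof -
        have "\<bar>c (g w)\<bar> \<le> \<bar>B\<bar>" using B that by fastforce
        then have "\<bar>c (g w)\<bar> * \<bar>k w\<bar> \<le> \<bar>B\<bar> * \<bar>k w\<bar>" by (rule mult_right_mono) simp
        then show ?thesis by (simp add: abs_mult)
      qed
      then show "AE w in ?M. norm (c (g w) * k w) \<le> norm (B * norm (k w))" by (rule AE_I2)
    qed
  qed
  have Zb: "\<forall>w\<in>space ?M. Z w \<in> {l..u}" using Z(2) by simp
  have T1: "(\<lambda>w. T (fst w)) \<in> borel_measurable ?M" "\<forall>w\<in>space ?M. T (fst w) \<in> {l..u}"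
    using Tb by (auto simp: space_pair_measure)
  have P1: "(\<lambda>w. P (snd w)) \<in> borel_measurable ?M" "\<forall>w\<in>space ?M. P (snd w) \<in> {l..u}"
    using Pb by (auto simp: space_pair_measure)
  note i1 = iZ[OF T1] iZ[OF P1] iZ[OF mZ Zb] icZ[OF ca T1] icZ[OF ca P1] icZ[OF ca mZ Zb]
  have i2: "integrable ?M (\<lambda>w. deriv a (T (fst w)) * (Z w - T (fst w)))"
    by (rule imul[OF cd T1]) (use i1 in auto)
  have i3: "integrable ?M (\<lambda>w. deriv a (P (snd w)) * (Z w - P (snd w)))"
    by (rule imul[OF cd P1]) (use i1 in auto)
  have i4: "integrable ?M (\<lambda>w. P (snd w) * (T (fst w) - q))"
    by (rule imul[OF continuous_on_id P1]) (use i1 in auto)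
  have iT: "integrable M1 T" using M1.integrable_continuous_Icc[of l u "\<lambda>x. x" T] Tb by auto
  have iP: "integrable M2 P" using M2.integrable_continuous_Icc[of l u "\<lambda>x. x" P] Pb by auto
  have iZx: "integrable M2 (\<lambda>y. Z (x, y))" if "x \<in> space M1" for x
    using M2.integrable_continuous_Icc[of l u "\<lambda>x. x" "\<lambda>y. Z (x, y)"] Z that by auto
  have iZy: "integrable M1 (\<lambda>x. Z (x, y))" if "y \<in> space M2" for y
    using M1.integrable_continuous_Icc[of l u "\<lambda>x. x" "\<lambda>x. Z (x, y)"] Z that by auto
  have P_Z: "(\<integral>y. P y \<partial>M2) = q"
    unfolding P_def q_def T_def using integral_fst'[OF i1(3)] integral_snd[of "\<lambda>x y. Z (x,y)"] i1(3) by simp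
  \<comment> \<open>\<open>T\<close> is the mean of \<open>Z\<close> given the first coordinate, so
    the inner integral over the second coordinate vanishes; \<open>z3\<close> exchanges the
    roles.\<close>
  have z2: "(\<integral>w. deriv a (T (fst w)) * (Z w - T (fst w)) \<partial>?M) = 0"
  proof -
    have "(\<integral>w. deriv a (T (fst w)) * (Z w - T (fst w)) \<partial>?M)
        = (\<integral>x. \<integral>y. deriv a (T x) * (Z (x, y) - T x) \<partial>M2 \<partial>M1)"
      using integral_fst'[OF i2] by simp
    also have "\<dots> = (\<integral>x. 0 \<partial>M1)"
      by (rule Bochner_Integration.integral_cong[OF refl]) (use iZx in \<open>simp add: T_def M2.prob_space\<close>)
    finally show ?thesis by simp
  qed
  have z3: "(\<integral>w. deriv a (P (snd w)) * (Z w - P (snd w)) \<partial>?M) = 0"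
  proof -
    have "(\<integral>w. deriv a (P (snd w)) * (Z w - P (snd w)) \<partial>?M)
        = (\<integral>y. \<integral>x. deriv a (P y) * (Z (x, y) - P y) \<partial>M1 \<partial>M2)"
      using integral_snd[of "\<lambda>x y. deriv a (P y) * (Z (x, y) - P y)"] i3 by (simp add: split_def)
    also have "\<dots> = (\<integral>y. 0 \<partial>M2)"
      by (rule Bochner_Integration.integral_cong[OF refl]) (use iZy in \<open>simp add: P_def M1.prob_space\<close>)
    finally show ?thesis by simp
  qed
  have s1: "(\<integral>w. g (fst w) \<partial>?M) = (\<integral>x. g x \<partial>M1)" if "integrable ?M (\<lambda>w. g (fst w))" for g :: "'a \<Rightarrow> real"
    using integral_fst'[OF that] by (simp add: M2.prob_space)
  have s2: "(\<integral>w. g (snd w) \<partial>?M) = (\<integral>x. g x \<partial>M2)" if "integrable ?M (\<lambda>w. g (snd w))" for g :: "'b \<Rightarrow> real"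
    using integral_fst'[OF that] by (simp add: M1.prob_space)
  have z4: "(\<integral>w. Z w - P (snd w) \<partial>?M) = 0"
    using i1 s2[OF i1(2)] P_Z integral_fst'[OF i1(3)] by (simp add: q_def T_def)
  \<comment> \<open>The only term mixing both projections: \<open>P\<close> depends on the second
    coordinate, \<open>T\<close> on the first, and \<open>T\<close> has mean \<open>q\<close>, so
    the product measure makes it vanish.\<close>
  have z5: "(\<integral>w. P (snd w) * (T (fst w) - q) \<partial>?M) = 0"
    using integral_fst'[OF i4] iP iT by (simp add: P_Z q_def[symmetric] M1.prob_space)
  have z6: "(\<integral>w. T (fst w) - q \<partial>?M) = 0"
    using i1 s1[OF i1(1)] by (simp add: q_def P.prob_space)
  let ?L = "\<lambda>w. bregman a (P (snd w)) q + (deriv a (P (snd w)) - deriv a q) * (Z w - P (snd w))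
        - (deriv ^^ 2) a q * (P (snd w) - q) * (T (fst w) - q)"
  let ?L' = "\<lambda>w. (a (P (snd w)) - a q - deriv a q * (P (snd w) - q))
       + deriv a (P (snd w)) * (Z w - P (snd w)) - deriv a q * (Z w - P (snd w))
       - (deriv ^^ 2) a q * (P (snd w) * (T (fst w) - q)) + (deriv ^^ 2) a q * q * (T (fst w) - q)"
  \<comment> \<open>Regrouped so that every product contains one of the centred factors treated in
    \<open>z3\<close> to \<open>z6\<close>.\<close>
  have L: "?L = ?L'" by (rule ext) (simp add: bregman_def algebra_simps)
  let ?R' = "\<lambda>w. a (Z w) - a (T (fst w)) - deriv a (T (fst w)) * (Z w - T (fst w))"
  have "(\<integral>w. ?L' w \<partial>?M) \<le> (\<integral>w. ?R' w \<partial>?M)"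
  proof (rule integral_mono)
    show "integrable ?M ?L'" using i1 i3 i4 by auto
    show "integrable ?M ?R'" using i1 i2 by auto
    fix w assume w: "w \<in> space ?M"
    have "?L w \<le> bregman a (Z w) (T (fst w))"
      using bregman_above_tangent[OF a, of "P (snd w)" q "Z w" "T (fst w)"] bspec[OF T1(2) w] bspec[OF P1(2) w] qb Z(2)[of w] l
      by auto
    then show "?L' w \<le> ?R' w" using fun_cong[OF L, of w] by (simp add: bregman_def)
  qed
  also have "(\<integral>w. ?R' w \<partial>?M) = (\<integral>w. a (Z w) \<partial>?M) - (\<integral>x. a (T x) \<partial>M1)"
    using i1 i2 z2 s1[OF i1(4)] by simp
  also have "(\<integral>w. ?L' w \<partial>?M) = (\<integral>y. a (P y) \<partial>M2) - a q"
  proof -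
    have "(\<integral>w. ?L' w \<partial>?M) = (\<integral>w. a (P (snd w)) \<partial>?M) - a q - deriv a q * ((\<integral>w. P (snd w) \<partial>?M) - q)
     + (\<integral>w. deriv a (P (snd w)) * (Z w - P (snd w)) \<partial>?M) - deriv a q * (\<integral>w. Z w - P (snd w) \<partial>?M)
     - (deriv ^^ 2) a q * (\<integral>w. P (snd w) * (T (fst w) - q) \<partial>?M) + (deriv ^^ 2) a q * q * (\<integral>w. T (fst w) - q \<partial>?M)"
      using i1 i3 i4 by (simp add: P.prob_space)
    moreover have "(\<integral>w. a (P (snd w)) \<partial>?M) = (\<integral>y. a (P y) \<partial>M2)" "(\<integral>w. P (snd w) \<partial>?M) = q"
      using s2[of "\<lambda>y. a (P y)"] s2[of P] i1 P_Z by simp_all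
    ultimately show ?thesis unfolding z3 z4 z5 z6 by simp
  qed
  finally have "(\<integral>y. a (P y) \<partial>M2) - a q \<le> (\<integral>w. a (Z w) \<partial>?M) - (\<integral>x. a (T x) \<partial>M1)" .
  moreover have "(\<integral>w. a (Z w) \<partial>?M) = (\<integral>x. \<integral>y. a (Z (x, y)) \<partial>M2 \<partial>M1)"
    using integral_fst'[OF i1(6)] by simp
  ultimately show ?thesis by (simp add: P_def T_def q_def)
qed

section \<open>Characteristic functions\<close>

definition cf :: "'a::euclidean_space measure \<Rightarrow> 'a \<Rightarrow> complex" where
  "cf \<mu> \<xi> = (\<integral>x. cis (\<xi> \<bullet> x) \<partial>\<mu>)"

abbreviation borel_prob :: "'a::euclidean_space measure \<Rightarrow> bool" where
  "borel_prob \<mu> \<equiv> prob_space \<mu> \<and> sets \<mu> = sets borel"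

lemma borel_measurable_cis [measurable (raw)]:
  assumes "f \<in> borel_measurable M"
  shows "(\<lambda>x. cis (f x)) \<in> borel_measurable M"
  using assms by (rule measurable_compose) (intro borel_measurable_continuous_onI continuous_on_cis continuous_on_id)

lemma (in prob_space) integrable_cis:
  "f \<in> borel_measurable M \<Longrightarrow> integrable M (\<lambda>x. cis (f x))"
  by (rule integrable_const_bound[where B = 1]) auto

lemma (in pair_prob_space) integral_cis_add:
  assumes f: "f \<in> borel_measurable M1" and g: "g \<in> borel_measurable M2"
  shows "(\<integral>w. cis (f (fst w) + g (snd w)) \<partial>(M1 \<Otimes>\<^sub>M M2)) = (\<integral>x. cis (f x) \<partial>M1) * (\<integral>y. cis (g y) \<partial>M2)"
proof -
  have i: "integrable (M1 \<Otimes>\<^sub>M M2) (\<lambda>w. cis (f (fst w) + g (snd w)))"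
    by (rule P.integrable_cis) (use f g in measurable)
  have "(\<integral>w. cis (f (fst w) + g (snd w)) \<partial>(M1 \<Otimes>\<^sub>M M2)) = (\<integral>x. \<integral>y. cis (f x) * cis (g y) \<partial>M2 \<partial>M1)"
    using integral_fst'[OF i] by (simp add: cis_mult)
  then show ?thesis by simp
qed

lemma cf_distr_pair:
  assumes "prob_space M1" "prob_space M2"
    and f[measurable]: "f \<in> M1 \<rightarrow>\<^sub>M borel" and g[measurable]: "g \<in> M2 \<rightarrow>\<^sub>M borel"
  shows "cf (distr (M1 \<Otimes>\<^sub>M M2) borel (\<lambda>w. f (fst w) + g (snd w))) \<xi>
     = (\<integral>x. cis (\<xi> \<bullet> f x) \<partial>M1) * (\<integral>y. cis (\<xi> \<bullet> g y) \<partial>M2)"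
proof -
  interpret M1: prob_space M1 by fact
  interpret M2: prob_space M2 by fact
  interpret pair_prob_space M1 M2 ..
  show ?thesis unfolding cf_def
    by (subst integral_distr) (auto simp: inner_add_right integral_cis_add[of "\<lambda>x. \<xi> \<bullet> f x" "\<lambda>x. \<xi> \<bullet> g x", symmetric])
qed

lemma borel_prob_distr:
  "prob_space M \<Longrightarrow> f \<in> M \<rightarrow>\<^sub>M borel \<Longrightarrow> borel_prob (distr M borel f)"
  by (auto intro: prob_space.prob_space_distr)

lemma prob_space_pair: "prob_space M1 \<Longrightarrow> prob_space M2 \<Longrightarrow> prob_space (M1 \<Otimes>\<^sub>M M2)"
proof -
  assume "prob_space M1" "prob_space M2"
  then interpret M1: prob_space M1 + M2: prob_space M2 by auto
  interpret pair_prob_space M1 M2 ..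
  show ?thesis by unfold_locales
qed

text \<open>Described by the characteristic function and not by a density, so that \<open>S\<close>
  may be singular, down to the Dirac mass for \<open>S = 0\<close>.\<close>

definition centered_gaussian :: "real^'n^'n \<Rightarrow> (real^'n) measure \<Rightarrow> bool" where
  "centered_gaussian S \<mu> \<longleftrightarrow> borel_prob \<mu> \<and> (\<forall>\<xi>. cf \<mu> \<xi> = complex_of_real (exp (- (\<xi> \<bullet> (S *v \<xi>)) / 2)))"

lemma integral_cis_std_normal: "(\<integral>x. cis (t * x) \<partial>std_normal_distribution) = complex_of_real (exp (- t\<^sup>2 / 2))"
  using fun_cong[OF char_std_normal_distribution, of t] by (simp add: char_def cis_conv_exp)

lemma symmetric_matrix_inner:
  fixes S :: "real^'n^'n"
  assumes "transpose S = S"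
  shows "x \<bullet> (S *v y) = y \<bullet> (S *v x)"
  by (metis assms dot_lmul_matrix inner_commute vector_transpose_matrix)

lemma psd_matrix_cauchy_schwarz:
  assumes S: "psd_matrix S" and c: "v \<bullet> (S *v v) > 0"
  shows "(x \<bullet> (S *v v))\<^sup>2 / (v \<bullet> (S *v v)) \<le> x \<bullet> (S *v x)"
proof -
  let ?c = "v \<bullet> (S *v v)" and ?b = "x \<bullet> (S *v v)"
  \<comment> \<open>Minimiser of the quadratic polynomial whose value at t is the form at x + t
    v.\<close>
  define t where "t = - ?b / ?c"
  have "0 \<le> (x + t *\<^sub>R v) \<bullet> (S *v (x + t *\<^sub>R v))" using S by (simp add: psd_matrix_def)
  also have "\<dots> = x \<bullet> (S *v x) + 2 * t * ?b + t\<^sup>2 * ?c"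
    using symmetric_matrix_inner[of S v x] S
    by (simp add: psd_matrix_def matrix_vector_right_distrib matrix_vector_mult_scaleR inner_add_left inner_add_right
        power2_eq_square algebra_simps)
  also have "\<dots> = x \<bullet> (S *v x) - ?b\<^sup>2 / ?c"
    using c by (simp add: t_def field_simps power2_eq_square)
  finally show ?thesis by simp
qed

text \<open>Splitting off a one-dimensional Gaussian along \<open>S v\<close> enlarges the kernel of \<open>S\<close> by \<open>v\<close>.\<close>

lemma centered_gaussian_exists:
  fixes S :: "real^'n^'n"
  assumes "psd_matrix S"
  shows "\<exists>\<mu>. centered_gaussian S \<mu>"
  using assms
proof (induction "CARD('n) - dim {x. S *v x = 0}" arbitrary: S rule: less_induct)
  case less
  note S = less.prems
  show ?case
  proof (cases "\<forall>v. v \<bullet> (S *v v) = 0")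
    case True
    interpret prob_space "return borel (0::real^'n)" by (rule prob_space_return) simp
    have "cf (return borel (0::real^'n)) \<xi> = 1" for \<xi>
      unfolding cf_def by (subst integral_return) auto
    then show ?thesis using True
      by (intro exI[of _ "return borel 0"]) (auto simp: centered_gaussian_def prob_space_axioms)
  next
    case False
    then obtain v where "v \<bullet> (S *v v) \<noteq> 0" by blast
    then have v: "v \<bullet> (S *v v) > 0" using S unfolding psd_matrix_def by (metis less_eq_real_def)
    define c where "c = v \<bullet> (S *v v)"
    define u where "u = S *v v"
    \<comment> \<open>The rank-one part carried by u = S v is removed; Cauchy-Schwarz for
      \<open>S\<close> says that what remains is still positive semidefinite.\<close>
    define S' where "S' = (\<chi> i j. S $ i $ j - u $ i * u $ j / c)"
    have S'x: "S' *v x = S *v x - ((u \<bullet> x) / c) *\<^sub>R u" for x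
      by (simp add: vec_eq_iff S'_def matrix_vector_mult_def inner_vec_def algebra_simps
          sum_subtractf sum_distrib_left sum_divide_distrib)
    have xu: "x \<bullet> u = v \<bullet> (S *v x)" for x
      using symmetric_matrix_inner[of S x v] S by (simp add: u_def psd_matrix_def)
    have q: "x \<bullet> (S' *v x) = x \<bullet> (S *v x) - (x \<bullet> u)\<^sup>2 / c" for x
      by (simp add: S'x inner_diff_right inner_commute power2_eq_square)
    have S': "psd_matrix S'"
      unfolding psd_matrix_def
    proof
      show "transpose S' = S'" using S
        by (simp add: psd_matrix_def transpose_def S'_def vec_eq_iff mult.commute)
      show "\<forall>x. 0 \<le> x \<bullet> (S' *v x)"
        using psd_matrix_cauchy_schwarz[OF S v] by (simp add: q u_def c_def)
    qed
    have sub: "Real_Vector_Spaces.subspace {x. A *v x = 0}" for A :: "real^'n^'n"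
      by (auto simp: Real_Vector_Spaces.subspace_def matrix_vector_right_distrib matrix_vector_mult_scaleR)
    have "{x. S *v x = 0} \<subset> {x. S' *v x = 0}"
    proof -
      have "S' *v x = 0" if "S *v x = 0" for x
        using that xu[of x] by (simp add: S'x inner_commute)
      moreover have "S' *v v = 0" using v by (simp add: S'x u_def c_def inner_commute)
      moreover have "S *v v \<noteq> 0" using v by auto
      ultimately show ?thesis by blast
    qed
    then have "dim {x. S *v x = 0} < dim {x. S' *v x = 0}"
      using dim_psubset[of "{x. S *v x = 0}" "{x. S' *v x = 0}"] by (simp add: span_eq_iff[THEN iffD2, OF sub])
    moreover have "dim {x. S' *v x = 0} \<le> CARD('n)"
      using dim_subset_UNIV[of "{x. S' *v x = 0}"] by simp
    ultimately obtain \<mu>' where \<mu>': "centered_gaussian S' \<mu>'"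
      using less.hyps[OF _ S'] by (auto simp: diff_less_mono2)
    then have p: "prob_space \<mu>'" and s[measurable_cong]: "sets \<mu>' = sets borel"
      by (auto simp: centered_gaussian_def)
    \<comment> \<open>The factor 1 / sqrt c gives the random multiple of \<open>u\<close> the form
      (\<xi> \<bullet> u)^2 / c, exactly what was subtracted in \<open>S'\<close>.\<close>
    let ?g = "\<lambda>w. (fst w / sqrt c) *\<^sub>R u + snd w"
    let ?\<mu> = "distr (std_normal_distribution \<Otimes>\<^sub>M \<mu>') borel ?g"
    have pn: "prob_space std_normal_distribution" by (rule prob_space_normal_density) simp
    have bp: "borel_prob ?\<mu>"
      by (rule borel_prob_distr[OF prob_space_pair[OF pn p]]) measurable
    have "cf ?\<mu> \<xi> = complex_of_real (exp (- (\<xi> \<bullet> (S *v \<xi>)) / 2))" for \<xi>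
    proof -
      have "cf ?\<mu> \<xi> = (\<integral>x. cis (\<xi> \<bullet> ((x / sqrt c) *\<^sub>R u)) \<partial>std_normal_distribution) * (\<integral>y. cis (\<xi> \<bullet> y) \<partial>\<mu>')"
        by (rule cf_distr_pair[OF pn p, of "\<lambda>x. (x / sqrt c) *\<^sub>R u" "\<lambda>y. y"]) measurable
      also have "(\<integral>x. cis (\<xi> \<bullet> ((x / sqrt c) *\<^sub>R u)) \<partial>std_normal_distribution) = complex_of_real (exp (- (\<xi> \<bullet> u)\<^sup>2 / c / 2))"
        using integral_cis_std_normal[of "\<xi> \<bullet> u / sqrt c"] v by (simp add: c_def mult.commute power_divide)
      also have "(\<integral>y. cis (\<xi> \<bullet> y) \<partial>\<mu>') = complex_of_real (exp (- (\<xi> \<bullet> (S' *v \<xi>)) / 2))"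
        using \<mu>' by (simp add: centered_gaussian_def cf_def)
      also have "complex_of_real (exp (- (\<xi> \<bullet> u)\<^sup>2 / c / 2)) * complex_of_real (exp (- (\<xi> \<bullet> (S' *v \<xi>)) / 2))
          = complex_of_real (exp (- (\<xi> \<bullet> (S *v \<xi>)) / 2))"
        unfolding of_real_mult[symmetric] exp_add[symmetric] q by (simp add: field_simps)
      finally show ?thesis .
    qed
    with bp show ?thesis unfolding centered_gaussian_def by blast
  qed
qed

text \<open>Closed sets form an intersection-stable generator of the Borel sets, and the indicator
  of a closed set is the pointwise limit of the continuous functions max 0 (1 - k * infdist x
  C).\<close>

lemma borel_prob_eqI:
  fixes \<mu> \<nu> :: "'a::euclidean_space measure"
  assumes \<mu>: "borel_prob \<mu>" and \<nu>: "borel_prob \<nu>"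
    and eq: "\<And>f::'a \<Rightarrow> real. continuous_on UNIV f \<Longrightarrow> (\<And>x. 0 \<le> f x) \<Longrightarrow> (\<And>x. f x \<le> 1) \<Longrightarrow> (\<integral>x. f x \<partial>\<mu>) = (\<integral>x. f x \<partial>\<nu>)"
  shows "\<mu> = \<nu>"
proof -
  interpret \<mu>: prob_space \<mu> using \<mu> by simp
  interpret \<nu>: prob_space \<nu> using \<nu> by simp
  show ?thesis
  proof (rule measure_eqI_generator_eq[where E = "{C. closed C}" and \<Omega> = UNIV and A = "\<lambda>_. UNIV"])
    fix C :: "'a set" assume "C \<in> {C. closed C}"
    then have C: "closed C" by simp
    have *: "(\<lambda>k. \<integral>x. max 0 (1 - real k * infdist x C) \<partial>M) \<longlonglongrightarrow> measure M C"
      if M: "prob_space M" "sets M = sets borel" "C \<noteq> {}" for M :: "'a measure"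
    proof -
      interpret prob_space M by fact
      note [measurable_cong] = M(2)
      have [measurable]: "C \<in> sets M" using C M(2) by auto
      have "(\<lambda>k. \<integral>x. max 0 (1 - real k * infdist x C) \<partial>M) \<longlonglongrightarrow> (\<integral>x. indicator C x \<partial>M)"
      proof (rule integral_dominated_convergence[where w = "\<lambda>_. 1"])
        show "(\<lambda>x. max 0 (1 - real k * infdist x C)) \<in> borel_measurable M" for k
        proof -
          have "(\<lambda>x::'a. max 0 (1 - real k * infdist x C)) \<in> borel_measurable borel"
            by (intro borel_measurable_continuous_onI continuous_intros)
          then show ?thesis using M(2) by (simp cong: measurable_cong_sets)
        qed
        show "AE x in M. norm (max 0 (1 - real k * infdist x C)) \<le> 1" for k
          by (auto simp: infdist_nonneg)
        show "AE x in M. (\<lambda>k. max 0 (1 - real k * infdist x C)) \<longlonglongrightarrow> indicator C x"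
        proof (rule AE_I2)
          fix x
          show "(\<lambda>k. max 0 (1 - real k * infdist x C)) \<longlonglongrightarrow> indicator C x"
          proof (cases "x \<in> C")
            case False
            then have pos: "infdist x C > 0"
              using in_closed_iff_infdist_zero[OF C that(3), of x] infdist_nonneg[of x C] by simp
            obtain N :: nat where N: "real N * infdist x C > 1"
              using reals_Archimedean3[OF pos] by blast
            have "\<forall>\<^sub>F k in sequentially. max 0 (1 - real k * infdist x C) = indicator C x"
              using eventually_ge_at_top[of N]
            proof eventually_elim
              case (elim k)
              have "real N * infdist x C \<le> real k * infdist x C"
                using elim pos by (intro mult_right_mono) auto
              then show ?case using N False by simp
            qed
            then show ?thesis by (rule tendsto_eventually)
          qed simp
        qed
      qed auto
      then show ?thesis by simp
    qed
    have "measure \<mu> C = measure \<nu> C"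
    \<comment> \<open>The distance to the empty set is 0 by convention, so for it the approximating
      functions would converge to 1.\<close>
    proof (cases "C = {}")
      case False
      have "(\<integral>x. max 0 (1 - real k * infdist x C) \<partial>\<mu>) = (\<integral>x. max 0 (1 - real k * infdist x C) \<partial>\<nu>)" for k
        by (rule eq) (auto intro!: continuous_intros simp: infdist_nonneg)
      with *[of \<mu>] *[of \<nu>] \<mu> \<nu> False show ?thesis by (auto intro: LIMSEQ_unique)
    qed simp
    then show "emeasure \<mu> C = emeasure \<nu> C"
      by (simp add: \<mu>.emeasure_eq_measure \<nu>.emeasure_eq_measure)
  qed (use \<mu> \<nu> in \<open>auto simp: Int_stable_def borel_eq_closed space_borel \<mu>.emeasure_eq_measure\<close>)
qed

text \<open>A Gaussian is up to scaling its own Fourier transform: the bump at y is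
  \<open>cf \<gamma>\<close> at c (y - m), and Fubini turns its integral over \<open>\<mu>\<close>
  into one in which \<open>\<mu>\<close> appears only through \<open>cf \<mu>\<close>.\<close>

lemma cf_bump:
  fixes \<mu> :: "(real^'n) measure"
  assumes \<mu>: "borel_prob \<mu>" and \<gamma>: "centered_gaussian (mat 1) \<gamma>"
  shows "complex_of_real (\<integral>y. exp (- (norm (c *\<^sub>R (y - m)))\<^sup>2 / 2) \<partial>\<mu>) = (\<integral>z. cis (- (c * (z \<bullet> m))) * cf \<mu> (c *\<^sub>R z) \<partial>\<gamma>)"
proof -
  note [measurable_cong] = \<mu>[THEN conjunct2]
  have s[measurable_cong]: "sets \<gamma> = sets borel" using \<gamma> by (simp add: centered_gaussian_def)
  interpret \<mu>: prob_space \<mu> using \<mu> by simp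
  interpret \<gamma>: prob_space \<gamma> using \<gamma> by (simp add: centered_gaussian_def)
  interpret pair_prob_space \<gamma> \<mu> ..
  have "complex_of_real (\<integral>y. exp (- (norm (c *\<^sub>R (y - m)))\<^sup>2 / 2) \<partial>\<mu>) = (\<integral>y. complex_of_real (exp (- (norm (c *\<^sub>R (y - m)))\<^sup>2 / 2)) \<partial>\<mu>)"
    by (simp only: integral_complex_of_real)
  also have "\<dots> = (\<integral>y. cf \<gamma> (c *\<^sub>R (y - m)) \<partial>\<mu>)"
    using \<gamma> by (simp only: centered_gaussian_def matrix_vector_mul_lid power2_norm_eq_inner)
  also have "\<dots> = (\<integral>y. \<integral>z. cis ((c *\<^sub>R (y - m)) \<bullet> z) \<partial>\<gamma> \<partial>\<mu>)"
    by (simp only: cf_def)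
  also have "\<dots> = (\<integral>z. \<integral>y. cis ((c *\<^sub>R (y - m)) \<bullet> z) \<partial>\<mu> \<partial>\<gamma>)"
    by (rule Fubini_integral) (auto intro!: P.integrable_cis simp: split_def)
  also have "\<dots> = (\<integral>z. \<integral>y. cis (- (c * (z \<bullet> m))) * cis ((c *\<^sub>R z) \<bullet> y) \<partial>\<mu> \<partial>\<gamma>)"
    by (simp add: cis_mult inner_diff_left inner_commute algebra_simps)
  also have "\<dots> = (\<integral>z. cis (- (c * (z \<bullet> m))) * cf \<mu> (c *\<^sub>R z) \<partial>\<gamma>)"
    by (simp add: cf_def)
  finally show ?thesis .
qed

lemma std_normal_product:
  fixes z :: "'a::euclidean_space"
  shows "(\<Prod>b\<in>Basis. std_normal_density (z \<bullet> b)) = (1 / sqrt (2 * pi)) ^ DIM('a) * exp (- (norm z)\<^sup>2 / 2)"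
proof -
  have "(norm z)\<^sup>2 = (\<Sum>b\<in>Basis. (z \<bullet> b)\<^sup>2)"
    unfolding power2_norm_eq_inner by (subst euclidean_inner) (simp only: power2_eq_square)
  then show ?thesis
    by (simp add: std_normal_density_def prod.distrib prod_dividef exp_sum[symmetric] sum_negf sum_divide_distrib power_one_over)
qed

text \<open>Convolving \<open>\<mu>\<close> with a narrow Gaussian yields integrals of Gaussian bumps, which are determined
  by the characteristic function.\<close>

theorem cf_unique:
  fixes \<mu> \<nu> :: "(real^'n) measure"
  assumes \<mu>: "borel_prob \<mu>" and \<nu>: "borel_prob \<nu>" and eq: "\<And>\<xi>. cf \<mu> \<xi> = cf \<nu> \<xi>"
  shows "\<mu> = \<nu>"
proof (rule borel_prob_eqI[OF \<mu> \<nu>])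
  obtain \<gamma> :: "(real^'n) measure" where \<gamma>: "centered_gaussian (mat 1) \<gamma>"
    using centered_gaussian_exists[of "mat 1 :: real^'n^'n"] by (auto simp: psd_matrix_def transpose_mat)
  define k where "k = (1 / sqrt (2 * pi)) ^ DIM(real^'n)"
  have k: "k > 0" by (simp add: k_def)
  define w where "w z = k * exp (- (norm z)\<^sup>2 / 2)" for z :: "real^'n"
  have w_nonneg: "w z \<ge> 0" for z using k by (simp add: w_def)
  have [measurable]: "w \<in> borel_measurable borel" unfolding w_def by measurable
  \<comment> \<open>\<open>W\<close> and \<open>\<gamma>\<close> are two descriptions of the
    standard normal law and are never identified: the density of \<open>W\<close> serves the change
    of variables, the characteristic function of \<open>\<gamma>\<close> serves
    \<open>cf_bump\<close>.\<close>
  define W where "W = density lborel (\<lambda>z. ennreal (w z))"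
  have [measurable_cong]: "sets W = sets borel" by (simp add: W_def)
  have w_prod: "ennreal (w z) = (\<Prod>b\<in>Basis. ennreal (std_normal_density (z \<bullet> b)))" for z
    unfolding w_def k_def std_normal_product[symmetric] by (rule prod_ennreal[symmetric]) simp
  have one: "(\<integral>\<^sup>+x. ennreal (std_normal_density x) \<partial>lborel) = 1"
    using prob_space.emeasure_space_1[OF prob_space_normal_density[of 1 0]] by (simp add: emeasure_density)
  have "emeasure W (space W) = (\<integral>\<^sup>+z. ennreal (w z) \<partial>lborel)"
    by (simp add: W_def emeasure_density)
  also have "\<dots> = (\<Prod>b\<in>(Basis::(real^'n) set). (\<integral>\<^sup>+x. ennreal (std_normal_density x) \<partial>lborel))"
    unfolding w_prod by (rule nn_integral_lborel_prod) auto
  finally have "emeasure W (space W) = 1" by (simp add: one)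
  then interpret W: prob_space W by (rule prob_spaceI)
  fix f :: "real^'n \<Rightarrow> real"
  assume cont: "continuous_on UNIV f" and f0: "\<And>x. 0 \<le> f x" and f1: "\<And>x. f x \<le> 1"
  have [measurable]: "f \<in> borel_measurable borel" by (rule borel_measurable_continuous_onI[OF cont])
  \<comment> \<open>With m = y + e z as integration variable the noise density becomes a bump of
    width e centred at m, and Tonelli moves the integral over \<open>M\<close> inside, where
    \<open>bump\<close> applies.\<close>
  have nn: "(\<integral>\<^sup>+y. \<integral>\<^sup>+z. ennreal (f (y + e *\<^sub>R z)) \<partial>W \<partial>M) =
      (\<integral>\<^sup>+m. ennreal (\<bar>1 / e\<bar> ^ CARD('n)) * ennreal (f m) * ennreal (k * (\<integral>y. exp (- (norm ((1 / e) *\<^sub>R (y - m)))\<^sup>2 / 2) \<partial>M)) \<partial>lborel)"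
    if e: "e > 0" and M: "borel_prob M" for e :: real and M :: "(real^'n) measure"
  proof -
    note [measurable_cong] = M[THEN conjunct2]
    interpret M: prob_space M using M by simp
    interpret pair_sigma_finite M "lborel :: (real^'n) measure" ..
    have inner: "(\<integral>\<^sup>+z. ennreal (f (y + e *\<^sub>R z)) \<partial>W) = 
        (\<integral>\<^sup>+m. ennreal (\<bar>1 / e\<bar> ^ CARD('n)) * ennreal (f m) * ennreal (w ((1 / e) *\<^sub>R (y - m))) \<partial>lborel)" for y
    proof -
      have 1: "(\<integral>\<^sup>+z. ennreal (f (y + e *\<^sub>R z)) \<partial>W) = (\<integral>\<^sup>+z. ennreal (w z) * ennreal (f (y + e *\<^sub>R z)) \<partial>lborel)"
        unfolding W_def by (rule nn_integral_density) measurable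
      have e': "1 / e \<noteq> 0" using e by simp
      have 2: "(\<integral>\<^sup>+z. ennreal (w z) * ennreal (f (y + e *\<^sub>R z)) \<partial>lborel) = 
         (\<integral>\<^sup>+m. ennreal (\<bar>1 / e\<bar> ^ DIM(real^'n)) * (ennreal (w (- (1 / e) *\<^sub>R y + (1 / e) *\<^sub>R m)) * ennreal (f (y + e *\<^sub>R (- (1 / e) *\<^sub>R y + (1 / e) *\<^sub>R m)))) \<partial>lborel)"
        by (subst lborel_affine[OF e', of "- (1 / e) *\<^sub>R y"])
          (simp add: nn_integral_density nn_integral_distr)
      have 3: "y + e *\<^sub>R (- (1 / e) *\<^sub>R y + (1 / e) *\<^sub>R m) = m" for m using e by (simp add: algebra_simps)
      \<comment> \<open>The density is even, so solving for z in terms of m - y or of y - m makes no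
        difference.\<close>
      have 4: "w (- (1 / e) *\<^sub>R y + (1 / e) *\<^sub>R m) = w ((1 / e) *\<^sub>R (y - m))" for m
      proof -
        have "- (1 / e) *\<^sub>R y + (1 / e) *\<^sub>R m = - ((1 / e) *\<^sub>R (y - m))" by (simp add: algebra_simps)
        then show ?thesis by (simp only: w_def norm_minus_cancel)
      qed
      show ?thesis unfolding 1 2 3 4 by (simp add: mult_ac)
    qed
    have sw: "(\<integral>\<^sup>+y. \<integral>\<^sup>+z. ennreal (f (y + e *\<^sub>R z)) \<partial>W \<partial>M)
      = (\<integral>\<^sup>+m. \<integral>\<^sup>+y. ennreal (\<bar>1 / e\<bar> ^ CARD('n)) * ennreal (f m) * ennreal (w ((1 / e) *\<^sub>R (y - m))) \<partial>M \<partial>lborel)"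
      unfolding inner by (subst Fubini') (simp_all add: split_def)
    have inner2: "(\<integral>\<^sup>+y. ennreal (\<bar>1 / e\<bar> ^ CARD('n)) * ennreal (f m) * ennreal (w ((1 / e) *\<^sub>R (y - m))) \<partial>M)
      = ennreal (\<bar>1 / e\<bar> ^ CARD('n)) * ennreal (f m) * ennreal (k * (\<integral>y. exp (- (norm ((1 / e) *\<^sub>R (y - m)))\<^sup>2 / 2) \<partial>M))" for m
    proof -
      have i: "integrable M (\<lambda>y. exp (- (norm ((1 / e) *\<^sub>R (y - m)))\<^sup>2 / 2))"
        by (rule M.integrable_const_bound[where B = 1]) auto
      have "(\<integral>\<^sup>+y. ennreal (w ((1 / e) *\<^sub>R (y - m))) \<partial>M) = ennreal (\<integral>y. w ((1 / e) *\<^sub>R (y - m)) \<partial>M)"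
        by (rule nn_integral_eq_integral) (use i w_nonneg in \<open>simp_all add: w_def del: norm_scaleR\<close>)
      then show ?thesis by (simp add: nn_integral_cmult w_def)
    qed
    show ?thesis unfolding sw inner2 ..
  qed
  have bump: "(\<integral>y. exp (- (norm (c *\<^sub>R (y - m)))\<^sup>2 / 2) \<partial>\<mu>) = (\<integral>y. exp (- (norm (c *\<^sub>R (y - m)))\<^sup>2 / 2) \<partial>\<nu>)" for c m
  proof -
    have "complex_of_real (\<integral>y. exp (- (norm (c *\<^sub>R (y - m)))\<^sup>2 / 2) \<partial>\<mu>) = complex_of_real (\<integral>y. exp (- (norm (c *\<^sub>R (y - m)))\<^sup>2 / 2) \<partial>\<nu>)"
      unfolding cf_bump[OF \<mu> \<gamma>] cf_bump[OF \<nu> \<gamma>] eq ..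
    then show ?thesis by (simp only: of_real_eq_iff)
  qed
  \<comment> \<open>Vanishing noise: bounded convergence is applied twice, under \<open>W\<close> by
    continuity of \<open>f\<close> and then under \<open>M\<close>.\<close>
  have lim: "(\<lambda>j. \<integral>y. \<integral>z. f (y + (1 / Suc j) *\<^sub>R z) \<partial>W \<partial>M) \<longlonglongrightarrow> (\<integral>y. f y \<partial>M)" if M: "borel_prob M" for M
  proof -
    note [measurable_cong] = M[THEN conjunct2]
    interpret M: prob_space M using M by simp
    have b: "norm (\<integral>z. f (y + (1 / Suc j) *\<^sub>R z) \<partial>W) \<le> 1" for y j
    proof -
      have "integrable W (\<lambda>z. f (y + (1 / Suc j) *\<^sub>R z))"
        by (rule W.integrable_const_bound[where B = 1]) (use f0 f1 in auto)
      then have "(\<integral>z. f (y + (1 / Suc j) *\<^sub>R z) \<partial>W) \<le> 1" by (rule W.integral_le_const) (use f1 in auto)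
      moreover have "0 \<le> (\<integral>z. f (y + (1 / Suc j) *\<^sub>R z) \<partial>W)" using f0 by simp
      ultimately show ?thesis by simp
    qed
    have m[measurable]: "f \<in> borel_measurable M" "(\<lambda>y. \<integral>z. f (y + c *\<^sub>R z) \<partial>W) \<in> borel_measurable M" for c
      by measurable
    show ?thesis
    proof (rule integral_dominated_convergence[where w = "\<lambda>_. 1"])
      show "AE y in M. (\<lambda>j. \<integral>z. f (y + (1 / Suc j) *\<^sub>R z) \<partial>W) \<longlonglongrightarrow> f y"
      proof (rule AE_I2)
        fix y
        have "(\<lambda>j. \<integral>z. f (y + (1 / Suc j) *\<^sub>R z) \<partial>W) \<longlonglongrightarrow> (\<integral>z. f y \<partial>W)"
        proof (rule integral_dominated_convergence[where w = "\<lambda>_. 1"])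
          show "AE z in W. (\<lambda>j. f (y + (1 / Suc j) *\<^sub>R z)) \<longlonglongrightarrow> f y"
          proof (rule AE_I2)
            fix z
            have "(\<lambda>j. y + (1 / Suc j) *\<^sub>R z) \<longlonglongrightarrow> y + 0 *\<^sub>R z"
              using LIMSEQ_inverse_real_of_nat by (intro tendsto_intros) (simp add: inverse_eq_divide)
            then show "(\<lambda>j. f (y + (1 / Suc j) *\<^sub>R z)) \<longlonglongrightarrow> f y"
              using continuous_on_tendsto_compose[OF cont] by simp
          qed
        qed (use f0 f1 in auto)
        then show "(\<lambda>j. \<integral>z. f (y + (1 / Suc j) *\<^sub>R z) \<partial>W) \<longlonglongrightarrow> f y" by (simp add: W.prob_space)
      qed
    qed (use b in auto)
  qed
  have conv: "ennreal (\<integral>y. \<integral>z. f (y + e *\<^sub>R z) \<partial>W \<partial>M) = (\<integral>\<^sup>+y. \<integral>\<^sup>+z. ennreal (f (y + e *\<^sub>R z)) \<partial>W \<partial>M)"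
    if M: "borel_prob M" for M e
  proof -
    note [measurable_cong] = M[THEN conjunct2]
    interpret M: prob_space M using M by simp
    have i: "integrable W (\<lambda>z. f (y + e *\<^sub>R z))" for y
      by (rule W.integrable_const_bound[where B = 1]) (use f0 f1 in auto)
    have b: "(\<integral>z. f (y + e *\<^sub>R z) \<partial>W) \<le> 1" for y
      by (rule W.integral_le_const[OF i]) (use f1 in auto)
    have ii: "integrable M (\<lambda>y. \<integral>z. f (y + e *\<^sub>R z) \<partial>W)"
      by (rule M.integrable_const_bound[where B = 1]) (use f0 b in auto)
    show ?thesis
      using nn_integral_eq_integral[OF i] nn_integral_eq_integral[OF ii] f0 by (simp add: integral_nonneg_AE)
  qed
  have "(\<integral>y. \<integral>z. f (y + (1 / Suc j) *\<^sub>R z) \<partial>W \<partial>\<mu>) = (\<integral>y. \<integral>z. f (y + (1 / Suc j) *\<^sub>R z) \<partial>W \<partial>\<nu>)" for j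
  proof -
    have "ennreal (\<integral>y. \<integral>z. f (y + (1 / Suc j) *\<^sub>R z) \<partial>W \<partial>\<mu>) = ennreal (\<integral>y. \<integral>z. f (y + (1 / Suc j) *\<^sub>R z) \<partial>W \<partial>\<nu>)"
    proof -
      have e: "0 < 1 / real (Suc j)" by simp
      show ?thesis unfolding conv[OF \<mu>] conv[OF \<nu>] nn[OF e \<mu>] nn[OF e \<nu>] bump ..
    qed
    then show ?thesis using f0 by (simp add: integral_nonneg_AE)
  qed
  then show "(\<integral>x. f x \<partial>\<mu>) = (\<integral>x. f x \<partial>\<nu>)"
    using lim[OF \<mu>] lim[OF \<nu>] by (auto intro: LIMSEQ_unique)
qed

section \<open>Entropy along the Mehler semigroup\<close>

lemma inner_matrix_transpose: "\<xi> \<bullet> (A *v x) = (transpose A *v \<xi>) \<bullet> x" for A :: "real^'n^'m"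
  by (simp add: dot_lmul_matrix transpose_matrix_vector)

lemma borel_measurable_matrix_vector [measurable (raw)]:
  fixes A :: "real^'n^'m"
  assumes "f \<in> borel_measurable M"
  shows "(\<lambda>x. A *v f x) \<in> borel_measurable M"
  using assms
  by (rule measurable_compose)
    (intro borel_measurable_continuous_onI linear_continuous_on linear_conv_bounded_linear[THEN iffD1] matrix_vector_mul_linear)

lemma centered_gaussianD:
  assumes "centered_gaussian S \<mu>"
  shows "prob_space \<mu>" "sets \<mu> = sets borel" "(\<integral>x. cis (\<xi> \<bullet> x) \<partial>\<mu>) = complex_of_real (exp (- (\<xi> \<bullet> (S *v \<xi>)) / 2))"
  using assms by (auto simp: centered_gaussian_def cf_def)

text \<open>The hypothesis on the forms says that A1 S1 A1^T + A2 S2 A2^T and A3 S3 A3^T agree, so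
  A1 X + A2 Y and A3 Z have the same characteristic function and hence the same law.\<close>

lemma gaussian_pair_integral:
  fixes f :: "real^'n \<Rightarrow> real"
  assumes \<mu>1: "centered_gaussian S1 \<mu>1" and \<mu>2: "centered_gaussian S2 \<mu>2" and \<mu>3: "centered_gaussian S3 \<mu>3"
    and q: "\<And>\<xi>. (transpose A1 *v \<xi>) \<bullet> (S1 *v (transpose A1 *v \<xi>)) + (transpose A2 *v \<xi>) \<bullet> (S2 *v (transpose A2 *v \<xi>))
        = (transpose A3 *v \<xi>) \<bullet> (S3 *v (transpose A3 *v \<xi>))"
    and f: "f \<in> borel_measurable borel" "\<And>x. \<bar>f x\<bar> \<le> C"
  shows "(\<integral>x. \<integral>y. f (A1 *v x + A2 *v y) \<partial>\<mu>2 \<partial>\<mu>1) = (\<integral>z. f (A3 *v z) \<partial>\<mu>3)"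
proof -
  note p = centered_gaussianD(1)[OF \<mu>1] centered_gaussianD(1)[OF \<mu>2] centered_gaussianD(1)[OF \<mu>3]
  note [measurable_cong] = centered_gaussianD(2)[OF \<mu>1] centered_gaussianD(2)[OF \<mu>2] centered_gaussianD(2)[OF \<mu>3]
  note [measurable] = f(1)
  interpret \<mu>1: prob_space \<mu>1 by fact
  interpret \<mu>2: prob_space \<mu>2 by fact
  interpret pair_prob_space \<mu>1 \<mu>2 ..
  have "distr (\<mu>1 \<Otimes>\<^sub>M \<mu>2) borel (\<lambda>w. A1 *v fst w + A2 *v snd w) = distr \<mu>3 borel (\<lambda>z. A3 *v z)"
  proof (rule cf_unique)
    show "borel_prob (distr (\<mu>1 \<Otimes>\<^sub>M \<mu>2) borel (\<lambda>w. A1 *v fst w + A2 *v snd w))"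
      by (rule borel_prob_distr[OF prob_space_pair[OF p(1,2)]]) measurable
    show "borel_prob (distr \<mu>3 borel (\<lambda>z. A3 *v z))"
      by (rule borel_prob_distr[OF p(3)]) measurable
    fix \<xi>
    have "cf (distr (\<mu>1 \<Otimes>\<^sub>M \<mu>2) borel (\<lambda>w. A1 *v fst w + A2 *v snd w)) \<xi> =
       (\<integral>x. cis (\<xi> \<bullet> (A1 *v x)) \<partial>\<mu>1) * (\<integral>x. cis (\<xi> \<bullet> (A2 *v x)) \<partial>\<mu>2)"
      by (rule cf_distr_pair[OF p(1,2)]) measurable
    also have "\<dots> = complex_of_real (exp (- ((transpose A3 *v \<xi>) \<bullet> (S3 *v (transpose A3 *v \<xi>))) / 2))"
      unfolding inner_matrix_transpose[of \<xi>] centered_gaussianD(3)[OF \<mu>1] centered_gaussianD(3)[OF \<mu>2] q[symmetric]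
        of_real_mult[symmetric] exp_add[symmetric] by (simp add: field_simps)
    also have "\<dots> = cf (distr \<mu>3 borel (\<lambda>z. A3 *v z)) \<xi>"
      unfolding cf_def centered_gaussianD(3)[OF \<mu>3, symmetric]
      by (subst integral_distr) (auto simp: inner_matrix_transpose[of \<xi>])
    finally show "cf (distr (\<mu>1 \<Otimes>\<^sub>M \<mu>2) borel (\<lambda>w. A1 *v fst w + A2 *v snd w)) \<xi> = cf (distr \<mu>3 borel (\<lambda>z. A3 *v z)) \<xi>" .
  qed
  then have "(\<integral>x. f x \<partial>distr (\<mu>1 \<Otimes>\<^sub>M \<mu>2) borel (\<lambda>w. A1 *v fst w + A2 *v snd w)) = (\<integral>x. f x \<partial>distr \<mu>3 borel (\<lambda>z. A3 *v z))"
    by simp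
  then have "(\<integral>w. f (A1 *v fst w + A2 *v snd w) \<partial>(\<mu>1 \<Otimes>\<^sub>M \<mu>2)) = (\<integral>z. f (A3 *v z) \<partial>\<mu>3)"
    by (subst (asm) (1 2) integral_distr) auto
  moreover have "integrable (\<mu>1 \<Otimes>\<^sub>M \<mu>2) (\<lambda>w. f (A1 *v fst w + A2 *v snd w))"
    by (rule P.integrable_const_bound[where B = C]) (use f(2) in auto)
  ultimately show ?thesis using integral_fst' by fastforce
qed

lemma transpose_scalar_matrix: "transpose (c *\<^sub>R (mat 1 :: real^'n^'n)) = c *\<^sub>R mat 1"
  by (simp add: transpose_def mat_def vec_eq_iff)

lemma scalar_matrix_mult: "(c *\<^sub>R (mat 1 :: real^'n^'n)) *v x = c *\<^sub>R x"
  by (simp add: scaleR_matrix_vector_assoc[symmetric])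

text \<open>Two independent Brownian increments over times \<alpha>^2 and \<beta>^2 combine into one
  over \<gamma>^2. The Brownian motion of the overview is present only through this rule.\<close>

lemma gaussian_add:
  fixes f :: "real^'n \<Rightarrow> real"
  assumes \<mu>: "centered_gaussian S \<mu>" and r: "\<alpha>\<^sup>2 + \<beta>\<^sup>2 = \<gamma>\<^sup>2"
    and f: "f \<in> borel_measurable borel" "\<And>x. \<bar>f x\<bar> \<le> C"
  shows "(\<integral>x. \<integral>y. f (\<alpha> *\<^sub>R x + \<beta> *\<^sub>R y) \<partial>\<mu> \<partial>\<mu>) = (\<integral>z. f (\<gamma> *\<^sub>R z) \<partial>\<mu>)"
  using gaussian_pair_integral[OF \<mu> \<mu> \<mu>, of "\<alpha> *\<^sub>R mat 1" "\<beta> *\<^sub>R mat 1" "\<gamma> *\<^sub>R mat 1" f C] f r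
  by (simp add: transpose_scalar_matrix scalar_matrix_mult matrix_vector_mult_scaleR
      power2_eq_square distrib_right[symmetric] mult.assoc[symmetric])

text \<open>The increments \<open>d\<close> are non-decreasing, so the average of the first k of
  them is at most \<open>d k\<close>, which is at most the average of the other N - k.\<close>

lemma convex_sequence_chord:
  fixes s :: "nat \<Rightarrow> real"
  assumes "\<And>k. k + 2 \<le> N \<Longrightarrow> 2 * s (k + 1) \<le> s k + s (k + 2)" and k: "k \<le> N"
  shows "real N * (s k - s 0) \<le> real k * (s N - s 0)"
proof (cases "k = N")
  case False
  define d where "d i = s (Suc i) - s i" for i
  have mono: "d i \<le> d j" if "i \<le> j" "j < N" for i j
    using that
  proof (induction j rule: dec_induct)
    case (step j)
    then show ?case using assms(1)[of j] by (simp add: d_def)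
  qed simp
  have "s k - s 0 = (\<Sum>i<k. d i)" by (simp add: d_def sum_lessThan_telescope)
  also have "\<dots> \<le> real k * d k" using sum_bounded_above[of "{..<k}" d "d k"] mono[of _ k] k False by simp
  finally have 1: "s k - s 0 \<le> real k * d k" .
  have "real (N - k) * d k \<le> (\<Sum>i=k..<N. d i)" using sum_bounded_below[of "{k..<N}" "d k" d] mono[of k] by simp
  also have "\<dots> = s N - s k" using sum_Suc_diff'[of k N s] k by (simp add: d_def)
  finally have "real k * (real (N - k) * d k) \<le> real k * (s N - s k)" by (rule mult_left_mono) simp
  moreover have "real (N - k) * (s k - s 0) \<le> real (N - k) * (real k * d k)" by (rule mult_left_mono[OF 1]) simp
  ultimately show ?thesis using k by (simp add: algebra_simps of_nat_diff)
qed simp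

text \<open>For r = sqrt (1 - t) this is the conditional expectation of f (W_1) given W_t = v. In
  \<open>mehler_entropy\<close> the variable W_t is represented as sqrt t times a variable with law
  \<mu>.\<close>

definition gauss_smooth :: "(real^'n) measure \<Rightarrow> (real^'n \<Rightarrow> real) \<Rightarrow> real \<Rightarrow> real^'n \<Rightarrow> real" where
  "gauss_smooth \<mu> f r v = (\<integral>y. f (v + r *\<^sub>R y) \<partial>\<mu>)"

definition mehler_entropy :: "(real \<Rightarrow> real) \<Rightarrow> (real^'n) measure \<Rightarrow> (real^'n \<Rightarrow> real) \<Rightarrow> real \<Rightarrow> real" where
  "mehler_entropy a \<mu> f t = (\<integral>x. a (gauss_smooth \<mu> f (sqrt (1 - t)) (sqrt t *\<^sub>R x)) \<partial>\<mu>)"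

section \<open>Convexity of the entropy along the Mehler semigroup\<close>

context
  fixes Q :: "real^'n^'n" and \<mu> :: "(real^'n) measure" and a :: "real \<Rightarrow> real" and f :: "real^'n \<Rightarrow> real" and l u :: real
  assumes \<mu>: "centered_gaussian Q \<mu>" and a: "admissible a" and l: "0 < l"
    and f: "f \<in> borel_measurable borel" "\<And>x. f x \<in> {l..u}"
begin

interpretation prob_space \<mu> by (rule centered_gaussianD(1)[OF \<mu>])

lemma sets_gaussian [measurable_cong]: "sets \<mu> = sets borel" by (rule centered_gaussianD(2)[OF \<mu>])
lemma integrand_measurable [measurable]: "f \<in> borel_measurable borel" by (rule f(1))

private abbreviation "G \<equiv> gauss_smooth \<mu> f"
private abbreviation "\<phi> \<equiv> mehler_entropy a \<mu> f"

lemma gauss_smooth_measurable [measurable]: "G r \<in> borel_measurable borel"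
  unfolding gauss_smooth_def by measurable

lemma gauss_smooth_bounds: "G r v \<in> {l..u}"
  unfolding gauss_smooth_def by (rule integral_in_Icc) (use f(2) in auto)

lemma bounded_abs: "g \<in> {l..u} \<Longrightarrow> \<bar>g\<bar> \<le> u"
  using l by auto

lemma admissible_continuous_Icc: "continuous_on {l..u} a"
  by (rule continuous_on_subset[OF admissible_continuous[OF a]]) (use l in auto)

lemma admissible_bounded: "\<exists>A. \<forall>x\<in>{l..u}. \<bar>a x\<bar> \<le> A"
proof -
  have "compact (a ` {l..u})" by (rule compact_continuous_image[OF admissible_continuous_Icc]) auto
  then obtain B where "\<And>y. y \<in> a ` {l..u} \<Longrightarrow> norm y \<le> B"
    using compact_imp_bounded bounded_iff by metis
  then show ?thesis by auto
qed

lemma admissible_gauss_smooth_measurable [measurable]: "(\<lambda>v. a (G r v)) \<in> borel_measurable borel"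
  by (rule continuous_on_measurable_Icc[OF admissible_continuous_Icc gauss_smooth_measurable gauss_smooth_bounds])

text \<open>Tower property: averaging a conditional expectation over the preceding increment gives
  the one at the earlier time.\<close>

lemma gauss_smooth_add:
  assumes "r\<^sup>2 + s\<^sup>2 = p\<^sup>2"
  shows "(\<integral>y. G r (v + s *\<^sub>R y) \<partial>\<mu>) = G p v"
proof -
  have "s\<^sup>2 + r\<^sup>2 = p\<^sup>2" using assms by simp
  moreover have "\<bar>f (v + x)\<bar> \<le> u" for x using bounded_abs[OF f(2)] .
  ultimately show ?thesis
    using gaussian_add[OF \<mu>, of s r p "\<lambda>x. f (v + x)" u] by (simp add: gauss_smooth_def add.assoc)
qed

lemma admissible_gauss_smooth_add:
  assumes "r\<^sup>2 + s\<^sup>2 = p\<^sup>2"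
  shows "(\<integral>x. \<integral>y. a (G q (r *\<^sub>R x + s *\<^sub>R y)) \<partial>\<mu> \<partial>\<mu>) = (\<integral>z. a (G q (p *\<^sub>R z)) \<partial>\<mu>)"
proof -
  obtain A where "\<And>x. x \<in> {l..u} \<Longrightarrow> \<bar>a x\<bar> \<le> A" using admissible_bounded by blast
  then show ?thesis
    by (intro gaussian_add[OF \<mu> assms, of "\<lambda>v. a (G q v)" A] admissible_gauss_smooth_measurable) (use gauss_smooth_bounds in auto)
qed

lemma admissible_integrable:
  assumes "g \<in> borel_measurable M" "\<And>x. g x \<in> {l..u}" "prob_space M"
  shows "integrable M (\<lambda>x. a (g x))"
  using prob_space.integrable_continuous_Icc[OF assms(3) admissible_continuous_Icc assms(1,2)] by simp

lemma admissible_expectation_bound: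
  assumes "prob_space M" "g \<in> borel_measurable M" "\<And>x. g x \<in> {l..u}" "\<And>x. x \<in> {l..u} \<Longrightarrow> \<bar>a x\<bar> \<le> A"
  shows "\<bar>\<integral>x. a (g x) \<partial>M\<bar> \<le> A"
proof -
  interpret M: prob_space M by fact
  have i: "integrable M (\<lambda>x. a (g x))" by (rule admissible_integrable) fact+
  have "a (g x) \<le> A" "- A \<le> a (g x)" for x using assms(4)[OF assms(3), of x] by auto
  then show ?thesis using M.integral_le_const[OF i, of A] M.integral_ge_const[OF i, of "- A"] by auto
qed

text \<open>Conditional Jensen: the smoothed function at time t is the average, over an increment of
  length t' - t, of the one at t'. Monotonicity takes the place of continuity in t when passing from
  a grid to all times.\<close>

lemma mehler_entropy_mono:
  assumes t: "0 \<le> t" "t \<le> t'" "t' \<le> 1"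
  shows "\<phi> t \<le> \<phi> t'"
proof -
  let ?r = "sqrt (1 - t')" and ?s = "sqrt (t' - t)"
  have "a (G (sqrt (1 - t)) v) \<le> (\<integral>y. a (G ?r (v + ?s *\<^sub>R y)) \<partial>\<mu>)" for v
  proof -
    have "a (\<integral>y. G ?r (v + ?s *\<^sub>R y) \<partial>\<mu>) \<le> (\<integral>y. a (G ?r (v + ?s *\<^sub>R y)) \<partial>\<mu>)"
      by (rule admissible_jensen[OF a _ gauss_smooth_bounds l]) measurable
    then show ?thesis using t by (simp add: gauss_smooth_add[where p = "sqrt (1 - t)"])
  qed
  then have "\<phi> t \<le> (\<integral>x. \<integral>y. a (G ?r (sqrt t *\<^sub>R x + ?s *\<^sub>R y)) \<partial>\<mu> \<partial>\<mu>)"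
    unfolding mehler_entropy_def
  proof (intro integral_mono)
    show "integrable \<mu> (\<lambda>x. a (G (sqrt (1 - t)) (sqrt t *\<^sub>R x)))"
      by (rule admissible_integrable[OF _ gauss_smooth_bounds prob_space_axioms]) measurable
    obtain A where A: "\<And>x. x \<in> {l..u} \<Longrightarrow> \<bar>a x\<bar> \<le> A" using admissible_bounded by blast
    show "integrable \<mu> (\<lambda>x. \<integral>y. a (G ?r (sqrt t *\<^sub>R x + ?s *\<^sub>R y)) \<partial>\<mu>)"
    proof (rule integrable_const_bound[where B = A])
      have "\<bar>\<integral>y. a (G ?r (v + ?s *\<^sub>R y)) \<partial>\<mu>\<bar> \<le> A" for v
        by (rule admissible_expectation_bound[OF prob_space_axioms _ gauss_smooth_bounds A]) measurable
      then show "AE x in \<mu>. norm (\<integral>y. a (G ?r (sqrt t *\<^sub>R x + ?s *\<^sub>R y)) \<partial>\<mu>) \<le> A" by simp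
    qed measurable
  qed
  also have "\<dots> = \<phi> t'"
    unfolding mehler_entropy_def by (rule admissible_gauss_smooth_add) (use t in simp)
  finally show ?thesis .
qed

text \<open>The second difference of \<open>\<phi>\<close> is the average over \<open>x\<close> of the superadditivity gap of the entropy for
  two independent Gaussian increments started at \<open>\<surd>t x\<close>.\<close>

lemma mehler_entropy_midpoint:
  assumes t: "0 \<le> t" "0 \<le> h" "t + 2 * h \<le> 1"
  shows "2 * \<phi> (t + h) \<le> \<phi> t + \<phi> (t + 2 * h)"
proof -
  let ?r = "sqrt (1 - (t + 2 * h))" and ?s = "sqrt h"
  interpret pair: pair_prob_space \<mu> \<mu> ..
  obtain A where A: "\<And>x. x \<in> {l..u} \<Longrightarrow> \<bar>a x\<bar> \<le> A" using admissible_bounded by blast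
  define L where "L v = (\<integral>x. a (G (sqrt (1 - (t + h))) (v + ?s *\<^sub>R x)) \<partial>\<mu>)" for v
  define R where "R v = (\<integral>x. \<integral>y. a (G ?r (v + ?s *\<^sub>R x + ?s *\<^sub>R y)) \<partial>\<mu> \<partial>\<mu>)" for v
  have [measurable]: "L \<in> borel_measurable borel" "R \<in> borel_measurable borel"
    unfolding L_def R_def by measurable
  have main: "2 * L v \<le> a (G (sqrt (1 - t)) v) + R v" for v
  proof -
    \<comment> \<open>The conditional expectation at time t + 2 h as a function of the two
      increments after t. It is symmetric in them, so integrating out either one gives the
      conditional expectation at t + h; the two left-hand terms of the superadditivity coincide,
      whence the factor 2.\<close>
    let ?Z = "\<lambda>w. G ?r (v + ?s *\<^sub>R fst w + ?s *\<^sub>R snd w)"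
    have 1: "(\<integral>y. G ?r (v + ?s *\<^sub>R x + ?s *\<^sub>R y) \<partial>\<mu>) = G (sqrt (1 - (t + h))) (v + ?s *\<^sub>R x)" for x
      by (rule gauss_smooth_add) (use t in simp)
    have 2: "(\<integral>x. G ?r (v + ?s *\<^sub>R x + ?s *\<^sub>R y) \<partial>\<mu>) = G (sqrt (1 - (t + h))) (v + ?s *\<^sub>R y)" for y
      using 1[of y] by (simp add: add_ac)
    have 3: "(\<integral>x. \<integral>y. G ?r (v + ?s *\<^sub>R x + ?s *\<^sub>R y) \<partial>\<mu> \<partial>\<mu>) = G (sqrt (1 - t)) v"
      unfolding 1 by (rule gauss_smooth_add) (use t in simp)
    have "(\<integral>x. a (\<integral>y. ?Z (x, y) \<partial>\<mu>) \<partial>\<mu>) + (\<integral>y. a (\<integral>x. ?Z (x, y) \<partial>\<mu>) \<partial>\<mu>)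
       \<le> (\<integral>x. \<integral>y. a (?Z (x, y)) \<partial>\<mu> \<partial>\<mu>) + a (\<integral>x. \<integral>y. ?Z (x, y) \<partial>\<mu> \<partial>\<mu>)"
      by (rule pair.admissible_entropy_superadditive[OF a l _ gauss_smooth_bounds]) measurable
    then show ?thesis unfolding fst_conv snd_conv 2 unfolding 3 unfolding 1 by (simp add: L_def R_def)
  qed
  have bL: "\<bar>L v\<bar> \<le> A" for v unfolding L_def by (rule admissible_expectation_bound[OF prob_space_axioms _ gauss_smooth_bounds A]) measurable
  have bR: "\<bar>R v\<bar> \<le> A" for v
  proof -
    have b: "\<bar>\<integral>y. a (G ?r (v + ?s *\<^sub>R x + ?s *\<^sub>R y)) \<partial>\<mu>\<bar> \<le> A" for x
      by (rule admissible_expectation_bound[OF prob_space_axioms _ gauss_smooth_bounds A]) measurable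
    have i: "integrable \<mu> (\<lambda>x. \<integral>y. a (G ?r (v + ?s *\<^sub>R x + ?s *\<^sub>R y)) \<partial>\<mu>)"
      by (rule integrable_const_bound[where B = A]) (use b in auto)
    have b': "(\<integral>y. a (G ?r (v + ?s *\<^sub>R x + ?s *\<^sub>R y)) \<partial>\<mu>) \<le> A" "- A \<le> (\<integral>y. a (G ?r (v + ?s *\<^sub>R x + ?s *\<^sub>R y)) \<partial>\<mu>)" for x
      using b[of x] by auto
    show ?thesis unfolding R_def using integral_le_const[OF i AE_I2[OF b'(1)]] integral_ge_const[OF i AE_I2[OF b'(2)]] by simp
  qed
  have i: "integrable \<mu> (\<lambda>x. L (sqrt t *\<^sub>R x))" "integrable \<mu> (\<lambda>x. R (sqrt t *\<^sub>R x))"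
    "integrable \<mu> (\<lambda>x. a (G (sqrt (1 - t)) (sqrt t *\<^sub>R x)))"
    using bL bR by (auto intro!: integrable_const_bound[where B = A] admissible_integrable[OF _ gauss_smooth_bounds prob_space_axioms])
  have "(\<integral>x. 2 * L (sqrt t *\<^sub>R x) \<partial>\<mu>) \<le> (\<integral>x. a (G (sqrt (1 - t)) (sqrt t *\<^sub>R x)) + R (sqrt t *\<^sub>R x) \<partial>\<mu>)"
    by (rule integral_mono) (use i main in auto)
  also have "\<dots> = \<phi> t + (\<integral>x. R (sqrt t *\<^sub>R x) \<partial>\<mu>)" using i by (simp add: mehler_entropy_def)
  also have "(\<integral>x. 2 * L (sqrt t *\<^sub>R x) \<partial>\<mu>) = 2 * (\<integral>x. \<integral>y. a (G (sqrt (1 - (t + h))) (sqrt t *\<^sub>R x + ?s *\<^sub>R y)) \<partial>\<mu> \<partial>\<mu>)"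
    by (simp add: L_def)
  also have "(\<integral>x. \<integral>y. a (G (sqrt (1 - (t + h))) (sqrt t *\<^sub>R x + ?s *\<^sub>R y)) \<partial>\<mu> \<partial>\<mu>) = \<phi> (t + h)"
    unfolding mehler_entropy_def by (rule admissible_gauss_smooth_add) (use t in simp)
  also have "(\<integral>x. R (sqrt t *\<^sub>R x) \<partial>\<mu>) = \<phi> (t + 2 * h)"
  proof -
    \<comment> \<open>Two consecutive increments of length h are merged into one of length 2
      h.\<close>
    have "R v = (\<integral>z. a (G ?r (v + sqrt (2 * h) *\<^sub>R z)) \<partial>\<mu>)" for v
      unfolding R_def using gaussian_add[OF \<mu>, of ?s ?s "sqrt (2 * h)" "\<lambda>x. a (G ?r (v + x))" A] t A[OF gauss_smooth_bounds]
      by (simp add: add.assoc)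
    then have "(\<integral>x. R (sqrt t *\<^sub>R x) \<partial>\<mu>) = (\<integral>x. \<integral>z. a (G ?r (sqrt t *\<^sub>R x + sqrt (2 * h) *\<^sub>R z)) \<partial>\<mu> \<partial>\<mu>)"
      by simp
    also have "\<dots> = \<phi> (t + 2 * h)"
      unfolding mehler_entropy_def by (rule admissible_gauss_smooth_add) (use t in simp)
    finally show ?thesis .
  qed
  finally show ?thesis .
qed

text \<open>Midpoint convexity gives the chord inequality at the points k / N of a uniform grid.
  Since \<open>\<phi>\<close> is non-decreasing, rounding t up to the grid costs at most 1 / N times
  the rise \<open>\<phi> 1 - \<phi> 0\<close>, which disappears as N grows.\<close>

lemma mehler_entropy_chord:
  assumes t: "0 \<le> t" "t \<le> 1"
  shows "\<phi> t \<le> \<phi> 0 + t * (\<phi> 1 - \<phi> 0)"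
proof -
  have D: "\<phi> 1 - \<phi> 0 \<ge> 0" using mehler_entropy_mono[of 0 1] by simp
  have "\<phi> t \<le> \<phi> 0 + (t + 1 / real (Suc n)) * (\<phi> 1 - \<phi> 0)" for n
  proof -
    let ?N = "Suc n"
    define k where "k = nat \<lceil>t * real ?N\<rceil>"
    have c: "real k = of_int \<lceil>t * real ?N\<rceil>" using t by (simp add: k_def)
    have k: "t * real ?N \<le> real k" "real k \<le> t * real ?N + 1" unfolding c by linarith+
    have "t * real ?N \<le> real ?N" using t by (intro mult_left_le_one_le) auto
    then have "\<lceil>t * real ?N\<rceil> \<le> int ?N" by (simp add: ceiling_le_iff del: of_nat_Suc)
    then have kN: "k \<le> ?N" by (simp add: k_def nat_le_iff del: of_nat_Suc)
    have "real ?N * (\<phi> (real k / real ?N) - \<phi> (real 0 / real ?N)) \<le> real k * (\<phi> (real ?N / real ?N) - \<phi> (real 0 / real ?N))"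
    proof (rule convex_sequence_chord[OF _ kN])
      fix j assume "j + 2 \<le> ?N"
      then show "2 * \<phi> (real (j + 1) / real ?N) \<le> \<phi> (real j / real ?N) + \<phi> (real (j + 2) / real ?N)"
      proof -
        have e: "real (j + 1) / real ?N = real j / real ?N + 1 / real ?N"
            "real (j + 2) / real ?N = real j / real ?N + 2 * (1 / real ?N)"
          by (simp_all add: add_divide_distrib)
        have "real (j + 2) / real ?N \<le> 1" using \<open>j + 2 \<le> ?N\<close> by (simp add: divide_le_eq)
        then show ?thesis unfolding e by (intro mehler_entropy_midpoint) simp_all
      qed
    qed
    then have "\<phi> (real k / real ?N) - \<phi> 0 \<le> real k / real ?N * (\<phi> 1 - \<phi> 0)"
      by (simp add: field_simps)
    also have "\<dots> \<le> (t + 1 / real ?N) * (\<phi> 1 - \<phi> 0)"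
    proof (rule mult_right_mono[OF _ D])
      have "real k / real ?N \<le> (t * real ?N + 1) / real ?N" using k(2) by (rule divide_right_mono) simp
      then show "real k / real ?N \<le> t + 1 / real ?N" by (simp add: add_divide_distrib)
    qed
    finally have "\<phi> (real k / real ?N) \<le> \<phi> 0 + (t + 1 / real ?N) * (\<phi> 1 - \<phi> 0)" by simp
    moreover have "\<phi> t \<le> \<phi> (real k / real ?N)"
      using t k kN by (intro mehler_entropy_mono) (simp_all add: field_simps)
    ultimately show ?thesis by linarith
  qed
  moreover have "(\<lambda>n. \<phi> 0 + (t + 1 / real (Suc n)) * (\<phi> 1 - \<phi> 0)) \<longlonglongrightarrow> \<phi> 0 + (t + 0) * (\<phi> 1 - \<phi> 0)"
    using LIMSEQ_inverse_real_of_nat by (intro tendsto_intros) (simp add: inverse_eq_divide)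
  ultimately show ?thesis by (intro LIMSEQ_le_const[where X = "\<lambda>n. \<phi> 0 + (t + 1 / real (Suc n)) * (\<phi> 1 - \<phi> 0)"]) auto
qed

lemma mehler_entropy_0: "\<phi> 0 = a (\<integral>x. f x \<partial>\<mu>)"
  by (simp add: mehler_entropy_def gauss_smooth_def prob_space)

lemma mehler_entropy_1: "\<phi> 1 = (\<integral>x. a (f x) \<partial>\<mu>)"
  by (simp add: mehler_entropy_def gauss_smooth_def prob_space)

text \<open>If \<open>A Q A\<^sup>T \<le> \<theta> Q\<close>, the kernel \<open>k\<close> factors through the Mehler kernel with parameter \<open>\<surd>\<theta>\<close>; the other
  factor leaves \<open>\<mu>\<close> invariant, so it does not increase the entropy.\<close>

lemma gaussian_kernel_entropy_bounded:
  assumes Q: "transpose Q = Q" and \<theta>: "0 < \<theta>" "\<theta> \<le> 1"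
    and A: "\<And>\<xi>. (transpose A *v \<xi>) \<bullet> (Q *v (transpose A *v \<xi>)) \<le> \<theta> * (\<xi> \<bullet> (Q *v \<xi>))"
    and k: "\<And>x. borel_prob (k x)"
      "\<And>x \<xi>. cf (k x) \<xi> = cis (\<xi> \<bullet> (A *v x)) * complex_of_real (exp (- (\<xi> \<bullet> (Q *v \<xi>) - (transpose A *v \<xi>) \<bullet> (Q *v (transpose A *v \<xi>))) / 2))"
  shows "(\<integral>x. a (\<integral>y. f y \<partial>k x) \<partial>\<mu>) \<le> (1 - \<theta>) * a (\<integral>x. f x \<partial>\<mu>) + \<theta> * (\<integral>x. a (f x) \<partial>\<mu>)"
proof -
  \<comment> \<open>Covariance of the noise in the factor that preserves \<open>\<mu>\<close>. Its
    positivity is exactly the comparison of A Q A^T with \<theta> Q.\<close>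
  define S where "S = Q - (1 / \<theta>) *\<^sub>R (A ** Q ** transpose A)"
  have Sx: "\<xi> \<bullet> (S *v \<xi>) = \<xi> \<bullet> (Q *v \<xi>) - ((transpose A *v \<xi>) \<bullet> (Q *v (transpose A *v \<xi>))) / \<theta>" for \<xi>
    by (simp add: S_def matrix_vector_mult_diff_rdistrib scaleR_matrix_vector_assoc[symmetric]
        matrix_vector_mul_assoc[symmetric] inner_diff_right inner_matrix_transpose)
  have "psd_matrix S" unfolding psd_matrix_def
  proof
    have "transpose (X - c *\<^sub>R Y) = transpose X - c *\<^sub>R transpose Y" for X Y :: "real^'n^'n" and c
      by (simp add: transpose_def vec_eq_iff)
    then show "transpose S = S"
      by (simp add: S_def Q matrix_transpose_mul transpose_transpose matrix_mul_assoc)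
    show "\<forall>x. 0 \<le> x \<bullet> (S *v x)" using A \<theta> by (simp add: Sx field_simps)
  qed
  then obtain \<nu> where \<nu>: "centered_gaussian S \<nu>" using centered_gaussian_exists by blast
  interpret \<nu>: prob_space \<nu> by (rule centered_gaussianD(1)[OF \<nu>])
  note [measurable_cong] = centered_gaussianD(2)[OF \<nu>]
  interpret pair: pair_prob_space \<nu> \<mu> ..
  let ?r = "sqrt (1 - \<theta>)" and ?s = "sqrt \<theta>"
  \<comment> \<open>The covariance of \<open>k x\<close> is split as Q - A Q A^T = \<theta> S + (1 -
    \<theta>) Q; the second part is the noise of the Mehler kernel.\<close>
  have k_eq: "k x = distr (\<nu> \<Otimes>\<^sub>M \<mu>) borel (\<lambda>w. (A *v x + ?s *\<^sub>R fst w) + ?r *\<^sub>R snd w)" for x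
  proof (rule cf_unique[OF k(1)])
    show "borel_prob (distr (\<nu> \<Otimes>\<^sub>M \<mu>) borel (\<lambda>w. (A *v x + ?s *\<^sub>R fst w) + ?r *\<^sub>R snd w))"
      by (rule borel_prob_distr[OF prob_space_pair[OF \<nu>.prob_space_axioms prob_space_axioms]]) measurable
    fix \<xi>
    have "cf (distr (\<nu> \<Otimes>\<^sub>M \<mu>) borel (\<lambda>w. (A *v x + ?s *\<^sub>R fst w) + ?r *\<^sub>R snd w)) \<xi> =
      (\<integral>z. cis (\<xi> \<bullet> (A *v x + ?s *\<^sub>R z)) \<partial>\<nu>) * (\<integral>y. cis (\<xi> \<bullet> (?r *\<^sub>R y)) \<partial>\<mu>)"
      by (rule cf_distr_pair[OF \<nu>.prob_space_axioms prob_space_axioms, of "\<lambda>z. A *v x + ?s *\<^sub>R z" "\<lambda>y. ?r *\<^sub>R y"]) measurable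
    also have "(\<integral>z. cis (\<xi> \<bullet> (A *v x + ?s *\<^sub>R z)) \<partial>\<nu>) = cis (\<xi> \<bullet> (A *v x)) * (\<integral>z. cis ((?s *\<^sub>R \<xi>) \<bullet> z) \<partial>\<nu>)"
      by (simp add: inner_add_right cis_mult[symmetric])
    also have "(\<integral>y. cis (\<xi> \<bullet> (?r *\<^sub>R y)) \<partial>\<mu>) = (\<integral>y. cis ((?r *\<^sub>R \<xi>) \<bullet> y) \<partial>\<mu>)" by simp
    also have "cis (\<xi> \<bullet> (A *v x)) * (\<integral>z. cis ((?s *\<^sub>R \<xi>) \<bullet> z) \<partial>\<nu>) * (\<integral>y. cis ((?r *\<^sub>R \<xi>) \<bullet> y) \<partial>\<mu>) = 
      cis (\<xi> \<bullet> (A *v x)) * complex_of_real (exp (- ((?s *\<^sub>R \<xi>) \<bullet> (S *v (?s *\<^sub>R \<xi>))) / 2) * exp (- ((?r *\<^sub>R \<xi>) \<bullet> (Q *v (?r *\<^sub>R \<xi>))) / 2))"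
      unfolding centered_gaussianD(3)[OF \<nu>] centered_gaussianD(3)[OF \<mu>] of_real_mult by (simp only: mult.assoc)
    also have "(?s *\<^sub>R \<xi>) \<bullet> (S *v (?s *\<^sub>R \<xi>)) = \<theta> * (\<xi> \<bullet> (S *v \<xi>))"
      using \<theta> by (simp add: matrix_vector_mult_scaleR mult.assoc[symmetric])
    also have "(?r *\<^sub>R \<xi>) \<bullet> (Q *v (?r *\<^sub>R \<xi>)) = (1 - \<theta>) * (\<xi> \<bullet> (Q *v \<xi>))"
      using \<theta> by (simp add: matrix_vector_mult_scaleR mult.assoc[symmetric])
    also have "cis (\<xi> \<bullet> (A *v x)) * complex_of_real (exp (- (\<theta> * (\<xi> \<bullet> (S *v \<xi>))) / 2) * exp (- ((1 - \<theta>) * (\<xi> \<bullet> (Q *v \<xi>))) / 2)) = cf (k x) \<xi>"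
      unfolding k(2) exp_add[symmetric] Sx using \<theta> by (simp add: field_simps del: of_real_exp)
    finally show "cf (k x) \<xi> = cf (distr (\<nu> \<Otimes>\<^sub>M \<mu>) borel (\<lambda>w. (A *v x + ?s *\<^sub>R fst w) + ?r *\<^sub>R snd w)) \<xi>" by simp
  qed
  define M where "M v = G ?r (?s *\<^sub>R v)" for v
  have [measurable]: "M \<in> borel_measurable borel" unfolding M_def by measurable
  have Mb: "M v \<in> {l..u}" for v unfolding M_def by (rule gauss_smooth_bounds)
  have kf: "(\<integral>y. f y \<partial>k x) = (\<integral>z. M ((1 / ?s) *\<^sub>R (A *v x) + z) \<partial>\<nu>)" for x
  proof -
    have "integrable (\<nu> \<Otimes>\<^sub>M \<mu>) (\<lambda>w. f ((A *v x + ?s *\<^sub>R fst w) + ?r *\<^sub>R snd w))"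
      by (rule pair.P.integrable_const_bound[where B = u]) (use f(2) l in \<open>auto intro!: bounded_abs\<close>)
    then have "(\<integral>w. f ((A *v x + ?s *\<^sub>R fst w) + ?r *\<^sub>R snd w) \<partial>(\<nu> \<Otimes>\<^sub>M \<mu>)) = (\<integral>z. \<integral>y. f ((A *v x + ?s *\<^sub>R z) + ?r *\<^sub>R y) \<partial>\<mu> \<partial>\<nu>)"
      using pair.integral_fst' by fastforce
    then show ?thesis unfolding k_eq
      using \<theta> by (subst integral_distr) (auto simp: M_def gauss_smooth_def scaleR_add_right)
  qed
  have ja: "a (\<integral>y. f y \<partial>k x) \<le> (\<integral>z. a (M ((1 / ?s) *\<^sub>R (A *v x) + z)) \<partial>\<nu>)" for x
    unfolding kf by (rule \<nu>.admissible_jensen[OF a _ Mb l]) measurable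
  obtain B where B: "\<And>x. x \<in> {l..u} \<Longrightarrow> \<bar>a x\<bar> \<le> B" using admissible_bounded by blast
  have aM[measurable]: "(\<lambda>v. a (M v)) \<in> borel_measurable borel"
    unfolding M_def by measurable
  have kb: "(\<integral>y. f y \<partial>k x) \<in> {l..u}" for x
    unfolding kf by (rule \<nu>.integral_in_Icc) (use Mb in auto)
  have "(\<integral>x. a (\<integral>y. f y \<partial>k x) \<partial>\<mu>) \<le> (\<integral>x. \<integral>z. a (M ((1 / ?s) *\<^sub>R (A *v x) + z)) \<partial>\<nu> \<partial>\<mu>)"
  proof (rule integral_mono[OF _ _ ja])
    show "integrable \<mu> (\<lambda>x. a (\<integral>y. f y \<partial>k x))"
      by (rule admissible_integrable[OF _ kb prob_space_axioms]) (unfold kf, measurable)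
    show "integrable \<mu> (\<lambda>x. \<integral>z. a (M ((1 / ?s) *\<^sub>R (A *v x) + z)) \<partial>\<nu>)"
    proof (rule integrable_const_bound[where B = B])
      have "\<bar>\<integral>z. a (M (v + z)) \<partial>\<nu>\<bar> \<le> B" for v
        by (rule admissible_expectation_bound[OF \<nu>.prob_space_axioms _ Mb B]) measurable
      then show "AE x in \<mu>. norm (\<integral>z. a (M ((1 / ?s) *\<^sub>R (A *v x) + z)) \<partial>\<nu>) \<le> B" by simp
    qed measurable
  qed
  also have "\<dots> = (\<integral>x. \<integral>z. a (M (((1 / ?s) *\<^sub>R A) *v x + mat 1 *v z)) \<partial>\<nu> \<partial>\<mu>)"
    by (simp add: scaleR_matrix_vector_assoc[symmetric])
  also have "\<dots> = (\<integral>x. a (M (mat 1 *v x)) \<partial>\<mu>)"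
  \<comment> \<open>Stationarity of the first factor: (1 / \<theta>) A Q A^T + S = Q.\<close>
  proof (rule gaussian_pair_integral[OF \<mu> \<nu> \<mu> _ aM])
    show "\<bar>a (M x)\<bar> \<le> B" for x using B[OF Mb] .
    have "transpose (c *\<^sub>R A) = c *\<^sub>R transpose A" for c by (simp add: transpose_def vec_eq_iff)
    then show "(transpose ((1 / ?s) *\<^sub>R A) *v \<xi>) \<bullet> (Q *v (transpose ((1 / ?s) *\<^sub>R A) *v \<xi>)) +
         (transpose (mat 1) *v \<xi>) \<bullet> (S *v (transpose (mat 1) *v \<xi>)) =
         (transpose (mat 1) *v \<xi>) \<bullet> (Q *v (transpose (mat 1) *v \<xi>))" for \<xi>
      using \<theta> by (simp add: transpose_mat Sx scaleR_matrix_vector_assoc[symmetric] matrix_vector_mult_scaleR)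
  qed
  also have "\<dots> = \<phi> \<theta>" by (simp add: mehler_entropy_def M_def)
  also have "\<dots> \<le> (1 - \<theta>) * a (\<integral>x. f x \<partial>\<mu>) + \<theta> * (\<integral>x. a (f x) \<partial>\<mu>)"
    using mehler_entropy_chord[of \<theta>] \<theta> by (simp add: mehler_entropy_0 mehler_entropy_1 algebra_simps)
  finally show ?thesis .
qed

end

declare sets_gaussian [measurable_cong del] and integrand_measurable [measurable del]
  and gauss_smooth_measurable [measurable del] and admissible_gauss_smooth_measurable [measurable del]

section \<open>Passage to unbounded functions of finite entropy\<close>

lemma admissible_measurable:
  assumes a: "admissible a" and g: "g \<in> borel_measurable M" "\<And>x. 0 \<le> g x"
  shows "(\<lambda>x. a (g x)) \<in> borel_measurable M"
proof -
  have "(\<lambda>x. indicator {0..} x *\<^sub>R a x) \<in> borel_measurable borel"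
    by (rule borel_measurable_continuous_on_indicator[OF _ admissible_continuous[OF a]]) auto
  from measurable_compose[OF g(1) this] g(2) show ?thesis by simp
qed

text \<open>On a segment a convex function is at most the larger endpoint value, and non-negativity
  replaces the maximum by a sum, which is integrable when y = f x. This dominates \<open>a\<close>
  along the truncations of \<open>f\<close>.\<close>

lemma admissible_le_max_between:
  assumes a: "admissible a" and "x > 0" "y \<ge> 0" "min x y \<le> z" "z \<le> max x y"
  shows "a z \<le> a x + a y"
proof -
  have nn: "a x \<ge> 0" "a y \<ge> 0" using admissible_nonneg[OF a] assms by auto
  have *: "a z \<le> max (a p) (a q)" if pq: "0 \<le> p" "p \<le> z" "z \<le> q" for p q
  proof (cases "p = q")
    case False
    define t where "t = (z - p) / (q - p)"
    have "t * (q - p) = z - p" using False by (simp add: t_def)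
    then have "z = (1 - t) * p + t * q" by (simp add: algebra_simps)
    moreover have "0 \<le> t" "t \<le> 1" using False pq by (simp_all add: t_def)
    ultimately show ?thesis
      using convex_lower[OF admissible_convex[OF a], of p q "1 - t" t] pq by simp
  qed (use pq in simp)
  then have "a z \<le> max (a x) (a y)"
    using assms *[of x y] *[of y x] by (cases "x \<le> y") (simp_all add: max.commute)
  then show ?thesis using nn by linarith
qed

text \<open>Subtracting a finite number cannot make an infinite integral finite, so finite entropy
  already bounds the integral of \<open>a \<circ> f\<close>.\<close>

lemma Ent_integrable:
  assumes "admissible a" "borel_prob \<mu>" "f \<in> borel_measurable \<mu>" "\<And>x. 0 \<le> f x" "Ent a \<mu> f < \<infinity>"
  shows "integrable \<mu> (\<lambda>x. a (f x))" "Ent a \<mu> f = ereal ((\<integral>x. a (f x) \<partial>\<mu>) - a (\<integral>x. f x \<partial>\<mu>))"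
proof -
  have nn: "a (f x) \<ge> 0" for x using admissible_nonneg[OF assms(1)] assms(4) by simp
  have "(\<integral>\<^sup>+x. ennreal (a (f x)) \<partial>\<mu>) < \<infinity>"
  proof (rule ccontr)
    assume "\<not> (\<integral>\<^sup>+x. ennreal (a (f x)) \<partial>\<mu>) < \<infinity>"
    then have "(\<integral>\<^sup>+x. ennreal (a (f x)) \<partial>\<mu>) = \<top>" by (simp only: infinity_ennreal_def not_less top_unique)
    then show False using assms(5) by (simp add: Ent_def)
  qed
  then show i: "integrable \<mu> (\<lambda>x. a (f x))"
    by (rule integrableI_nonneg[OF admissible_measurable[OF assms(1,3,4)] AE_I2[OF nn]])
  show "Ent a \<mu> f = ereal ((\<integral>x. a (f x) \<partial>\<mu>) - a (\<integral>x. f x \<partial>\<mu>))"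
    using nn by (simp add: Ent_def nn_integral_eq_integral[OF i] integral_nonneg_AE enn2ereal_ennreal)
qed

text \<open>Every interval [1 / (n + 1), n + 1] contains 1, so the truncated value lies between 1
  and x; the positive lower end avoids 0, where \<open>a\<close> need not be differentiable.\<close>

definition clip :: "nat \<Rightarrow> real \<Rightarrow> real" where
  "clip n x = max (1 / real (Suc n)) (min x (real (Suc n)))"

lemma clip_bounds: "clip n x \<in> {1 / Suc n..real (Suc n)}"
proof -
  have "1 / real (Suc n) \<le> 1" by simp
  also have "1 \<le> real (Suc n)" by simp
  finally show ?thesis by (simp add: clip_def del: of_nat_Suc)
qed

lemma clip_between_1: "min 1 x \<le> clip n x" "clip n x \<le> max 1 x"
proof -
  have "1 / real (Suc n) \<le> 1" "1 \<le> real (Suc n)" by simp_all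
  then show "min 1 x \<le> clip n x" "clip n x \<le> max 1 x" unfolding clip_def by linarith+
qed

lemma clip_le: "x \<ge> 0 \<Longrightarrow> clip n x \<le> x + 1"
  using clip_between_1(2)[of n x] by linarith

lemma clip_tendsto: "x \<ge> 0 \<Longrightarrow> (\<lambda>n. clip n x) \<longlonglongrightarrow> x"
proof -
  assume x: "x \<ge> 0"
  have "(\<lambda>n. max (1 / Suc n) x) \<longlonglongrightarrow> max 0 x"
    using LIMSEQ_inverse_real_of_nat by (intro tendsto_intros) (simp add: inverse_eq_divide)
  moreover have "\<forall>\<^sub>F n in sequentially. max (1 / Suc n) x = clip n x"
    using eventually_ge_at_top[of "nat \<lceil>x\<rceil>"]
  proof eventually_elim
    case (elim n)
    then have "x \<le> Suc n" by linarith
    then show ?case by (simp add: clip_def)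
  qed
  ultimately show ?thesis using x by (simp add: tendsto_cong)
qed

lemma clip_measurable [measurable]: "clip n \<in> borel_measurable borel"
  unfolding clip_def by measurable

text \<open>Truncation of \<open>f\<close> to \<open>[1/n, n]\<close>: on the right dominated convergence applies since a convex
  function at the truncated value is at most \<open>a 1 + a (f x)\<close>; on the left Fatou suffices.\<close>

lemma kernel_entropy_from_bounded:
  fixes k :: "real^'n \<Rightarrow> (real^'n) measure"
  assumes \<mu>: "borel_prob \<mu>" and k: "k \<in> borel \<rightarrow>\<^sub>M prob_algebra borel" and inv: "\<mu> \<bind> k = \<mu>"
    and a: "admissible a" and \<theta>: "0 \<le> \<theta>" "\<theta> \<le> 1"
    and bounded: "\<And>f l u. 0 < l \<Longrightarrow> f \<in> borel_measurable borel \<Longrightarrow> (\<And>x. f x \<in> {l..u}) \<Longrightarrow>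
        (\<integral>x. a (\<integral>y. f y \<partial>k x) \<partial>\<mu>) \<le> (1 - \<theta>) * a (\<integral>x. f x \<partial>\<mu>) + \<theta> * (\<integral>x. a (f x) \<partial>\<mu>)"
    and f: "\<And>x. 0 \<le> f x" "integrable \<mu> f" "Ent a \<mu> f < \<infinity>"
  shows "Ent a \<mu> (\<lambda>x. \<integral>y. f y \<partial>k x) \<le> ereal \<theta> * Ent a \<mu> f"
proof -
  interpret prob_space \<mu> using \<mu> by simp
  have m\<mu>: "borel_measurable \<mu> = borel_measurable borel"
    by (rule measurable_cong_sets) (use \<mu> in auto)
  have fm[measurable]: "f \<in> borel_measurable borel" using borel_measurable_integrable[OF f(2)] unfolding m\<mu> .
  have s\<mu>[measurable_cong]: "sets \<mu> = sets borel" using \<mu> by simp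
  have ks[measurable]: "k \<in> borel \<rightarrow>\<^sub>M subprob_algebra borel" by (rule measurable_prob_algebraD[OF k])
  have kx: "prob_space (k x)" "sets (k x) = sets borel" for x
    using measurable_space[OF k, of x] by (auto simp: space_prob_algebra)
  have fm': "f \<in> borel_measurable (k x)" "f \<in> borel_measurable \<mu>" for x using fm kx \<mu> by (simp_all cong: measurable_cong_sets)
  note Ef = Ent_integrable[OF a \<mu> fm'(2) f(1) f(3)]
  define F where "F n x = clip n (f x)" for n x
  have Fm[measurable]: "F n \<in> borel_measurable borel" for n unfolding F_def by measurable
  have Fb: "F n x \<in> {1 / Suc n..real (Suc n)}" for n x unfolding F_def by (rule clip_bounds)
  have F0: "0 \<le> F n x" for n x using Fb[of n x] by (auto intro: order_trans[of 0 "1 / real (Suc n)"])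
  have Fl: "(\<lambda>n. F n x) \<longlonglongrightarrow> f x" for x unfolding F_def by (rule clip_tendsto[OF f(1)])
  have Fle: "\<bar>F n x\<bar> \<le> f x + 1" for n x using F0[of n x] clip_le[OF f(1), of n x] by (simp add: F_def)
  define P where "P g x = (\<integral>y. g y \<partial>k x)" for g :: "real^'n \<Rightarrow> real" and x
  have Pm: "P g \<in> borel_measurable borel" if "g \<in> borel_measurable borel" for g
    unfolding P_def using integral_measurable_subprob_algebra[OF that] by (rule measurable_compose[OF ks])
  have P0: "0 \<le> P g x" if "\<And>x. 0 \<le> g x" for g x unfolding P_def using that by simp
  have nnP: "(\<integral>\<^sup>+x. \<integral>\<^sup>+y. g y \<partial>k x \<partial>\<mu>) = (\<integral>\<^sup>+x. g x \<partial>\<mu>)" if "g \<in> borel_measurable borel" for g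
  proof -
    have "k \<in> \<mu> \<rightarrow>\<^sub>M subprob_algebra borel" using ks by measurable
    from nn_integral_bind[OF that this] show ?thesis by (simp add: inv)
  qed
  have nnf: "(\<integral>\<^sup>+x. \<integral>\<^sup>+y. ennreal (f y) \<partial>k x \<partial>\<mu>) = ennreal (\<integral>x. f x \<partial>\<mu>)"
    using nnP[of "\<lambda>x. ennreal (f x)"] nn_integral_eq_integral[OF f(2)] f(1) by simp
  have AEfin: "AE x in \<mu>. (\<integral>\<^sup>+y. ennreal (f y) \<partial>k x) \<noteq> \<infinity>"
  proof (rule nn_integral_PInf_AE)
    have "(\<lambda>M. \<integral>\<^sup>+y. ennreal (f y) \<partial>M) \<in> borel_measurable (subprob_algebra borel)" by measurable
    from measurable_compose[OF ks this]
    show "(\<lambda>x. \<integral>\<^sup>+y. ennreal (f y) \<partial>k x) \<in> borel_measurable \<mu>" unfolding m\<mu> .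
  qed (use nnf in simp)
  \<comment> \<open>Invariance gives integrability of \<open>f\<close> under \<open>k x\<close> only
    for almost every x. Elsewhere \<open>P f x\<close> is the default value 0, which affects no
    integral over \<open>\<mu>\<close>.\<close>
  have AEint: "AE x in \<mu>. integrable (k x) f"
    using AEfin by eventually_elim (use f(1) fm' in \<open>auto intro!: integrableI_nonneg simp: less_top\<close>)
  have EP: "(\<integral>x. P f x \<partial>\<mu>) = (\<integral>x. f x \<partial>\<mu>)"
  proof -
    have "(\<integral>\<^sup>+x. ennreal (P f x) \<partial>\<mu>) = (\<integral>\<^sup>+x. \<integral>\<^sup>+y. ennreal (f y) \<partial>k x \<partial>\<mu>)"
      by (rule nn_integral_cong_AE) (use AEint in eventually_elim, simp add: P_def nn_integral_eq_integral f(1))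
    then show ?thesis unfolding nnf
      using f(1) P0[of f] Pm[OF fm] \<mu> by (intro integral_eq_nn_integral[THEN trans]) (simp_all cong: measurable_cong_sets)
  qed
  define R where "R n = (1 - \<theta>) * a (\<integral>x. F n x \<partial>\<mu>) + \<theta> * (\<integral>x. a (F n x) \<partial>\<mu>)" for n
  have le: "(\<integral>\<^sup>+x. ennreal (a (P (F n) x)) \<partial>\<mu>) \<le> ennreal (R n)" for n
  proof -
    let ?l = "1 / real (Suc n)" and ?u = "real (Suc n)"
    have PFb: "P (F n) x \<in> {?l..?u}" for x unfolding P_def
      by (rule prob_space.integral_in_Icc[OF kx(1)]) (use Fb kx(2) in \<open>auto cong: measurable_cong_sets\<close>)
    have "integrable \<mu> (\<lambda>x. a (P (F n) x))"
      by (rule integrable_continuous_Icc[OF continuous_on_subset[OF admissible_continuous[OF a]] _ PFb])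
        (use Pm[OF Fm] m\<mu> in auto)
    moreover have "a (P (F n) x) \<ge> 0" for x using admissible_nonneg[OF a P0[OF F0]] .
    ultimately have "(\<integral>\<^sup>+x. ennreal (a (P (F n) x)) \<partial>\<mu>) = ennreal (\<integral>x. a (P (F n) x) \<partial>\<mu>)"
      by (intro nn_integral_eq_integral) auto
    also have "\<dots> \<le> ennreal (R n)"
      unfolding P_def R_def by (intro ennreal_leI bounded[of ?l _ ?u] Fm Fb) simp
    finally show ?thesis .
  qed
  have aF: "(\<lambda>n. a (g n)) \<longlonglongrightarrow> a x" if "g \<longlonglongrightarrow> x" "\<And>n. 0 \<le> g n" "0 \<le> x" for g x
    using continuous_on_tendsto_compose[OF admissible_continuous[OF a] that(1)] that(2,3) by auto
  have R: "R \<longlonglongrightarrow> (1 - \<theta>) * a (\<integral>x. f x \<partial>\<mu>) + \<theta> * (\<integral>x. a (f x) \<partial>\<mu>)" unfolding R_def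
  proof (intro tendsto_add tendsto_mult tendsto_const)
    have "(\<lambda>n. \<integral>x. F n x \<partial>\<mu>) \<longlonglongrightarrow> (\<integral>x. f x \<partial>\<mu>)"
      by (rule integral_dominated_convergence[where w = "\<lambda>x. f x + 1"]) (use f(2) Fl Fle fm Fm m\<mu> in auto)
    then show "(\<lambda>n. a (\<integral>x. F n x \<partial>\<mu>)) \<longlonglongrightarrow> a (\<integral>x. f x \<partial>\<mu>)"
      by (rule aF) (use F0 f(1) in simp_all)
    show "(\<lambda>n. \<integral>x. a (F n x) \<partial>\<mu>) \<longlonglongrightarrow> (\<integral>x. a (f x) \<partial>\<mu>)"
    proof (rule integral_dominated_convergence[where w = "\<lambda>x. a 1 + a (f x)"])
      show "integrable \<mu> (\<lambda>x. a 1 + a (f x))" using Ef(1) by simp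
      show "AE x in \<mu>. (\<lambda>n. a (F n x)) \<longlonglongrightarrow> a (f x)" by (intro AE_I2 aF Fl F0 f(1))
      show "AE x in \<mu>. norm (a (F n x)) \<le> a 1 + a (f x)" for n
      proof (rule AE_I2)
        fix x
        have "a (F n x) \<le> a 1 + a (f x)"
          by (rule admissible_le_max_between[OF a]) (use clip_between_1 f(1) in \<open>auto simp: F_def\<close>)
        then show "norm (a (F n x)) \<le> a 1 + a (f x)" using admissible_nonneg[OF a F0] by simp
      qed
      show "(\<lambda>x. a (f x)) \<in> borel_measurable \<mu>" by (rule admissible_measurable[OF a fm'(2) f(1)])
      show "(\<lambda>x. a (F n x)) \<in> borel_measurable \<mu>" for n
        by (rule admissible_measurable[OF a _ F0]) (use Fm m\<mu> in simp)
    qed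
  qed
  have "(\<integral>\<^sup>+x. ennreal (a (P f x)) \<partial>\<mu>) = (\<integral>\<^sup>+x. liminf (\<lambda>n. ennreal (a (P (F n) x))) \<partial>\<mu>)"
  proof (rule nn_integral_cong_AE)
    show "AE x in \<mu>. ennreal (a (P f x)) = liminf (\<lambda>n. ennreal (a (P (F n) x)))"
      using AEint
    proof eventually_elim
      case (elim x)
      interpret k: prob_space "k x" by (rule kx)
      have "(\<lambda>n. P (F n) x) \<longlonglongrightarrow> P f x" unfolding P_def
        by (rule integral_dominated_convergence[where w = "\<lambda>x. f x + 1"])
          (use elim Fl Fle fm' Fm kx(2) in \<open>auto cong: measurable_cong_sets\<close>)
      then have "(\<lambda>n. ennreal (a (P (F n) x))) \<longlonglongrightarrow> ennreal (a (P f x))"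
        by (intro tendsto_ennrealI aF P0 F0 f(1))
      then show ?case by (simp add: lim_imp_Liminf)
    qed
  qed
  also have "\<dots> \<le> liminf (\<lambda>n. \<integral>\<^sup>+x. ennreal (a (P (F n) x)) \<partial>\<mu>)"
  proof (rule nn_integral_liminf)
    show "(\<lambda>x. ennreal (a (P (F n) x))) \<in> borel_measurable \<mu>" for n
      unfolding m\<mu> by (rule measurable_compose[OF admissible_measurable[OF a Pm[OF Fm] P0[OF F0]] measurable_ennreal])
  qed
  also have "\<dots> \<le> liminf (\<lambda>n. ennreal (R n))"
    by (rule Liminf_mono) (use le in auto)
  also have "\<dots> = ennreal ((1 - \<theta>) * a (\<integral>x. f x \<partial>\<mu>) + \<theta> * (\<integral>x. a (f x) \<partial>\<mu>))"
    by (intro lim_imp_Liminf tendsto_ennrealI R) simp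
  finally have fin: "(\<integral>\<^sup>+x. ennreal (a (P f x)) \<partial>\<mu>) \<le> ennreal ((1 - \<theta>) * a (\<integral>x. f x \<partial>\<mu>) + \<theta> * (\<integral>x. a (f x) \<partial>\<mu>))" .
  have nn: "0 \<le> (1 - \<theta>) * a (\<integral>x. f x \<partial>\<mu>) + \<theta> * (\<integral>x. a (f x) \<partial>\<mu>)"
    using \<theta> admissible_nonneg[OF a] f(1) by (intro add_nonneg_nonneg mult_nonneg_nonneg) (auto simp: integral_nonneg_AE)
  have "enn2ereal (\<integral>\<^sup>+x. ennreal (a (P f x)) \<partial>\<mu>) \<le> ereal ((1 - \<theta>) * a (\<integral>x. f x \<partial>\<mu>) + \<theta> * (\<integral>x. a (f x) \<partial>\<mu>))"
    using fin nn by (metis enn2ereal_ennreal less_eq_ennreal.rep_eq)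
  \<comment> \<open>As \<open>P f\<close> and \<open>f\<close> have the same mean
    (\<open>EP\<close>), the same value of \<open>a\<close> is subtracted for both, and of the
    convex combination only \<theta> times the entropy of \<open>f\<close> is left.\<close>
  then have "Ent a \<mu> (P f) \<le> ereal ((1 - \<theta>) * a (\<integral>x. f x \<partial>\<mu>) + \<theta> * (\<integral>x. a (f x) \<partial>\<mu>)) - ereal (a (\<integral>x. f x \<partial>\<mu>))"
    unfolding Ent_def EP by (rule ereal_minus_mono) simp
  also have "\<dots> = ereal \<theta> * Ent a \<mu> f" unfolding Ef(2) by (simp add: algebra_simps)
  finally show ?thesis unfolding P_def .
qed

section \<open>The matrix exponential\<close>

text \<open>Entrywise, so that convergence and termwise differentiation are those of real power
  series in t.\<close>

definition mexp :: "real^'n^'n \<Rightarrow> real \<Rightarrow> real^'n^'n" where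
  "mexp A t = (\<chi> i j. \<Sum>k. matpow A k $ i $ j / fact k * t ^ k)"

lemma matrix_mult_entry: "(X ** Y) $ i $ j = (\<Sum>l\<in>UNIV. X $ i $ l * Y $ l $ j)"
  by (simp add: matrix_matrix_mult_def)

lemma matpow_commute: "matpow A k ** A = A ** matpow A k"
  by (induction k) (simp_all add: matrix_mul_assoc[symmetric])

lemma matpow_bound: "\<exists>K\<ge>0. \<forall>k i j. \<bar>matpow (A::real^'n^'n) k $ i $ j\<bar> \<le> K ^ k"
proof -
  define m where "m = (\<Sum>i\<in>UNIV. \<Sum>j\<in>UNIV. \<bar>A $ i $ j\<bar>)"
  have m: "\<bar>A $ i $ j\<bar> \<le> m" for i j
  proof -
    have "\<bar>A $ i $ j\<bar> \<le> (\<Sum>j\<in>UNIV. \<bar>A $ i $ j\<bar>)" by (rule member_le_sum) auto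
    also have "\<dots> \<le> m" unfolding m_def by (rule member_le_sum[of i UNIV "\<lambda>i. \<Sum>j\<in>UNIV. \<bar>A $ i $ j\<bar>"]) (auto intro: sum_nonneg)
    finally show ?thesis .
  qed
  then have m0: "0 \<le> m" using order_trans[OF abs_ge_zero] by blast
  let ?K = "real CARD('n) * m"
  have "\<bar>matpow A k $ i $ j\<bar> \<le> ?K ^ k" for k i j
  proof (induction k arbitrary: i j)
    case 0
    then show ?case by (simp add: mat_def)
  next
    case (Suc k)
    have "\<bar>matpow A (Suc k) $ i $ j\<bar> \<le> (\<Sum>l\<in>UNIV. \<bar>A $ i $ l * matpow A k $ l $ j\<bar>)"
      by (simp add: matrix_matrix_mult_def sum_abs)
    also have "\<dots> \<le> (\<Sum>l\<in>(UNIV::'n set). m * ?K ^ k)"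
      unfolding abs_mult by (intro sum_mono mult_mono m Suc m0) auto
    finally show ?case by (simp add: mult_ac)
  qed
  then show ?thesis using m0 by (intro exI[of _ ?K]) auto
qed

lemma mexp_summable: "summable (\<lambda>k. norm (matpow A k $ i $ j / fact k * (t::real) ^ k))"
proof -
  obtain K where K: "K \<ge> 0" "\<And>k i j. \<bar>matpow A k $ i $ j\<bar> \<le> K ^ k" using matpow_bound[of A] by blast
  have "norm (matpow A k $ i $ j / fact k * t ^ k) \<le> inverse (fact k) * (K * \<bar>t\<bar>) ^ k" for k
    using mult_right_mono[OF K(2)[of k i j], of "\<bar>t\<bar> ^ k / fact k"]
    by (simp add: abs_mult power_abs power_mult_distrib field_simps)
  then show ?thesis
    by (intro summable_comparison_test'[OF summable_exp[of "K * \<bar>t\<bar>"]]) auto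
qed

lemma mexp_sums: "(\<lambda>k. matpow A k $ i $ j / fact k * t ^ k) sums (mexp A t $ i $ j)"
  using summable_sums[OF summable_norm_cancel[OF mexp_summable]] by (simp add: mexp_def)

lemma mexp_0: "mexp A 0 = mat 1"
  unfolding vec_eq_iff mexp_def vec_lambda_beta powser_zero by simp

lemma mexp_commute: "mexp A t ** A = A ** mexp A t"
proof -
  have "(mexp A t ** A) $ i $ j = (A ** mexp A t) $ i $ j" for i j
  proof -
    have 1: "(\<lambda>k. \<Sum>l\<in>UNIV. matpow A k $ i $ l / fact k * t ^ k * A $ l $ j) sums ((mexp A t ** A) $ i $ j)"
      unfolding matrix_mult_entry by (intro sums_sum sums_mult2 mexp_sums)
    have 2: "(\<lambda>k. \<Sum>l\<in>UNIV. A $ i $ l * (matpow A k $ l $ j / fact k * t ^ k)) sums ((A ** mexp A t) $ i $ j)"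
      unfolding matrix_mult_entry by (intro sums_sum sums_mult mexp_sums)
    have 3: "(\<Sum>l\<in>UNIV. matpow A k $ i $ l / fact k * t ^ k * A $ l $ j) = (\<Sum>l\<in>UNIV. A $ i $ l * (matpow A k $ l $ j / fact k * t ^ k))" for k
    proof -
      have "(\<Sum>l\<in>UNIV. matpow A k $ i $ l / fact k * t ^ k * A $ l $ j) = (matpow A k ** A) $ i $ j * (t ^ k / fact k)"
        unfolding matrix_mult_entry sum_distrib_right by (intro sum.cong refl) simp
      also have "\<dots> = (\<Sum>l\<in>UNIV. A $ i $ l * (matpow A k $ l $ j / fact k * t ^ k))"
        unfolding matpow_commute matrix_mult_entry sum_distrib_right by (intro sum.cong refl) simp
      finally show ?thesis .
    qed
    show ?thesis using 1 2 unfolding 3 by (rule sums_unique2)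
  qed
  then show ?thesis by (simp add: vec_eq_iff)
qed

lemma mexp_entry_derivative:
  "((\<lambda>t. mexp A t $ i $ j) has_real_derivative ((A ** mexp A t) $ i $ j)) (at t)"
proof -
  let ?c = "\<lambda>k. matpow A k $ i $ j / fact k"
  have "((\<lambda>x. \<Sum>n. ?c n * x ^ n) has_real_derivative (\<Sum>n. diffs ?c n * t ^ n)) (at t)"
    by (rule termdiffs_strong_converges_everywhere) (rule summable_norm_cancel[OF mexp_summable])
  moreover have "(\<lambda>n. diffs ?c n * t ^ n) sums ((A ** mexp A t) $ i $ j)"
  proof -
    have "(\<lambda>k. \<Sum>l\<in>UNIV. A $ i $ l * (matpow A k $ l $ j / fact k * t ^ k)) sums ((A ** mexp A t) $ i $ j)"
      unfolding matrix_mult_entry by (intro sums_sum sums_mult mexp_sums)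
    moreover have "diffs ?c n * t ^ n = (\<Sum>l\<in>UNIV. A $ i $ l * (matpow A n $ l $ j / fact n * t ^ n))" for n
    proof -
      have "diffs ?c n * t ^ n = (A ** matpow A n) $ i $ j * (t ^ n / fact n)"
        by (simp add: diffs_def del: of_nat_Suc)
      also have "\<dots> = (\<Sum>l\<in>UNIV. A $ i $ l * (matpow A n $ l $ j / fact n * t ^ n))"
        unfolding matrix_mult_entry sum_distrib_right by (intro sum.cong refl) simp
      finally show ?thesis .
    qed
    ultimately show ?thesis by simp
  qed
  ultimately show ?thesis by (simp add: mexp_def sums_iff)
qed

lemma has_vector_derivative_matrixI:
  fixes F :: "real \<Rightarrow> real^'n^'m"
  assumes "\<And>i j. ((\<lambda>t. F t $ i $ j) has_real_derivative (G $ i $ j)) (at t)"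
  shows "(F has_vector_derivative G) (at t)"
  unfolding has_vector_derivative_def
  by (subst has_derivative_componentwise_within)
    (use assms in \<open>auto simp: Basis_vec_def inner_axis has_field_derivative_def mult.commute[of _ "G $ _ $ _"]\<close>)

lemma mexp_has_vector_derivative: "(mexp A has_vector_derivative (A ** mexp A t)) (at t)"
  by (rule has_vector_derivative_matrixI) (rule mexp_entry_derivative)

lemma bounded_bilinear_matrix_matrix_mult: "bounded_bilinear ((**) :: real^'n^'m \<Rightarrow> real^'k^'n \<Rightarrow> real^'k^'m)"
proof -
  have "bilinear ((**) :: real^'n^'m \<Rightarrow> real^'k^'n \<Rightarrow> real^'k^'m)"
    unfolding bilinear_def
    by (auto intro!: linearI simp: vec_eq_iff matrix_matrix_mult_def algebra_simps sum.distrib sum_distrib_left)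
  then show ?thesis by (simp add: bilinear_conv_bounded_bilinear)
qed

lemma bounded_bilinear_matrix_vector_mult: "bounded_bilinear ((*v) :: real^'n^'m \<Rightarrow> real^'n \<Rightarrow> real^'m)"
proof -
  have "bilinear ((*v) :: real^'n^'m \<Rightarrow> real^'n \<Rightarrow> real^'m)"
    unfolding bilinear_def
    by (auto intro!: linearI simp: vec_eq_iff matrix_vector_mult_def algebra_simps sum.distrib sum_distrib_left)
  then show ?thesis by (simp add: bilinear_conv_bounded_bilinear)
qed

text \<open>The product exp ((s + t - r) A) exp (r A) has derivative 0 in r because \<open>A\<close>
  commutes with its exponential; its values at r = 0 and r = t are the two sides.\<close>

lemma mexp_add: "mexp A (s + t) = mexp A s ** mexp A t"
proof -
  define g where "g r = mexp A (s + t - r) ** mexp A r" for r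
  have "(g has_vector_derivative 0) (at r within UNIV)" for r
  proof -
    have 1: "((\<lambda>r. mexp A (s + t - r)) has_vector_derivative - (A ** mexp A (s + t - r))) (at r)"
    proof (rule has_vector_derivative_matrixI)
      fix i j
      have "((\<lambda>r. mexp A (s + t - r) $ i $ j) has_real_derivative (A ** mexp A (s + t - r)) $ i $ j * (- 1)) (at r)"
        by (rule DERIV_chain2[OF mexp_entry_derivative]) (auto intro!: derivative_eq_intros)
      then show "((\<lambda>r. mexp A (s + t - r) $ i $ j) has_real_derivative (- (A ** mexp A (s + t - r))) $ i $ j) (at r)" by simp
    qed
    have "(g has_vector_derivative (mexp A (s + t - r) ** (A ** mexp A r) + - (A ** mexp A (s + t - r)) ** mexp A r)) (at r)"
      unfolding g_def by (rule bounded_bilinear.has_vector_derivative[OF bounded_bilinear_matrix_matrix_mult 1 mexp_has_vector_derivative])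
    moreover have "mexp A (s + t - r) ** (A ** mexp A r) + - (A ** mexp A (s + t - r)) ** mexp A r = 0"
      by (simp add: matrix_mul_assoc mexp_commute bounded_bilinear.minus_left[OF bounded_bilinear_matrix_matrix_mult])
    ultimately show ?thesis by simp
  qed
  then obtain c where "\<And>r. r \<in> UNIV \<Longrightarrow> g r = c"
    using has_vector_derivative_zero_constant[of UNIV g] by auto
  then have "g 0 = g t" by simp
  then show ?thesis by (simp add: g_def mexp_0)
qed

section \<open>Decay from the Jordan form\<close>

text \<open>The offset m is the distance to the diagonal inside one block. The constraint m < n is
  what limits the power of t in the exponential to the block size minus one.\<close>

lemma jordan_matrix_pow_entry:
  fixes n_as :: "(nat \<times> 'a :: comm_ring_1) list"
  assumes "p < sum_list (map fst n_as)" "q < sum_list (map fst n_as)"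
  shows "(\<forall>k. (jordan_matrix n_as ^\<^sub>m k) $$ (p, q) = 0) \<or>
    (\<exists>n a m. (n, a) \<in> set n_as \<and> m < n \<and> (\<forall>k. (jordan_matrix n_as ^\<^sub>m k) $$ (p, q) = of_nat (k choose m) * a ^ (k - m)))"
  using assms
proof (induction n_as arbitrary: p q)
  case (Cons na n_as)
  obtain n a where na: "na = (n, a)" by force
  let ?D = "sum_list (map fst n_as)"
  define C where "C k = diag_block_mat (map (\<lambda>(n, a). jordan_block n a ^\<^sub>m k) n_as)" for k
  have C: "jordan_matrix n_as ^\<^sub>m k = C k" for k by (simp add: jordan_matrix_pow C_def)
  have dim: "dim_row (C k) = ?D" "dim_col (C k) = ?D" for k
    unfolding C[symmetric] by (auto simp: jordan_matrix_dim pow_mat_dim)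
  have J: "jordan_matrix (na # n_as) ^\<^sub>m k = four_block_mat (jordan_block n a ^\<^sub>m k) (0\<^sub>m n ?D) (0\<^sub>m ?D n) (C k)" for k
    using dim by (simp add: jordan_matrix_pow na Let_def C_def)
  have e: "(jordan_matrix (na # n_as) ^\<^sub>m k) $$ (p, q) =
      (if p < n then if q < n then (jordan_block n a ^\<^sub>m k) $$ (p, q) else 0
       else if q < n then 0 else C k $$ (p - n, q - n))" for k
    using Cons.prems unfolding J by (subst index_mat_four_block) (auto simp: dim na)
  show ?case
  proof (cases "p < n \<and> q < n")
    case True
    show ?thesis
    proof (cases "p \<le> q")
      case le: True
      have "(jordan_matrix (na # n_as) ^\<^sub>m k) $$ (p, q) = of_nat (k choose (q - p)) * a ^ (k - (q - p))" for k
        using True le by (simp add: e jordan_block_pow)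
      moreover have "q - p < n" using True by auto
      ultimately show ?thesis using na by (intro disjI2 exI[of _ n] exI[of _ a] exI[of _ "q - p"]) auto
    next
      case False
      then have "(jordan_matrix (na # n_as) ^\<^sub>m k) $$ (p, q) = 0" for k
        using True by (simp add: e jordan_block_pow)
      then show ?thesis by blast
    qed
  next
    case False
    show ?thesis
    proof (cases "p < n \<or> q < n")
      case True
      then have "(jordan_matrix (na # n_as) ^\<^sub>m k) $$ (p, q) = 0" for k using False by (auto simp: e)
      then show ?thesis by blast
    next
      case False
      then have "(jordan_matrix (na # n_as) ^\<^sub>m k) $$ (p, q) = C k $$ (p - n, q - n)" for k by (simp add: e)
      moreover have "p - n < ?D" "q - n < ?D" using Cons.prems False by (auto simp: na)
      ultimately show ?thesis using Cons.IH[of "p - n" "q - n"] by (auto simp: C)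
    qed
  qed
qed simp

lemma complex_mat_pow:
  fixes A :: "real^'n^'n"
  assumes "i < CARD('n)" "j < CARD('n)"
  shows "(complex_mat A ^\<^sub>m k) $$ (i, j) = complex_of_real (matpow A k $ from_nat_into UNIV i $ from_nat_into UNIV j)"
  using assms
proof (induction k arbitrary: i j)
  case 0
  have "inj_on (from_nat_into (UNIV :: 'n set)) {..<CARD('n)}"
    using bij_betw_from_nat_into_finite[of "UNIV :: 'n set"] by (auto simp: bij_betw_def)
  then have "(from_nat_into (UNIV :: 'n set) i = from_nat_into UNIV j) = (i = j)"
    using 0 by (auto simp: inj_on_def)
  then show ?case using 0 by (simp add: complex_mat_def mat_def)
next
  case (Suc k)
  have d: "dim_row (complex_mat A ^\<^sub>m k) = CARD('n)" "dim_col (complex_mat A ^\<^sub>m k) = CARD('n)"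
      "dim_row (complex_mat A) = CARD('n)" "dim_col (complex_mat A) = CARD('n)"
    by (auto simp: complex_mat_def)
  have "(complex_mat A ^\<^sub>m Suc k) $$ (i, j) = (\<Sum>l = 0..<CARD('n). (complex_mat A ^\<^sub>m k) $$ (i, l) * complex_mat A $$ (l, j))"
    using Suc.prems d by (simp add: scalar_prod_def)
  also have "\<dots> = (\<Sum>l<CARD('n). complex_of_real (matpow A k $ from_nat_into UNIV i $ from_nat_into UNIV l * A $ from_nat_into UNIV l $ from_nat_into UNIV j))"
    using Suc by (intro sum.cong) (auto simp: complex_mat_def)
  also have "\<dots> = (\<Sum>l\<in>UNIV. complex_of_real (matpow A k $ from_nat_into UNIV i $ l * A $ l $ from_nat_into UNIV j))"
    by (rule sum.reindex_bij_betw[OF bij_betw_from_nat_into_finite]) simp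
  also have "\<dots> = complex_of_real ((matpow A k ** A) $ from_nat_into UNIV i $ from_nat_into UNIV j)"
    by (simp add: matrix_matrix_mult_def)
  \<comment> \<open>\<open>^\<^sub>m\<close> multiplies on the right, \<open>matpow\<close> on the
    left.\<close>
  finally show ?case by (simp add: matpow_commute)
qed

text \<open>The m-th superdiagonal of the exponential of a Jordan block. Terms with k < m vanish,
  and after shifting k by m the binomial coefficient over the factorial splits as 1 / (m!
  k!).\<close>

lemma binomial_exp_sums:
  fixes a :: complex and t :: real
  shows "(\<lambda>k. of_nat (k choose m) * a ^ (k - m) / fact k * of_real t ^ k) sums (of_real t ^ m / fact m * exp (a * of_real t))"
proof -
  let ?f = "\<lambda>k. of_nat (k choose m) * a ^ (k - m) / fact k * of_real t ^ k"
  have "?f (k + m) = of_real t ^ m / fact m * ((a * of_real t) ^ k /\<^sub>R fact k)" for k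
  proof -
    have "of_nat (k + m choose m) / (fact (k + m) :: complex) = 1 / (fact m * fact k)"
      using binomial_fact[of m "k + m", where 'a = complex] by (simp add: field_simps)
    then have "?f (k + m) = 1 / (fact m * fact k) * a ^ k * of_real t ^ (k + m)" by (simp add: field_simps)
    then show ?thesis by (simp add: power_add power_mult_distrib scaleR_conv_of_real field_simps)
  qed
  then have "(\<lambda>k. ?f (k + m)) sums (of_real t ^ m / fact m * exp (a * of_real t))"
    using sums_mult[OF exp_converges[of "a * of_real t"], of "of_real t ^ m / fact m"] by simp
  moreover have "(\<Sum>k<m. ?f k) = 0" by (intro sum.neutral) (simp add: binomial_eq_0)
  ultimately show ?thesis using sums_iff_shift[of ?f m] by simp
qed

text \<open>The single term of index m in the exponential series of \<delta> t already gives the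
  constant.\<close>

lemma power_exp_bound:
  fixes \<delta> :: real
  assumes "\<delta> > 0"
  shows "\<exists>C\<ge>0. \<forall>t\<ge>0. t ^ m * exp (- \<delta> * t) \<le> C"
proof (intro exI conjI allI impI)
  fix t :: real assume t: "t \<ge> 0"
  have "(\<delta> * t) ^ m / fact m \<le> exp (\<delta> * t)"
    using sum_le_suminf[OF summable_exp_generic[of "\<delta> * t"], of "{m}"] assms t
    by (simp add: exp_def divide_inverse mult.commute)
  then have "t ^ m \<le> fact m / \<delta> ^ m * exp (\<delta> * t)"
    using assms by (simp add: power_mult_distrib field_simps)
  then show "t ^ m * exp (- \<delta> * t) \<le> fact m / \<delta> ^ m"
    by (simp add: exp_minus field_simps)
qed (use assms in simp)

text \<open>Entries of exp (- t B) are fixed linear combinations of terms t^m exp (- a t) with m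
  below the size of a block for the eigenvalue a. On the line Re a = \<rho> this gives the power N -
  1; to the right of it the spare factor exp (- (Re a - \<rho>) t) absorbs any power.\<close>

lemma mexp_jordan_bound:
  fixes B :: "real^'n^'n"
  assumes \<rho>: "\<rho> = min_re_spectrum B" and N: "N = max_jordan_block B \<rho>"
  shows "\<exists>C\<ge>0. \<forall>t\<ge>0. \<forall>i j. \<bar>mexp B (- t) $ i $ j\<bar> \<le> C * ((1 + t ^ (N - 1)) * exp (- \<rho> * t))"
proof -
  let ?n = "CARD('n)" and ?A = "complex_mat B"
  have A: "?A \<in> carrier_mat ?n ?n" by (simp add: complex_mat_def)
  obtain as where "char_poly ?A = (\<Prod>a\<leftarrow>as. [:- a, 1:])"
    using char_poly_factorized[OF A] by blast
  from jordan_nf_exists[OF A this] obtain n_as where nf: "jordan_nf ?A n_as" ..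
  obtain P Q where P: "P \<in> carrier_mat ?n ?n" and Q: "Q \<in> carrier_mat ?n ?n"
    and cp: "char_poly ?A = (\<Prod>(na, a)\<leftarrow>n_as. [:- a, 1:] ^ na)"
    and pow: "\<And>k. ?A ^\<^sub>m k = P * (jordan_matrix n_as)^\<^sub>m k * Q"
    using jordan_nf_powE[OF A nf] by metis
  have size: "sum_list (map fst ns) = ?n" if "jordan_nf ?A ns" for ns
  proof -
    have "similar_mat ?A (jordan_matrix ns)" using that by (simp add: jordan_nf_def)
    from similar_matD[OF this] obtain m where "{?A, jordan_matrix ns} \<subseteq> carrier_mat m m" by blast
    then have "dim_row (jordan_matrix ns) = m" "dim_row ?A = m" by (blast intro: carrier_matD)+
    then show ?thesis using carrier_matD(1)[OF A] by simp
  qed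
  have blk_pos: "n > 0" if "(n, ev) \<in> set n_as" for n ev
    using nf that unfolding jordan_nf_def by (metis fst_conv image_eqI neq0_conv)
  have spec: "ev \<in> spectrum ?A" if "(n, ev) \<in> set n_as" for n ev
  proof -
    have "poly (case (n, ev) of (n, a) \<Rightarrow> [:- a, 1:] ^ n) ev = 0"
      using blk_pos[OF that] by (simp add: poly_power)
    then have "0 \<in> (\<lambda>x. poly (case x of (n, a) \<Rightarrow> [:- a, 1:] ^ n) ev) ` set n_as"
      using that by (metis (no_types, lifting) image_eqI)
    then have "poly (char_poly ?A) ev = 0"
      unfolding cp by (simp add: poly_prod_list prod_list_zero_iff image_image o_def)
    then show ?thesis using spectrum_root_char_poly[OF A] by simp
  qed
  have fin: "finite (spectrum ?A)" using card_finite_spectrum[OF A] by simp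
  have ge: "Re ev \<ge> \<rho>" if "(n, ev) \<in> set n_as" for n ev
    unfolding \<rho> min_re_spectrum_def using fin spec[OF that] by (intro cInf_lower bdd_below_finite finite_imageI) auto
  \<comment> \<open>\<open>max_jordan_block\<close> ranges over all Jordan forms; block sizes are at
    most the dimension, so the set is finite and \<open>Max\<close> is meaningful.\<close>
  have le: "n \<le> N" if "(n, ev) \<in> set n_as" "Re ev = \<rho>" for n ev
    unfolding N max_jordan_block_def
  proof (rule Max_ge)
    show "n \<in> {n. \<exists>n_as ev. jordan_nf ?A n_as \<and> (n, ev) \<in> set n_as \<and> Re ev = \<rho>}" using nf that by blast
    have "n \<le> ?n" if "jordan_nf ?A ns" "(n, ev) \<in> set ns" for n ev ns
      using size[OF that(1)] member_le_sum_list[of n "map fst ns"] that(2) by force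
    then have "{n. \<exists>n_as ev. jordan_nf ?A n_as \<and> (n, ev) \<in> set n_as \<and> Re ev = \<rho>} \<subseteq> {..?n}" by auto
    then show "finite {n. \<exists>n_as ev. jordan_nf ?A n_as \<and> (n, ev) \<in> set n_as \<and> Re ev = \<rho>}" by (rule finite_subset) simp
  qed
  define g where "g t = (1 + t ^ (N - 1)) * exp (- \<rho> * t)" for t
  define J where "J k p q = (jordan_matrix n_as ^\<^sub>m k) $$ (p, q)" for k p q
  have entry: "\<exists>S C. (\<forall>t. (\<lambda>k. J k p q / fact k * complex_of_real t ^ k) sums S t) \<and> C \<ge> 0 \<and> (\<forall>t\<ge>0. norm (S (- t)) \<le> C * g t)"
    if pq: "p < ?n" "q < ?n" for p q
  proof -
    consider "\<forall>k. J k p q = 0" | n a m where "(n, a) \<in> set n_as" "m < n" "\<And>k. J k p q = of_nat (k choose m) * a ^ (k - m)"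
      using jordan_matrix_pow_entry[of p n_as q] pq size[OF nf] unfolding J_def by metis
    then show ?thesis
    proof cases
      case 1
      then show ?thesis by (intro exI[of _ "\<lambda>_. 0"] exI[of _ 0]) auto
    next
      case 2
      let ?S = "\<lambda>t. complex_of_real t ^ m / fact m * exp (a * complex_of_real t)"
      have S: "norm (?S (- t)) \<le> t ^ m * exp (- Re a * t)" if "t \<ge> 0" for t
      proof -
        have "norm (?S (- t)) = t ^ m / fact m * exp (- Re a * t)"
          using that by (simp add: norm_mult norm_divide norm_power norm_exp_eq_Re)
        also have "\<dots> \<le> t ^ m * exp (- Re a * t)"
          using that by (intro mult_right_mono) (auto simp: divide_le_eq mult_le_cancel_left1 fact_ge_1)
        finally show ?thesis .
      qed
      have "\<exists>C\<ge>0. \<forall>t\<ge>0. t ^ m * exp (- Re a * t) \<le> C * g t"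
      proof (cases "Re a = \<rho>")
        case True
        have "t ^ m \<le> 1 + t ^ (N - 1)" if "t \<ge> 0" for t :: real
        \<comment> \<open>For t below 1 the lower powers dominate, which is why the bound carries
          the summand 1.\<close>
        proof (cases "t \<le> 1")
          case True
          then show ?thesis using that power_le_one[of t m] by (simp add: add_increasing2)
        next
          case False
          then have "t ^ m \<le> t ^ (N - 1)" using le[OF 2(1) True] 2(2) by (intro power_increasing) auto
          then show ?thesis by simp
        qed
        then show ?thesis unfolding g_def True by (intro exI[of _ 1]) (auto intro!: mult_right_mono)
      next
        case False
        then have d: "Re a - \<rho> > 0" using ge[OF 2(1)] by simp
        obtain C where C: "C \<ge> 0" "\<And>t. t \<ge> 0 \<Longrightarrow> t ^ m * exp (- (Re a - \<rho>) * t) \<le> C"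
          using power_exp_bound[OF d, of m] by blast
        have "t ^ m * exp (- Re a * t) \<le> C * g t" if "t \<ge> 0" for t
        proof -
          have "t ^ m * exp (- Re a * t) = (t ^ m * exp (- (Re a - \<rho>) * t)) * exp (- \<rho> * t)"
            by (simp add: mult.assoc exp_add[symmetric] algebra_simps)
          also have "\<dots> \<le> C * exp (- \<rho> * t)" using C(2)[OF that] by (rule mult_right_mono) simp
          also have "\<dots> \<le> C * g t" unfolding g_def using C(1) that by (intro mult_left_mono) auto
          finally show ?thesis .
        qed
        then show ?thesis using C(1) by blast
      qed
      then obtain C where C: "C \<ge> 0" "\<forall>t\<ge>0. t ^ m * exp (- Re a * t) \<le> C * g t" by blast
      show ?thesis
        using binomial_exp_sums[of m a] C S by (intro exI[of _ ?S] exI[of _ C]) (auto simp: 2(3) intro: order_trans)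
    qed
  qed
  \<comment> \<open>Series value and constant are chosen together for each pair of indices, so that
    both become functions of p and q that can be summed.\<close>
  let ?R = "\<lambda>p q X. (\<forall>t. (\<lambda>k. J k p q / fact k * complex_of_real t ^ k) sums fst X t) \<and> snd X \<ge> 0 \<and>
      (\<forall>t\<ge>0. norm (fst X (- t)) \<le> snd X * g t)"
  define X where "X p q = (SOME X. ?R p q X)" for p q
  have X: "?R p q (X p q)" if pq: "p < ?n" "q < ?n" for p q
  proof -
    obtain S C where "\<forall>t. (\<lambda>k. J k p q / fact k * complex_of_real t ^ k) sums S t" "C \<ge> 0" "\<forall>t\<ge>0. norm (S (- t)) \<le> C * g t"
      using entry[OF pq] by blast
    then have "?R p q (S, C)" by simp
    then have "\<exists>X. ?R p q X" by (rule exI)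
    then show ?thesis unfolding X_def by (rule someI_ex)
  qed
  define S C where "S p q = fst (X p q)" and "C p q = snd (X p q)" for p q
  have SC: "\<And>p q t. p < ?n \<Longrightarrow> q < ?n \<Longrightarrow> (\<lambda>k. J k p q / fact k * complex_of_real t ^ k) sums S p q t"
      "\<And>p q. p < ?n \<Longrightarrow> q < ?n \<Longrightarrow> C p q \<ge> 0"
      "\<And>p q t. p < ?n \<Longrightarrow> q < ?n \<Longrightarrow> t \<ge> 0 \<Longrightarrow> norm (S p q (- t)) \<le> C p q * g t"
    using X by (simp_all add: S_def C_def)
  have g0: "g t \<ge> 0" if "t \<ge> 0" for t using that by (simp add: g_def)
  have E: "complex_of_real (mexp B t $ from_nat_into UNIV i $ from_nat_into UNIV j) = (\<Sum>q<?n. (\<Sum>p<?n. P $$ (i, p) * S p q t) * Q $$ (q, j))"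
    if ij: "i < ?n" "j < ?n" for i j t
  proof -
    have "(\<lambda>k. (\<Sum>q<?n. (\<Sum>p<?n. P $$ (i, p) * (J k p q / fact k * complex_of_real t ^ k)) * Q $$ (q, j)))
        sums (\<Sum>q<?n. (\<Sum>p<?n. P $$ (i, p) * S p q t) * Q $$ (q, j))"
      by (intro sums_sum sums_mult sums_mult2 SC(1)) auto
    moreover have "(\<Sum>q<?n. (\<Sum>p<?n. P $$ (i, p) * (J k p q / fact k * complex_of_real t ^ k)) * Q $$ (q, j))
       = complex_of_real (matpow B k $ from_nat_into UNIV i $ from_nat_into UNIV j / fact k * t ^ k)" for k
    proof -
      have d: "dim_row (jordan_matrix n_as ^\<^sub>m k) = ?n" "dim_col (jordan_matrix n_as ^\<^sub>m k) = ?n"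
        using size[OF nf] by (auto simp: pow_mat_dim)
      have "complex_of_real (matpow B k $ from_nat_into UNIV i $ from_nat_into UNIV j) = (P * (jordan_matrix n_as)^\<^sub>m k * Q) $$ (i, j)"
        using complex_mat_pow[OF ij, of B k] pow by simp
      also have "\<dots> = (\<Sum>q<?n. (\<Sum>p<?n. P $$ (i, p) * J k p q) * Q $$ (q, j))"
        using ij P Q d by (simp add: scalar_prod_def J_def atLeast0LessThan)
      finally show ?thesis by (simp add: sum_distrib_left sum_distrib_right sum_divide_distrib mult_ac)
    qed
    ultimately have "(\<lambda>k. complex_of_real (matpow B k $ from_nat_into UNIV i $ from_nat_into UNIV j / fact k * t ^ k)) sums (\<Sum>q<?n. (\<Sum>p<?n. P $$ (i, p) * S p q t) * Q $$ (q, j))"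
      by simp
    then show ?thesis using sums_of_real[OF mexp_sums] sums_unique2 by blast
  qed
  \<comment> \<open>Summed over i and j as well, so that one constant serves every entry.\<close>
  define K where "K = (\<Sum>i<?n. \<Sum>j<?n. \<Sum>q<?n. (\<Sum>p<?n. norm (P $$ (i, p)) * C p q) * norm (Q $$ (q, j)))"
  have K0: "0 \<le> (\<Sum>q<?n. (\<Sum>p<?n. norm (P $$ (i, p)) * C p q) * norm (Q $$ (q, j)))" for i j
    by (intro sum_nonneg mult_nonneg_nonneg) (auto simp: SC(2))
  have "\<bar>mexp B (- t) $ i' $ j'\<bar> \<le> K * g t" if t: "t \<ge> 0" for t i' j'
  proof -
    have "i' \<in> from_nat_into UNIV ` {..<?n}" "j' \<in> from_nat_into UNIV ` {..<?n}"
      using bij_betw_from_nat_into_finite[of "UNIV :: 'n set"] by (auto simp: bij_betw_def)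
    then obtain i j where ij: "i < ?n" "j < ?n" "i' = from_nat_into UNIV i" "j' = from_nat_into UNIV j" by auto
    have "\<bar>mexp B (- t) $ i' $ j'\<bar> = norm (complex_of_real (mexp B (- t) $ i' $ j'))" by simp
    also have "\<dots> \<le> (\<Sum>q<?n. (\<Sum>p<?n. norm (P $$ (i, p)) * (C p q * g t)) * norm (Q $$ (q, j)))"
      unfolding ij(3,4) E[OF ij(1,2)]
    proof (intro sum_norm_le order_trans[OF norm_mult_ineq] mult_right_mono)
      fix q p assume "q \<in> {..<?n}" "p \<in> {..<?n}"
      then show "norm (P $$ (i, p)) * norm (S p q (- t)) \<le> norm (P $$ (i, p)) * (C p q * g t)"
        by (intro mult_left_mono SC(3) t) auto
    qed auto
    also have "\<dots> = (\<Sum>q<?n. (\<Sum>p<?n. norm (P $$ (i, p)) * C p q) * norm (Q $$ (q, j))) * g t"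
      by (simp add: sum_distrib_left sum_distrib_right mult_ac)
    also have "\<dots> \<le> K * g t"
    proof (rule mult_right_mono[OF _ g0[OF t]])
      have "(\<Sum>q<?n. (\<Sum>p<?n. norm (P $$ (i, p)) * C p q) * norm (Q $$ (q, j))) \<le> (\<Sum>j<?n. \<Sum>q<?n. (\<Sum>p<?n. norm (P $$ (i, p)) * C p q) * norm (Q $$ (q, j)))"
        by (rule member_le_sum[of j "{..<?n}"]) (use ij K0 in auto)
      also have "\<dots> \<le> K" unfolding K_def
        by (rule member_le_sum[of i "{..<?n}" "\<lambda>i. \<Sum>j<?n. \<Sum>q<?n. (\<Sum>p<?n. norm (P $$ (i, p)) * C p q) * norm (Q $$ (q, j))"])
           (use ij K0 in \<open>auto intro: sum_nonneg\<close>)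
      finally show "(\<Sum>q<?n. (\<Sum>p<?n. norm (P $$ (i, p)) * C p q) * norm (Q $$ (q, j))) \<le> K" .
    qed
    finally show ?thesis .
  qed
  moreover have "K \<ge> 0" unfolding K_def by (intro sum_nonneg K0)
  ultimately show ?thesis unfolding g_def by blast
qed

section \<open>The Lyapunov equation\<close>

lemma inner_congruence: "\<xi> \<bullet> ((X ** Y ** transpose X) *v \<xi>) = (transpose X *v \<xi>) \<bullet> (Y *v (transpose X *v \<xi>))"
  for X Y :: "real^'n^'n"
  by (simp add: matrix_vector_mul_assoc[symmetric] inner_matrix_transpose del: transpose_matrix_vector)

lemma transpose_add: "transpose (X + Y) = transpose X + transpose Y"
  by (simp add: transpose_def vec_eq_iff)

lemma transpose_scaleR: "transpose (c *\<^sub>R X) = c *\<^sub>R transpose X" for X :: "real^'n^'m"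
  by (simp add: transpose_def vec_eq_iff)

lemma transpose_minus: "transpose (- X) = - transpose X" for X :: "real^'n^'m"
  by (simp add: transpose_def vec_eq_iff)

lemmas matrix_minus_left = bounded_bilinear.minus_left[OF bounded_bilinear_matrix_matrix_mult]
  and matrix_minus_right = bounded_bilinear.minus_right[OF bounded_bilinear_matrix_matrix_mult]

lemma bounded_linear_transpose: "bounded_linear (transpose :: real^'n^'m \<Rightarrow> real^'m^'n)"
  by (intro linear_conv_bounded_linear[THEN iffD1] linearI) (simp_all add: transpose_add transpose_scaleR)

lemma bounded_linear_inner_matrix: "bounded_linear (\<lambda>X :: real^'n^'m. x \<bullet> (X *v y))"
  by (rule bounded_linear_compose[OF bounded_linear_inner_right
      bounded_bilinear.bounded_linear_left[OF bounded_bilinear_matrix_vector_mult]])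

lemma mexp_minus_has_vector_derivative: "((\<lambda>t. mexp B (- t)) has_vector_derivative - (B ** mexp B (- t))) (at t)"
proof (rule has_vector_derivative_matrixI)
  fix i j
  have "((\<lambda>t. mexp B (- t) $ i $ j) has_real_derivative (B ** mexp B (- t)) $ i $ j * (- 1)) (at t)"
    by (rule DERIV_chain2[OF mexp_entry_derivative]) (auto intro!: derivative_eq_intros)
  then show "((\<lambda>t. mexp B (- t) $ i $ j) has_real_derivative (- (B ** mexp B (- t))) $ i $ j) (at t)" by simp
qed

lemma mexp_congruence_derivative:
  "((\<lambda>t. mexp B (- t) ** X ** transpose (mexp B (- t))) has_vector_derivative
     - (mexp B (- t) ** (B ** X + X ** transpose B) ** transpose (mexp B (- t)))) (at t)"
proof -
  let ?E = "mexp B (- t)"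
  have 1: "((\<lambda>t. mexp B (- t) ** X) has_vector_derivative - (B ** ?E) ** X) (at t)"
    by (rule bounded_linear.has_vector_derivative[OF bounded_bilinear.bounded_linear_left[OF bounded_bilinear_matrix_matrix_mult]
       mexp_minus_has_vector_derivative])
  have 2: "((\<lambda>t. transpose (mexp B (- t))) has_vector_derivative transpose (- (B ** ?E))) (at t)"
    by (rule bounded_linear.has_vector_derivative[OF bounded_linear_transpose mexp_minus_has_vector_derivative])
  have "((\<lambda>t. mexp B (- t) ** X ** transpose (mexp B (- t))) has_vector_derivative
      (?E ** X) ** transpose (- (B ** ?E)) + (- (B ** ?E) ** X) ** transpose ?E) (at t)"
    by (rule bounded_bilinear.has_vector_derivative[OF bounded_bilinear_matrix_matrix_mult 1 2])
  moreover have "(?E ** X) ** transpose (- (B ** ?E)) + (- (B ** ?E) ** X) ** transpose ?E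
      = - (?E ** (B ** X + X ** transpose B) ** transpose ?E)"
  proof -
    have "(?E ** X) ** transpose (B ** ?E) = ?E ** (X ** transpose B) ** transpose ?E"
      unfolding mexp_commute[symmetric, of B] by (simp add: matrix_transpose_mul matrix_mul_assoc)
    moreover have "(B ** ?E) ** X = ?E ** (B ** X)"
      by (simp add: mexp_commute[symmetric] matrix_mul_assoc)
    ultimately show ?thesis
      by (simp add: transpose_minus matrix_minus_left matrix_minus_right
          bounded_bilinear.add_left[OF bounded_bilinear_matrix_matrix_mult] bounded_bilinear.add_right[OF bounded_bilinear_matrix_matrix_mult])
  qed
  ultimately show ?thesis by simp
qed

definition qform :: "real^'n^'n \<Rightarrow> real^'n \<Rightarrow> real" where
  "qform X \<xi> = \<xi> \<bullet> (X *v \<xi>)"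

lemma qform_bound: "\<exists>K>0. \<forall>\<xi>. qform X \<xi> \<le> K * (norm \<xi>)\<^sup>2"
proof -
  obtain K where K: "K > 0" "\<And>\<xi>. norm (X *v \<xi>) \<le> norm \<xi> * K"
    using bounded_linear.pos_bounded[OF bounded_bilinear.bounded_linear_right[OF bounded_bilinear_matrix_vector_mult, of X]] by blast
  have "qform X \<xi> \<le> K * (norm \<xi>)\<^sup>2" for \<xi>
  proof -
    have "qform X \<xi> \<le> norm \<xi> * norm (X *v \<xi>)" unfolding qform_def by (rule norm_cauchy_schwarz)
    also have "\<dots> \<le> norm \<xi> * (norm \<xi> * K)" by (intro mult_left_mono K) simp
    finally show ?thesis by (simp add: power2_eq_square mult_ac)
  qed
  then show ?thesis using K(1) by blast
qed

lemma qform_congruence: "qform (X ** Y ** transpose X) \<xi> = qform Y (transpose X *v \<xi>)" for X Y :: "real^'n^'n"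
  unfolding qform_def by (rule inner_congruence)

locale hurwitz =
  fixes B D :: "real^'n^'n"
  assumes decay: "\<And>i j. ((\<lambda>t. mexp B (- t) $ i $ j) \<longlongrightarrow> 0) at_top"
    and D: "psd_matrix D"
begin

text \<open>The flow acts on frequencies: characteristic functions are transported by the transpose
  of exp (- t B), whereas the mean of the process moves by exp (- t B) itself.\<close>

definition flow :: "real \<Rightarrow> real^'n \<Rightarrow> real^'n" where
  "flow t \<xi> = transpose (mexp B (- t)) *v \<xi>"

lemma congruence_tendsto_0: "((\<lambda>t. mexp B (- t) ** X ** transpose (mexp B (- t))) \<longlongrightarrow> 0) at_top"
proof (intro vec_tendstoI)
  fix i j
  have "((\<lambda>t. \<Sum>l\<in>UNIV. (\<Sum>k\<in>UNIV. mexp B (- t) $ i $ k * X $ k $ l) * mexp B (- t) $ j $ l) \<longlongrightarrow> (\<Sum>l\<in>(UNIV::'n set). (\<Sum>k\<in>(UNIV::'n set). 0 * X $ k $ l) * 0)) at_top"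
    by (intro tendsto_sum tendsto_mult decay tendsto_const)
  then show "((\<lambda>t. (mexp B (- t) ** X ** transpose (mexp B (- t))) $ i $ j) \<longlongrightarrow> (0::real^'n^'n) $ i $ j) at_top"
    by (simp add: matrix_matrix_mult_def transpose_def)
qed

text \<open>If the Lyapunov operator kills \<open>X\<close>, the congruence of \<open>X\<close> by
  exp (- t B) is constant in t; it tends to 0 by decay, and at t = 0 it is \<open>X\<close>.\<close>

lemma lyapunov_injective:
  assumes "B ** X + X ** transpose B = 0"
  shows "X = 0"
proof -
  let ?F = "\<lambda>t. mexp B (- t) ** X ** transpose (mexp B (- t))"
  have "(?F has_vector_derivative 0) (at t within UNIV)" for t
    using mexp_congruence_derivative[of B X t] unfolding assms by simp
  then obtain c where c: "\<And>t. t \<in> UNIV \<Longrightarrow> ?F t = c"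
    using has_vector_derivative_zero_constant[of UNIV ?F] by auto
  then have "((\<lambda>t::real. c) \<longlongrightarrow> 0) at_top" using congruence_tendsto_0[of X] by simp
  then have "c = 0" using tendsto_const_iff[of "at_top::real filter"] by (simp add: tendsto_const_iff)
  then show ?thesis using c[of 0] by (simp add: mexp_0 transpose_mat)
qed

text \<open>An injective linear map of a finite-dimensional space into itself is onto, which
  replaces the improper integral of 2 exp (- t B) D exp (- t B^T) over positive times. Symmetry
  follows from uniqueness, since the transpose solves the same equation.\<close>

lemma lyapunov_solution: "\<exists>Q. B ** Q + Q ** transpose B = 2 *\<^sub>R D \<and> transpose Q = Q"
proof -
  let ?L = "\<lambda>X. B ** X + X ** transpose B"
  have lin: "linear ?L"
    by (intro linear_compose_add bounded_linear.linear bounded_bilinear.bounded_linear_left[OF bounded_bilinear_matrix_matrix_mult]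
        bounded_bilinear.bounded_linear_right[OF bounded_bilinear_matrix_matrix_mult])
  have "inj ?L" unfolding linear_injective_0[OF lin] using lyapunov_injective by blast
  then have "surj ?L" by (rule linear_injective_imp_surjective[OF lin]) (rule refl)
  then have "2 *\<^sub>R D \<in> range ?L" by simp
  then obtain Q where Q: "2 *\<^sub>R D = ?L Q" by (rule imageE)
  have "?L (transpose Q) = transpose (?L Q)" by (simp add: transpose_add matrix_transpose_mul add.commute)
  also have "\<dots> = ?L Q" unfolding Q[symmetric] using D by (simp add: transpose_scaleR psd_matrix_def)
  finally have "transpose Q = Q" by (rule injD[OF \<open>inj ?L\<close>])
  with Q[symmetric] show ?thesis by blast
qed

definition Q :: "real^'n^'n" where
  "Q = (SOME Q. B ** Q + Q ** transpose B = 2 *\<^sub>R D \<and> transpose Q = Q)"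

lemma Q: "B ** Q + Q ** transpose B = 2 *\<^sub>R D" "transpose Q = Q"
  using someI_ex[OF lyapunov_solution] unfolding Q_def by auto

lemma qform_D_nonneg: "0 \<le> qform D \<xi>"
  using D by (simp add: qform_def psd_matrix_def)

text \<open>Energy identity: the Lyapunov equation makes \<open>Q\<close> decrease along the flow at
  a rate given by \<open>D\<close> alone. For singular \<open>D\<close> this rate may vanish at
  single times, which is the difficulty of the hypoelliptic estimate.\<close>

lemma qform_flow_derivative: "((\<lambda>t. qform Q (flow t \<xi>)) has_real_derivative - 2 * qform D (flow t \<xi>)) (at t)"
proof -
  have "((\<lambda>t. \<xi> \<bullet> ((mexp B (- t) ** Q ** transpose (mexp B (- t))) *v \<xi>)) has_vector_derivative
      \<xi> \<bullet> (- (mexp B (- t) ** (2 *\<^sub>R D) ** transpose (mexp B (- t))) *v \<xi>)) (at t)"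
    using bounded_linear.has_vector_derivative[OF bounded_linear_inner_matrix mexp_congruence_derivative[of B Q t]] unfolding Q(1) .
  moreover have "\<xi> \<bullet> (- (mexp B (- t) ** (2 *\<^sub>R D) ** transpose (mexp B (- t))) *v \<xi>) = - 2 * qform D (flow t \<xi>)"
    using qform_congruence[of "mexp B (- t)" D \<xi>]
    by (simp add: flow_def qform_def bounded_bilinear.scaleR_left[OF bounded_bilinear_matrix_matrix_mult]
      bounded_bilinear.scaleR_right[OF bounded_bilinear_matrix_matrix_mult] scaleR_matrix_vector_assoc[symmetric]
      bounded_bilinear.minus_left[OF bounded_bilinear_matrix_vector_mult] del: transpose_matrix_vector)
  ultimately show ?thesis
    by (simp add: has_real_derivative_iff_has_vector_derivative flow_def inner_congruence qform_def del: transpose_matrix_vector)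
qed

lemma flow_0: "flow 0 \<xi> = \<xi>"
  by (simp add: flow_def mexp_0 transpose_mat)

lemma flow_add: "flow (s + t) \<xi> = flow t (flow s \<xi>)"
  by (simp add: flow_def mexp_add[symmetric] matrix_vector_mul_assoc matrix_transpose_mul[symmetric] add.commute del: transpose_matrix_vector)

lemma qform_flow_antimono:
  assumes "s \<le> t"
  shows "qform Q (flow t \<xi>) \<le> qform Q (flow s \<xi>)"
  by (rule DERIV_nonpos_imp_nonincreasing[OF assms])
    (use qform_flow_derivative qform_D_nonneg in \<open>force intro: exI[of _ "- 2 * qform D (flow _ \<xi>)"]\<close>)

lemma qform_flow_tendsto: "((\<lambda>t. qform Q (flow t \<xi>)) \<longlongrightarrow> 0) at_top"
proof -
  have "((\<lambda>t. \<xi> \<bullet> ((mexp B (- t) ** Q ** transpose (mexp B (- t))) *v \<xi>)) \<longlongrightarrow> \<xi> \<bullet> (0 *v \<xi>)) at_top"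
    by (rule bounded_linear.tendsto[OF bounded_linear_inner_matrix congruence_tendsto_0])
  then show ?thesis by (simp add: flow_def inner_congruence qform_def del: transpose_matrix_vector)
qed

text \<open>A non-increasing function with limit 0 is non-negative.\<close>

lemma qform_Q_nonneg: "0 \<le> qform Q \<xi>"
proof -
  have "0 \<le> qform Q (flow 0 \<xi>)"
  proof (rule tendsto_upperbound[OF qform_flow_tendsto])
    show "\<forall>\<^sub>F t in at_top. qform Q (flow t \<xi>) \<le> qform Q (flow 0 \<xi>)"
      using eventually_ge_at_top[of 0] by eventually_elim (rule qform_flow_antimono)
  qed simp
  then show ?thesis by (simp add: flow_0)
qed

lemma psd_Q: "psd_matrix Q"
  using Q(2) qform_Q_nonneg by (simp add: psd_matrix_def qform_def)

end

section \<open>Quantitative hypoellipticity\<close>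

text \<open>A chain of successive derivatives with constant last member stands for a polynomial of
  degree m. Its difference over a shift by t / 2 is again such a chain, one degree shorter and with
  top value A t / 2, and the L2 norm of this difference on half the interval is controlled by that
  of \<open>F 0\<close>.\<close>

lemma top_coefficient_bound:
  "\<exists>C>0. \<forall>t>0. \<forall>F::nat \<Rightarrow> real \<Rightarrow> real. \<forall>A. (\<forall>j<m. \<forall>x. (F j has_real_derivative F (Suc j) x) (at x)) \<and> (\<forall>x. F m x = A) \<longrightarrow>
     t ^ (2 * m + 1) * A\<^sup>2 \<le> C * integral {0..t} (\<lambda>x. (F 0 x)\<^sup>2)"
proof (induction m)
  case 0
  show ?case by (intro exI[of _ 1]) auto
next
  case (Suc m)
  from Suc.IH obtain C where C: "C > 0" and IH: "\<forall>t>0. \<forall>F::nat \<Rightarrow> real \<Rightarrow> real. \<forall>A. (\<forall>j<m. \<forall>x. (F j has_real_derivative F (Suc j) x) (at x)) \<and> (\<forall>x. F m x = A) \<longrightarrow>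
     t ^ (2 * m + 1) * A\<^sup>2 \<le> C * integral {0..t} (\<lambda>x. (F 0 x)\<^sup>2)"
    by (elim exE conjE)
  show ?case
  proof (intro exI conjI allI impI)
    \<comment> \<open>A factor 2^(2 m + 3) undoes t = 2 s in the power of t; a further 2 comes from
      the square of a difference.\<close>
    show "4 * C * 2 ^ (2 * m + 2) > 0" using C by simp
    fix t :: real and F :: "nat \<Rightarrow> real \<Rightarrow> real" and A
    assume t: "t > 0" and F: "(\<forall>j<Suc m. \<forall>x. (F j has_real_derivative F (Suc j) x) (at x)) \<and> (\<forall>x. F (Suc m) x = A)"
    define s where "s = t / 2"
    have s: "s > 0" "t = s + s" using t by (simp_all add: s_def)
    define G where "G j x = F j (x + s) - F j x" for j x
    have dF: "(F j has_real_derivative F (Suc j) x) (at x)" if "j < Suc m" for j x using F that by blast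
    have "G m x = A * s" for x
    proof -
      define H where "H y = F m y - A * y" for y
      have "(H has_real_derivative 0) (at y)" for y
        unfolding H_def using dF[of m y] F by (auto intro!: derivative_eq_intros)
      then have "H (x + s) = H x" using DERIV_isconst_all by blast
      then show ?thesis by (simp add: H_def G_def algebra_simps)
    qed
    moreover have "(G j has_real_derivative G (Suc j) x) (at x)" if "j < m" for j x
      unfolding G_def using that dF[of j] DERIV_shift[of "F j" "F (Suc j) (x + s)" x s]
      by (auto intro!: DERIV_diff)
    ultimately have 1: "s ^ (2 * m + 1) * (A * s)\<^sup>2 \<le> C * integral {0..s} (\<lambda>x. (G 0 x)\<^sup>2)"
      by (intro IH[rule_format] s(1)) simp
    have cont: "continuous_on X (F 0)" for X
      using dF[of 0] by (auto intro!: continuous_at_imp_continuous_on DERIV_isCont)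
    have contG: "continuous_on X (G 0)" for X unfolding G_def
      by (intro continuous_intros continuous_on_compose2[OF cont[of UNIV]]) auto
    have i: "(\<lambda>x. (F 0 x)\<^sup>2) integrable_on {u..v}" for u v
      by (intro integrable_continuous_real continuous_intros cont)
    have ish: "(\<lambda>x. (F 0 (x + s))\<^sup>2) integrable_on {u..v}" for u v
      by (intro integrable_continuous_real continuous_intros continuous_on_compose2[OF cont[of UNIV]]) auto
    have "integral {0..s} (\<lambda>x. (G 0 x)\<^sup>2) \<le> integral {0..s} (\<lambda>x. 2 * (F 0 (x + s))\<^sup>2 + 2 * (F 0 x)\<^sup>2)"
    proof (rule integral_le)
      show "(\<lambda>x. (G 0 x)\<^sup>2) integrable_on {0..s}" by (intro integrable_continuous_real continuous_intros contG)
      show "(\<lambda>x. 2 * (F 0 (x + s))\<^sup>2 + 2 * (F 0 x)\<^sup>2) integrable_on {0..s}"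
        by (intro integrable_add integrable_on_mult_right i ish)
      fix x
      have "0 \<le> (F 0 (x + s) + F 0 x)\<^sup>2" by simp
      then show "(G 0 x)\<^sup>2 \<le> 2 * (F 0 (x + s))\<^sup>2 + 2 * (F 0 x)\<^sup>2"
        by (simp add: G_def power2_eq_square algebra_simps)
    qed
    also have "\<dots> = 2 * (integral {0..s} (\<lambda>x. (F 0 (x + s))\<^sup>2) + integral {0..s} (\<lambda>x. (F 0 x)\<^sup>2))"
      using i ish by (simp add: integral_add integrable_on_cmult_left)
    also have "integral {0..s} (\<lambda>x. (F 0 (x + s))\<^sup>2) = integral {s..t} (\<lambda>x. (F 0 x)\<^sup>2)"
      using integral_shift[of 0 s s "\<lambda>x. (F 0 x)\<^sup>2"] s(2) by (simp add: o_def continuous_intros cont)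
    also have "integral {s..t} (\<lambda>x. (F 0 x)\<^sup>2) + integral {0..s} (\<lambda>x. (F 0 x)\<^sup>2) = integral {0..t} (\<lambda>x. (F 0 x)\<^sup>2)"
      using Henstock_Kurzweil_Integration.integral_combine[OF _ _ i, of 0 s t] s by simp
    finally have 2: "integral {0..s} (\<lambda>x. (G 0 x)\<^sup>2) \<le> 2 * integral {0..t} (\<lambda>x. (F 0 x)\<^sup>2)" .
    have e: "2 * Suc m + 1 = 2 * m + 3" by simp
    have "s ^ ((2 * m + 1) + 2) = s ^ (2 * m + 1) * s\<^sup>2" by (rule power_add)
    moreover have "(2 * m + 1) + 2 = 2 * m + 3" by simp
    ultimately have "s ^ (2 * m + 3) = s ^ (2 * m + 1) * s\<^sup>2" by metis
    then have "t ^ (2 * Suc m + 1) * A\<^sup>2 = 2 ^ (2 * m + 3) * (s ^ (2 * m + 1) * (A * s)\<^sup>2)"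
      unfolding e s(2) mult_2[symmetric] power_mult_distrib by simp
    also have "\<dots> \<le> 2 ^ (2 * m + 3) * (C * (2 * integral {0..t} (\<lambda>x. (F 0 x)\<^sup>2)))"
      using 1 2 C by (intro mult_left_mono order_trans[OF 1]) auto
    finally show "t ^ (2 * Suc m + 1) * A\<^sup>2 \<le> 4 * C * 2 ^ (2 * m + 2) * integral {0..t} (\<lambda>x. (F 0 x)\<^sup>2)"
      by (simp add: power_add mult_ac)
  qed
qed

text \<open>The preceding lemma bounds the top coefficient, hence also the L2 norm of its monomial;
  the remainder of lower degree is left to the induction hypothesis. The exponent 2 k + 1 matches
  the scaling of x, so the constant does not depend on t.\<close>

lemma polynomial_coefficients_bound:
  "\<exists>C>0. \<forall>t>0. \<forall>\<alpha>::nat \<Rightarrow> real. \<forall>k\<le>m. t ^ (2 * k + 1) * (\<alpha> k)\<^sup>2 \<le> C * integral {0..t} (\<lambda>x. (\<Sum>i\<le>m. \<alpha> i * x ^ i)\<^sup>2)"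
proof (induction m)
  case 0
  show ?case by (intro exI[of _ 1]) auto
next
  case (Suc m)
  from Suc.IH obtain C where C: "C > 0" and IH: "\<forall>t>0. \<forall>\<alpha>::nat \<Rightarrow> real. \<forall>k\<le>m.
      t ^ (2 * k + 1) * (\<alpha> k)\<^sup>2 \<le> C * integral {0..t} (\<lambda>x. (\<Sum>i\<le>m. \<alpha> i * x ^ i)\<^sup>2)"
    by (elim exE conjE)
  from top_coefficient_bound[of "Suc m"] obtain C1 where C1: "C1 > 0"
    and top: "\<forall>t>0. \<forall>F::nat \<Rightarrow> real \<Rightarrow> real. \<forall>A. (\<forall>j<Suc m. \<forall>x. (F j has_real_derivative F (Suc j) x) (at x)) \<and> (\<forall>x. F (Suc m) x = A) \<longrightarrow>
     t ^ (2 * Suc m + 1) * A\<^sup>2 \<le> C1 * integral {0..t} (\<lambda>x. (F 0 x)\<^sup>2)"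
    by (elim exE conjE)
  show ?case
  proof (intro exI conjI allI impI)
    show "C1 + C * (2 + 2 * C1) > 0" using C C1 by (simp add: add_pos_pos)
    fix t :: real and \<alpha> :: "nat \<Rightarrow> real" and k
    assume t: "t > 0" and k: "k \<le> Suc m"
    let ?p = "\<lambda>x. \<Sum>i\<le>Suc m. \<alpha> i * x ^ i" and ?q = "\<lambda>x. \<Sum>i\<le>m. \<alpha> i * x ^ i"
    let ?I = "integral {0..t} (\<lambda>x. (?p x)\<^sup>2)"
    have I0: "?I \<ge> 0" by (intro integral_nonneg integrable_continuous_real continuous_intros) auto
    \<comment> \<open>The j-th derivative of the polynomial as a sum of fixed length; the
      conditional removes the indices i < j, where the truncated difference i - j would be
      wrong.\<close>
    define F where "F j x = (\<Sum>i\<le>Suc m. \<alpha> i * (if j \<le> i then fact i / fact (i - j) * x ^ (i - j) else 0))" for j :: nat and x :: real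
    have top1: "t ^ (2 * Suc m + 1) * (fact (Suc m) * \<alpha> (Suc m))\<^sup>2 \<le> C1 * ?I"
    proof -
      have "(F j has_real_derivative F (Suc j) x) (at x)" for j x
        unfolding F_def
      proof (intro DERIV_sum DERIV_cmult)
        fix i
        show "((\<lambda>x::real. if j \<le> i then fact i / fact (i - j) * x ^ (i - j) else 0) has_real_derivative
            (if Suc j \<le> i then fact i / fact (i - Suc j) * x ^ (i - Suc j) else 0)) (at x)"
        proof (cases "Suc j \<le> i")
          case True
          then obtain l where l: "i - j = Suc l" "i - Suc j = l" by (metis Suc_diff_Suc Suc_le_eq)
          have "((\<lambda>x::real. fact i / fact (Suc l) * x ^ Suc l) has_real_derivative fact i / fact (Suc l) * (real (Suc l) * x ^ l)) (at x)"
            using DERIV_cmult[OF DERIV_pow[of "Suc l" x UNIV], of "fact i / fact (Suc l)"] by (simp del: fact_Suc of_nat_Suc power_Suc)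
          moreover have "fact i / fact (Suc l) * (real (Suc l) * x ^ l) = fact i / fact l * x ^ l" by (simp add: field_simps del: of_nat_Suc)
          ultimately show ?thesis using True l by simp
        next
          case False
          then show ?thesis by (cases "j = i") auto
        qed
      qed
      moreover have "F (Suc m) x = fact (Suc m) * \<alpha> (Suc m)" for x
        by (simp add: F_def)
      moreover have "F 0 x = ?p x" for x by (simp add: F_def)
      ultimately show ?thesis using top[rule_format, OF t, of F "fact (Suc m) * \<alpha> (Suc m)"] by (simp del: fact_Suc sum.atMost_Suc)
    qed
    have "(\<alpha> (Suc m))\<^sup>2 \<le> (fact (Suc m) * \<alpha> (Suc m))\<^sup>2"
      using one_le_power[of "fact (Suc m) :: real" 2] mult_right_mono[of 1 "(fact (Suc m))\<^sup>2" "(\<alpha> (Suc m))\<^sup>2"]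
      by (simp add: power_mult_distrib fact_ge_1 del: fact_Suc)
    then have top2: "t ^ (2 * Suc m + 1) * (\<alpha> (Suc m))\<^sup>2 \<le> C1 * ?I"
      using t by (intro order_trans[OF mult_left_mono top1]) auto
    show "t ^ (2 * k + 1) * (\<alpha> k)\<^sup>2 \<le> (C1 + C * (2 + 2 * C1)) * ?I"
    proof (cases "k = Suc m")
      case True
      have "0 \<le> C * (2 + 2 * C1) * ?I" using C C1 I0 by simp
      then show ?thesis using top2 True by (simp add: distrib_right)
    next
      case False
      have "integral {0..t} (\<lambda>x. (?q x)\<^sup>2) \<le> integral {0..t} (\<lambda>x. 2 * (?p x)\<^sup>2 + 2 * ((\<alpha> (Suc m))\<^sup>2 * t ^ (2 * Suc m)))"
      proof (rule integral_le)
        fix x assume x: "x \<in> {0..t}"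
        have "(?q x)\<^sup>2 \<le> 2 * (?p x)\<^sup>2 + 2 * (\<alpha> (Suc m) * x ^ Suc m)\<^sup>2"
        proof -
          \<comment> \<open>With r the top monomial and p = q + r, one has 2 p^2 + 2 r^2 - q^2 = (q
            + 2 r)^2.\<close>
          have "0 \<le> (?q x + 2 * (\<alpha> (Suc m) * x ^ Suc m))\<^sup>2" by simp
          then show ?thesis by (simp add: power2_eq_square algebra_simps)
        qed
        also have "(\<alpha> (Suc m) * x ^ Suc m)\<^sup>2 = (\<alpha> (Suc m))\<^sup>2 * x ^ (2 * Suc m)"
          by (simp only: power_mult_distrib power_mult[symmetric] mult.commute[of 2])
        also have "(\<alpha> (Suc m))\<^sup>2 * x ^ (2 * Suc m) \<le> (\<alpha> (Suc m))\<^sup>2 * t ^ (2 * Suc m)"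
          using x by (intro mult_left_mono power_mono) auto
        finally show "(?q x)\<^sup>2 \<le> 2 * (?p x)\<^sup>2 + 2 * ((\<alpha> (Suc m))\<^sup>2 * t ^ (2 * Suc m))" by simp
      qed (intro integrable_continuous_real continuous_intros)+
      also have "\<dots> = 2 * ?I + 2 * (t ^ (2 * Suc m + 1) * (\<alpha> (Suc m))\<^sup>2)"
      proof -
        have i1: "(\<lambda>x. 2 * (?p x)\<^sup>2) integrable_on {0..t}" by (intro integrable_continuous_real continuous_intros)
        show ?thesis using t by (subst integral_add[OF i1]) (auto simp: mult_ac)
      qed
      also have "\<dots> \<le> (2 + 2 * C1) * ?I" using top2 by (simp add: distrib_right)
      finally have "C * integral {0..t} (\<lambda>x. (?q x)\<^sup>2) \<le> C * ((2 + 2 * C1) * ?I)" using C by (intro mult_left_mono) auto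
      moreover have "t ^ (2 * k + 1) * (\<alpha> k)\<^sup>2 \<le> C * integral {0..t} (\<lambda>x. (?q x)\<^sup>2)" using False k t by (intro IH[rule_format]) auto
      moreover have "0 \<le> C1 * ?I" using C1 I0 by simp
      ultimately show ?thesis by (simp add: distrib_right mult.assoc)
    qed
  qed
qed

lemma transpose_matpow: "transpose (matpow A k) = matpow (transpose A) k"
  by (induction k) (simp_all add: transpose_mat matrix_transpose_mul matpow_commute)

lemma qform_sum: "qform (\<Sum>k\<in>A. X k) \<xi> = (\<Sum>k\<in>A. qform (X k) \<xi>)"
  unfolding qform_def by (rule linear_sum[OF bounded_linear.linear[OF bounded_linear_inner_matrix]])

lemma qform_bracket: "qform (matpow B k ** D ** matpow (transpose B) k) \<xi> = qform D (matpow (transpose B) k *v \<xi>)"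
  using qform_congruence[of "matpow B k" D \<xi>] by (simp add: transpose_matpow del: transpose_matrix_vector)

lemma pd_matrix_lower_bound:
  fixes X :: "real^'n^'n"
  assumes X: "pd_matrix X"
  shows "\<exists>c>0. \<forall>\<xi>. c * (norm \<xi>)\<^sup>2 \<le> qform X \<xi>"
proof -
  have "\<exists>x\<in>sphere 0 1. \<forall>y\<in>sphere 0 1. qform X x \<le> qform X y"
  proof (rule continuous_attains_inf)
    show "sphere (0::real^'n) 1 \<noteq> {}" by simp
    show "continuous_on (sphere 0 1) (qform X)" unfolding qform_def
      by (intro continuous_intros linear_continuous_on bounded_bilinear.bounded_linear_right[OF bounded_bilinear_matrix_vector_mult])
  qed simp
  then obtain x where x: "norm x = 1" "\<And>y. norm y = 1 \<Longrightarrow> qform X x \<le> qform X y" by auto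
  have "x \<noteq> 0" using x(1) by auto
  then have pos: "qform X x > 0" using X by (simp add: pd_matrix_def qform_def)
  have "qform X x * (norm \<xi>)\<^sup>2 \<le> qform X \<xi>" for \<xi>
  proof (cases "\<xi> = 0")
    case False
    then have "qform X x \<le> qform X ((1 / norm \<xi>) *\<^sub>R \<xi>)" by (intro x(2)) simp
    also have "\<dots> = qform X \<xi> / (norm \<xi>)\<^sup>2"
      by (simp add: qform_def matrix_vector_mult_scaleR power2_eq_square)
    finally show ?thesis using False by (simp add: field_simps)
  qed (simp add: qform_def)
  then show ?thesis using pos by blast
qed

text \<open>From D \<le> K follows D^2 \<le> K D; the form is expanded at v - t D v with t = 1 / K,
  which avoids a matrix square root. It shows that D v = 0 wherever the form vanishes, and later
  bounds a Taylor remainder.\<close>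

lemma psd_matrix_norm_bound:
  fixes D :: "real^'n^'n"
  assumes D: "psd_matrix D"
  shows "\<exists>K>0. \<forall>v. (norm (D *v v))\<^sup>2 \<le> K * qform D v"
proof -
  obtain K where K: "K > 0" "\<And>\<xi>. qform D \<xi> \<le> K * (norm \<xi>)\<^sup>2" using qform_bound[of D] by blast
  have "(norm (D *v v))\<^sup>2 \<le> K * qform D v" for v
  proof -
    let ?w = "D *v v"
    define t where "t = 1 / K"
    have t: "t > 0" "t * K = 1" using K(1) by (simp_all add: t_def)
    have ww: "?w \<bullet> ?w = (norm ?w)\<^sup>2" by (simp add: power2_norm_eq_inner)
    have vw: "v \<bullet> (D *v ?w) = (norm ?w)\<^sup>2"
      using symmetric_matrix_inner[of D v ?w] D ww by (simp add: psd_matrix_def)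
    have "0 \<le> qform D (v - t *\<^sub>R ?w)" using D by (simp add: psd_matrix_def qform_def)
    also have "\<dots> = qform D v - t * (v \<bullet> (D *v ?w)) - t * (?w \<bullet> ?w) + t\<^sup>2 * qform D ?w"
      by (simp add: qform_def matrix_vector_mult_diff_distrib matrix_vector_mult_scaleR inner_diff_left inner_diff_right
          power2_eq_square algebra_simps)
    also have "\<dots> = qform D v - 2 * t * (norm ?w)\<^sup>2 + t\<^sup>2 * qform D ?w" unfolding ww vw by simp
    also have "\<dots> \<le> qform D v - 2 * t * (norm ?w)\<^sup>2 + t\<^sup>2 * (K * (norm ?w)\<^sup>2)"
      using K(2)[of ?w] by (intro add_left_mono mult_left_mono) auto
    also have "t\<^sup>2 * (K * (norm ?w)\<^sup>2) = t * (norm ?w)\<^sup>2"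
      using t(2) by (simp add: power2_eq_square mult.assoc[symmetric])
    finally have "t * (norm ?w)\<^sup>2 \<le> qform D v" by simp
    then have "K * (t * (norm ?w)\<^sup>2) \<le> K * qform D v" using K(1) by (intro mult_left_mono) auto
    then show ?thesis using t(2) by (simp add: mult.assoc[symmetric] mult.commute[of K])
  qed
  then show ?thesis using K(1) by blast
qed

lemma subspace_matrix_kernel: "Real_Vector_Spaces.subspace {x. A *v x = 0}" for A :: "real^'n^'m"
  by (auto simp: Real_Vector_Spaces.subspace_def matrix_vector_right_distrib matrix_vector_mult_scaleR)

text \<open>The joint kernels \<open>S m\<close> decrease, so at an m of minimal dimension
  \<open>S (Suc m) = S m\<close>. This subspace of the kernel of \<open>D\<close> is mapped into
  itself by B^T, hence trivial. Some m therefore makes the sum positive definite, and the minimum in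
  \<open>num_brackets\<close> is attained.\<close>

lemma bracket_matrix_pd:
  fixes B D :: "real^'n^'n"
  assumes D: "psd_matrix D" and ker: "kernel_nondegenerate B D"
  shows "pd_matrix (\<Sum>k\<le>num_brackets B D. matpow B k ** D ** matpow (transpose B) k)"
proof -
  let ?W = "\<lambda>m. \<Sum>k\<le>m. matpow B k ** D ** matpow (transpose B) k"
  define S where "S m = (\<Inter>k\<le>m. {x. (D ** matpow (transpose B) k) *v x = 0})" for m
  have S_iff: "x \<in> S m \<longleftrightarrow> (\<forall>k\<le>m. D *v (matpow (transpose B) k *v x) = 0)" for x m
    by (auto simp: S_def matrix_vector_mul_assoc)
  have sub: "Real_Vector_Spaces.subspace (S m)" for m
    unfolding S_def by (intro subspace_Inter) (auto intro: subspace_matrix_kernel)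
  obtain m where m: "\<And>m'. dim (S m) \<le> dim (S m')"
    using ex_has_least_nat[of "\<lambda>_. True" 0 "\<lambda>m. dim (S m)"] by auto
  have "S (Suc m) \<subseteq> S m" by (auto simp: S_def)
  then have Suc: "S (Suc m) = S m" by (rule subspace_dim_equal[OF sub sub _ m])
  have "S m = {0}"
  proof -
    have "S m \<subseteq> {x. D *v x = 0}"
    proof
      fix x assume "x \<in> S m"
      then have "D *v (matpow (transpose B) 0 *v x) = 0" unfolding S_iff by blast
      then show "x \<in> {x. D *v x = 0}" by simp
    qed
    moreover have "transpose B *v x \<in> S m" if "x \<in> S m" for x
    proof -
      have x: "x \<in> S (Suc m)" using that Suc by simp
      have "D *v (matpow (transpose B) k *v (transpose B *v x)) = 0" if "k \<le> m" for k
      proof -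
        have "D *v (matpow (transpose B) (Suc k) *v x) = 0" using x that S_iff[of x "Suc m"] Suc_le_mono by blast
        moreover have "matpow (transpose B) k ** transpose B = matpow (transpose B) (Suc k)"
          by (simp add: matpow_commute)
        ultimately show ?thesis by (simp only: matrix_vector_mul_assoc)
      qed
      then show ?thesis unfolding S_iff by blast
    qed
    ultimately show ?thesis using ker sub unfolding kernel_nondegenerate_def by blast
  qed
  have "pd_matrix (?W m)"
    unfolding pd_matrix_def
  proof (intro conjI allI impI)
    have "transpose (matpow B k ** D ** matpow (transpose B) k) = matpow B k ** D ** matpow (transpose B) k" for k
      using D transpose_matpow[of B k, symmetric] by (simp add: psd_matrix_def matrix_transpose_mul transpose_transpose matrix_mul_assoc)
    then show "transpose (?W m) = ?W m"
      using linear_sum[OF bounded_linear.linear[OF bounded_linear_transpose], of "\<lambda>k. matpow B k ** D ** matpow (transpose B) k" "{..m}"] by simp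
    fix x :: "real^'n" assume "x \<noteq> 0"
    then have "x \<notin> S m" using \<open>S m = {0}\<close> by simp
    then obtain k where k: "k \<le> m" "D *v (matpow (transpose B) k *v x) \<noteq> 0"
      by (auto simp: S_def matrix_vector_mul_assoc)
    obtain K where K: "K > 0" "\<And>v. (norm (D *v v))\<^sup>2 \<le> K * qform D v" using psd_matrix_norm_bound[OF D] by blast
    have "0 < (norm (D *v (matpow (transpose B) k *v x)))\<^sup>2" using k(2) by simp
    also have "\<dots> \<le> K * qform D (matpow (transpose B) k *v x)" by (rule K(2))
    finally have pos: "0 < qform D (matpow (transpose B) k *v x)" using K(1) by (simp add: zero_less_mult_iff)
    have "qform D (matpow (transpose B) k *v x) \<le> (\<Sum>k\<le>m. qform D (matpow (transpose B) k *v x))"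
      by (rule member_le_sum) (use k(1) D in \<open>auto simp: psd_matrix_def qform_def\<close>)
    then show "0 < x \<bullet> (?W m *v x)"
      using pos unfolding qform_def[symmetric] qform_sum qform_bracket by simp
  qed
  then show ?thesis unfolding num_brackets_def by (rule LeastI)
qed

context hurwitz
begin

lemma flow_has_vector_derivative: "((\<lambda>s. flow s \<xi>) has_vector_derivative - (transpose B *v flow s \<xi>)) (at s)"
proof -
  have "((\<lambda>s. transpose (mexp B (- s))) has_vector_derivative transpose (- (B ** mexp B (- s)))) (at s)"
    by (rule bounded_linear.has_vector_derivative[OF bounded_linear_transpose mexp_minus_has_vector_derivative])
  from bounded_linear.has_vector_derivative[OF bounded_bilinear.bounded_linear_left[OF bounded_bilinear_matrix_vector_mult] this, of \<xi>]
  show ?thesis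
    by (simp add: flow_def mexp_commute[symmetric] transpose_minus matrix_transpose_mul matrix_vector_mul_assoc[symmetric]
       bounded_bilinear.minus_left[OF bounded_bilinear_matrix_vector_mult] del: transpose_matrix_vector)
qed

lemma flow_bounded: "\<exists>C>0. \<forall>s\<in>{0..1}. \<forall>\<xi>. norm (A *v flow s \<xi>) \<le> C * norm \<xi>" for A :: "real^'n^'n"
proof -
  obtain K where K: "K > 0" "\<And>X y. norm ((X::real^'n^'n) *v y) \<le> norm X * norm y * K"
    using bounded_bilinear.pos_bounded[OF bounded_bilinear_matrix_vector_mult] by blast
  have "continuous_on {0..1} (\<lambda>s. A ** transpose (mexp B (- s)))"
  proof (intro continuous_at_imp_continuous_on ballI)
    fix s :: real
    have "((\<lambda>s. A ** transpose (mexp B (- s))) has_vector_derivative A ** transpose (- (B ** mexp B (- s)))) (at s)"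
      by (rule bounded_linear.has_vector_derivative[OF bounded_bilinear.bounded_linear_right[OF bounded_bilinear_matrix_matrix_mult]
         bounded_linear.has_vector_derivative[OF bounded_linear_transpose mexp_minus_has_vector_derivative]])
    then show "isCont (\<lambda>s. A ** transpose (mexp B (- s))) s" by (rule has_vector_derivative_continuous)
  qed
  then have "compact ((\<lambda>s. A ** transpose (mexp B (- s))) ` {0..1})" by (rule compact_continuous_image) simp
  then obtain L where L: "\<And>s. s \<in> {0..1} \<Longrightarrow> norm (A ** transpose (mexp B (- s))) \<le> L"
    using compact_imp_bounded bounded_iff by (metis image_eqI)
  have L0: "0 \<le> L" using order_trans[OF norm_ge_zero L[of 0]] by simp
  have "norm (A *v flow s \<xi>) \<le> (L * K + 1) * norm \<xi>" if "s \<in> {0..1}" for s \<xi>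
  proof -
    have "norm (A *v flow s \<xi>) = norm ((A ** transpose (mexp B (- s))) *v \<xi>)"
      by (simp add: flow_def matrix_vector_mul_assoc del: transpose_matrix_vector)
    also have "\<dots> \<le> norm (A ** transpose (mexp B (- s))) * norm \<xi> * K" by (rule K(2))
    also have "\<dots> \<le> L * norm \<xi> * K" using L[OF that] K(1) by (intro mult_right_mono) auto
    also have "\<dots> \<le> (L * K + 1) * norm \<xi>" by (simp add: algebra_simps)
    finally show ?thesis .
  qed
  moreover have "L * K + 1 > 0" using L0 K(1) by (simp add: add_nonneg_pos)
  ultimately show ?thesis by blast
qed

lemma qform_flow_integral:
  assumes "0 \<le> t"
  shows "((\<lambda>s. 2 * qform D (flow s \<xi>)) has_integral (qform Q \<xi> - qform Q (flow t \<xi>))) {0..t}"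
proof -
  have "((\<lambda>s. - 2 * qform D (flow s \<xi>)) has_integral (qform Q (flow t \<xi>) - qform Q (flow 0 \<xi>))) {0..t}"
    by (rule fundamental_theorem_of_calculus[OF assms])
      (use qform_flow_derivative in \<open>auto simp: has_real_derivative_iff_has_vector_derivative[symmetric] intro: has_field_derivative_at_within\<close>)
  from has_integral_neg[OF this] show ?thesis by (simp add: flow_0)
qed

text \<open>Taylor expansion to order \<open>M\<close> of \<open>s \<mapsto> D\<eta> \<bullet> flow s \<xi>\<close> with \<open>\<eta> = (B\<^sup>T)\<^sup>k \<xi>\<close>; by the Cauchy-Schwarz
  inequality the square of this function is at most \<open>qform D \<eta> * qform D (flow s \<xi>)\<close>.\<close>

lemma flow_gain_direction:
  "\<exists>C1>0. \<exists>C2>0. \<forall>t \<xi> k. 0 < t \<and> t \<le> 1 \<and> k \<le> M \<longrightarrow>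
     t ^ (2 * M + 1) * qform D (matpow (transpose B) k *v \<xi>)
       \<le> C1 * (qform Q \<xi> - qform Q (flow t \<xi>)) + C2 * t ^ (2 * M + 3) * (norm \<xi>)\<^sup>2"
proof -
  obtain C where C: "C > 0" and poly: "\<forall>t>0. \<forall>\<alpha>::nat \<Rightarrow> real. \<forall>k\<le>M.
      t ^ (2 * k + 1) * (\<alpha> k)\<^sup>2 \<le> C * integral {0..t} (\<lambda>x. (\<Sum>i\<le>M. \<alpha> i * x ^ i)\<^sup>2)"
    using polynomial_coefficients_bound[of M] by (elim exE conjE)
  obtain K where K: "K > 0" "\<And>v. (norm (D *v v))\<^sup>2 \<le> K * qform D v" using psd_matrix_norm_bound[OF D] by blast
  obtain L where L: "L > 0" "\<And>s \<xi>. s \<in> {0..1} \<Longrightarrow> norm (matpow (transpose B) (Suc M) *v flow s \<xi>) \<le> L * norm \<xi>"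
    using flow_bounded[of "matpow (transpose B) (Suc M)"] by blast
  define C1 where "C1 = (fact M)\<^sup>2 * C"
  define C2 where "C2 = C1 * (2 * L\<^sup>2 * K)"
  have C12: "C1 > 0" "C2 > 0" using C K(1) L(1) by (simp_all add: C1_def C2_def)
  have main: "t ^ (2 * M + 1) * qform D (matpow (transpose B) k *v \<xi>)
       \<le> C1 * (qform Q \<xi> - qform Q (flow t \<xi>)) + C2 * t ^ (2 * M + 3) * (norm \<xi>)\<^sup>2"
    if t: "0 < t" "t \<le> 1" and k: "k \<le> M" for t \<xi> k
  proof -
    let ?\<eta> = "matpow (transpose B) k *v \<xi>"
    define d where "d = qform D ?\<eta>"
    define w where "w = D *v ?\<eta>"
    define h where "h = qform Q \<xi> - qform Q (flow t \<xi>)"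
    have h0: "h \<ge> 0" using qform_flow_antimono[of 0 t \<xi>] t by (simp add: h_def flow_0)
    have d0: "d \<ge> 0" unfolding d_def by (rule qform_D_nonneg)
    show ?thesis
    proof (cases "d = 0")
      case True
      then show ?thesis using C12 h0 t by (simp add: d_def[symmetric] h_def[symmetric])
    next
      case False
      then have d: "d > 0" using d0 by simp
      \<comment> \<open>The j-th derivative in s of w \<bullet> flow s \<xi>; each differentiation
        brings down - B^T.\<close>
      define F where "F j s = (- 1) ^ j * (w \<bullet> (matpow (transpose B) j *v flow s \<xi>))" for j s
      have dF: "(F j has_real_derivative F (Suc j) s) (at s)" for j s
      proof -
        have "((\<lambda>s. w \<bullet> (matpow (transpose B) j *v flow s \<xi>)) has_vector_derivative w \<bullet> (matpow (transpose B) j *v (- (transpose B *v flow s \<xi>)))) (at s)"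
          by (rule bounded_linear.has_vector_derivative[OF bounded_linear_inner_right
              bounded_linear.has_vector_derivative[OF bounded_bilinear.bounded_linear_right[OF bounded_bilinear_matrix_vector_mult] flow_has_vector_derivative]])
        then have "((\<lambda>s. w \<bullet> (matpow (transpose B) j *v flow s \<xi>)) has_real_derivative - (w \<bullet> (matpow (transpose B) (Suc j) *v flow s \<xi>))) (at s)"
          by (simp add: has_real_derivative_iff_has_vector_derivative matrix_vector_mul_assoc matpow_commute
             bounded_bilinear.minus_right[OF bounded_bilinear_matrix_vector_mult] del: transpose_matrix_vector)
        from DERIV_cmult[OF this, of "(- 1) ^ j"] show ?thesis by (simp add: F_def[abs_def])
      qed
      define \<alpha> where "\<alpha> j = F j 0 / fact j" for j
      define p where "p s = (\<Sum>i\<le>M. \<alpha> i * s ^ i)" for s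
      have rem: "\<bar>F 0 s - p s\<bar> \<le> norm w * (L * norm \<xi>) * t ^ (M + 1)" if s: "s \<in> {0..t}" for s
      proof (cases "s = 0")
        case True
        have "p 0 = F 0 0" by (simp add: p_def \<alpha>_def power_0_left if_distrib cong: if_cong)
        then show ?thesis using True L(1) t by simp
      next
        case False
        then have "0 < s" using s by simp
        from Maclaurin[OF this, of "Suc M" F "F 0"] dF obtain r where r: "0 < r" "r < s"
          and e: "F 0 s = (\<Sum>m<Suc M. F m 0 / fact m * s ^ m) + F (Suc M) r / fact (Suc M) * s ^ Suc M" by blast
        have "F 0 s - p s = F (Suc M) r / fact (Suc M) * s ^ Suc M"
          unfolding e p_def \<alpha>_def by (simp add: lessThan_Suc_atMost del: fact_Suc power_Suc)
        also have "\<bar>\<dots>\<bar> = \<bar>F (Suc M) r\<bar> / fact (Suc M) * s ^ Suc M" using \<open>0 < s\<close> by (simp add: abs_mult power_abs)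
        also have "\<dots> \<le> (norm w * (L * norm \<xi>)) * t ^ Suc M"
        proof (intro mult_mono)
          have "\<bar>F (Suc M) r\<bar> \<le> norm w * norm (matpow (transpose B) (Suc M) *v flow r \<xi>)"
            unfolding F_def using Cauchy_Schwarz_ineq2 by (simp add: abs_mult power_abs)
          also have "\<dots> \<le> norm w * (L * norm \<xi>)" using r s t by (intro mult_left_mono L(2)) auto
          finally have b: "\<bar>F (Suc M) r\<bar> \<le> norm w * (L * norm \<xi>)" .
          have "\<bar>F (Suc M) r\<bar> / fact (Suc M) \<le> \<bar>F (Suc M) r\<bar> / 1"
            by (intro divide_left_mono) (simp_all add: fact_ge_1 del: fact_Suc)
          then show "\<bar>F (Suc M) r\<bar> / fact (Suc M) \<le> norm w * (L * norm \<xi>)" using b by simp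
          show "s ^ Suc M \<le> t ^ Suc M" using s by (intro power_mono) auto
          show "0 \<le> norm w * (L * norm \<xi>)" using L(1) by simp
          show "0 \<le> s ^ Suc M" using \<open>0 < s\<close> by (intro zero_le_power) simp
        qed
        finally show ?thesis by simp
      qed
      have CS: "(F 0 s)\<^sup>2 \<le> d * qform D (flow s \<xi>)" for s
      proof -
        have "(flow s \<xi> \<bullet> (D *v ?\<eta>))\<^sup>2 / (?\<eta> \<bullet> (D *v ?\<eta>)) \<le> flow s \<xi> \<bullet> (D *v flow s \<xi>)"
          by (rule psd_matrix_cauchy_schwarz[OF D]) (use d in \<open>simp add: d_def qform_def\<close>)
        then show ?thesis using d by (simp add: F_def w_def d_def qform_def inner_commute field_simps)
      qed
      define R where "R = 2 * (norm w * (L * norm \<xi>) * t ^ (M + 1))\<^sup>2"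
      have int: "integral {0..t} (\<lambda>s. (p s)\<^sup>2) \<le> d * h + t * R"
      proof -
        have "((\<lambda>s. R) has_integral t * R) {0..t}" using has_integral_const_real[of R 0 t] t by simp
        then have "((\<lambda>s. d * (2 * qform D (flow s \<xi>)) + R) has_integral (d * h + t * R)) {0..t}"
          unfolding h_def using t by (intro has_integral_add has_integral_mult_right qform_flow_integral) auto
        moreover have "((\<lambda>s. (p s)\<^sup>2) has_integral integral {0..t} (\<lambda>s. (p s)\<^sup>2)) {0..t}"
          unfolding p_def by (intro integrable_integral integrable_continuous_real continuous_intros)
        moreover have "(p s)\<^sup>2 \<le> d * (2 * qform D (flow s \<xi>)) + R" if s: "s \<in> {0..t}" for s
        proof -
          have "(F 0 s - p s)\<^sup>2 \<le> (norm w * (L * norm \<xi>) * t ^ (M + 1))\<^sup>2"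
            using rem[OF s] by (metis abs_ge_zero power2_abs power_mono)
          moreover have "(p s)\<^sup>2 \<le> 2 * (F 0 s)\<^sup>2 + 2 * (F 0 s - p s)\<^sup>2"
          proof -
            have "0 \<le> (2 * F 0 s - p s)\<^sup>2" by simp
            then show ?thesis by (simp add: power2_eq_square algebra_simps)
          qed
          ultimately show ?thesis using CS[of s] by (simp add: R_def)
        qed
        ultimately show ?thesis by (auto dest: has_integral_le)
      qed
      \<comment> \<open>The k-th Taylor coefficient pairs w = D \<eta> with (B^T)^k \<xi>, which is
        \<eta> itself, so up to sign and factorial it is \<open>d\<close>.\<close>
      have "\<alpha> k = (- 1) ^ k * d / fact k"
        by (simp add: \<alpha>_def F_def flow_0 w_def d_def qform_def inner_commute)
      moreover have "((- 1) ^ k)\<^sup>2 = (1 :: real)" by (simp add: power2_eq_square power_mult_distrib[symmetric])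
      ultimately have \<alpha>k: "(\<alpha> k)\<^sup>2 = d\<^sup>2 / (fact k)\<^sup>2" by (simp add: power_mult_distrib power_divide)
      have "t ^ (2 * M + 1) * d\<^sup>2 \<le> (fact M)\<^sup>2 * (t ^ (2 * k + 1) * (\<alpha> k)\<^sup>2)"
      proof -
        have f: "(fact k :: real)\<^sup>2 \<le> (fact M)\<^sup>2" using k by (intro power_mono fact_mono) auto
        \<comment> \<open>For t \<le> 1 the exponent belonging to k = M is the worst; this makes the
          bound uniform in k.\<close>
        have "t ^ (2 * M + 1) * d\<^sup>2 \<le> t ^ (2 * k + 1) * d\<^sup>2"
          using t k by (intro mult_right_mono power_decreasing) auto
        also have "d\<^sup>2 \<le> (fact M)\<^sup>2 * (\<alpha> k)\<^sup>2"
        proof -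
          have "d\<^sup>2 = (fact k)\<^sup>2 * (\<alpha> k)\<^sup>2" unfolding \<alpha>k by simp
          also have "\<dots> \<le> (fact M)\<^sup>2 * (\<alpha> k)\<^sup>2" using f by (rule mult_right_mono) simp
          finally show ?thesis .
        qed
        finally show ?thesis using t by (simp add: mult_left_mono mult.left_commute)
      qed
      also have "\<dots> \<le> (fact M)\<^sup>2 * (C * integral {0..t} (\<lambda>s. (p s)\<^sup>2))"
        using poly[rule_format, OF t(1) k, of \<alpha>] by (intro mult_left_mono) (auto simp: p_def)
      also have "\<dots> \<le> (fact M)\<^sup>2 * (C * (d * h + t * R))"
        using int C by (intro mult_left_mono) auto
      also have "\<dots> = C1 * (d * h + t * R)" by (simp add: C1_def)
      \<comment> \<open>The remainder carries |D \<eta>|^2, which is at most K d; so every term has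
        a factor \<open>d\<close>, and this factor is divided out at the end.\<close>
      also have "\<dots> \<le> C1 * (d * h + t * (2 * (K * d) * (L\<^sup>2 * (norm \<xi>)\<^sup>2) * t ^ (2 * M + 2)))"
      proof -
        have "(M + 1) * 2 = 2 * M + 2" by simp
        then have "(t ^ (M + 1))\<^sup>2 = t ^ (2 * M + 2)" unfolding power_mult[symmetric] by metis
        then have "R = 2 * (norm w)\<^sup>2 * (L\<^sup>2 * (norm \<xi>)\<^sup>2) * t ^ (2 * M + 2)"
          unfolding R_def power_mult_distrib by (simp only: mult.assoc)
        also have "\<dots> \<le> 2 * (K * d) * (L\<^sup>2 * (norm \<xi>)\<^sup>2) * t ^ (2 * M + 2)"
          using K(2)[of ?\<eta>] t unfolding w_def d_def by (intro mult_right_mono mult_left_mono) auto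
        finally have "t * R \<le> t * (2 * (K * d) * (L\<^sup>2 * (norm \<xi>)\<^sup>2) * t ^ (2 * M + 2))"
          by (rule mult_left_mono) (use t in simp)
        then show ?thesis using C12(1) by simp
      qed
      also have "\<dots> = d * (C1 * h + C2 * t ^ (2 * M + 3) * (norm \<xi>)\<^sup>2)"
      proof -
        have "Suc (2 * M + 2) = 2 * M + 3" by simp
        then have "t ^ (2 * M + 3) = t * t ^ (2 * M + 2)" using power_Suc[of t "2 * M + 2"] by metis
        then show ?thesis unfolding C2_def distrib_left by (simp only: mult_ac)
      qed
      finally have "d * (t ^ (2 * M + 1) * d) \<le> d * (C1 * h + C2 * t ^ (2 * M + 3) * (norm \<xi>)\<^sup>2)"
        by (simp add: power2_eq_square mult_ac)
      then show ?thesis using d by (simp add: d_def[symmetric] h_def[symmetric])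
    qed
  qed
  then show ?thesis using C12 by blast
qed

text \<open>When the directional bounds are summed over k, positive definiteness turns the left side
  into a multiple of t^(2 M + 1) |\<xi>|^2. The error is smaller by t^2 and is absorbed for t \<le>
  t0; monotonicity along the flow extends the bound to t \<le> 1 at the cost of a factor t0^(2 M +
  1).\<close>

lemma flow_gain:
  assumes pd: "pd_matrix (\<Sum>k\<le>M. matpow B k ** D ** matpow (transpose B) k)"
  shows "\<exists>c>0. \<forall>t\<in>{0..1}. \<forall>\<xi>. c * t ^ (2 * M + 1) * (norm \<xi>)\<^sup>2 \<le> qform Q \<xi> - qform Q (flow t \<xi>)"
proof -
  obtain c1 where c1: "c1 > 0" "\<And>\<xi>. c1 * (norm \<xi>)\<^sup>2 \<le> qform (\<Sum>k\<le>M. matpow B k ** D ** matpow (transpose B) k) \<xi>"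
    using pd_matrix_lower_bound[OF pd] by blast
  obtain C1 C2 where C: "C1 > 0" "C2 > 0" and dir: "\<And>t \<xi> k. 0 < t \<Longrightarrow> t \<le> 1 \<Longrightarrow> k \<le> M \<Longrightarrow>
     t ^ (2 * M + 1) * qform D (matpow (transpose B) k *v \<xi>)
       \<le> C1 * (qform Q \<xi> - qform Q (flow t \<xi>)) + C2 * t ^ (2 * M + 3) * (norm \<xi>)\<^sup>2"
    using flow_gain_direction[of M] by blast
  define n where "n = real (Suc M)"
  have n: "n > 0" by (simp add: n_def)
  \<comment> \<open>Chosen so that n * C2 * t0^2 \<le> c1 / 2: the error takes at most half of the
    main term.\<close>
  define t0 where "t0 = min 1 (sqrt (c1 / (2 * n * C2)))"
  have q: "c1 / (2 * n * C2) > 0" using c1 n C by simp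
  have t0: "0 < t0" "t0 \<le> 1" using q by (auto simp: t0_def)
  have t0sq: "t0\<^sup>2 \<le> c1 / (2 * n * C2)"
  proof -
    have "t0\<^sup>2 \<le> (sqrt (c1 / (2 * n * C2)))\<^sup>2" using t0 by (intro power_mono) (auto simp: t0_def)
    then show ?thesis using q by simp
  qed
  define c2 where "c2 = c1 / (2 * n * C1)"
  have c2: "c2 > 0" using c1 n C by (simp add: c2_def)
  have small: "c2 * t ^ (2 * M + 1) * (norm \<xi>)\<^sup>2 \<le> qform Q \<xi> - qform Q (flow t \<xi>)" if t: "0 < t" "t \<le> t0" for t \<xi>
  proof -
    let ?h = "qform Q \<xi> - qform Q (flow t \<xi>)"
    have "t ^ (2 * M + 1) * (c1 * (norm \<xi>)\<^sup>2) \<le> t ^ (2 * M + 1) * (\<Sum>k\<le>M. qform D (matpow (transpose B) k *v \<xi>))"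
      using c1(2)[of \<xi>] t unfolding qform_sum qform_bracket by (intro mult_left_mono) auto
    also have "\<dots> = (\<Sum>k\<le>M. t ^ (2 * M + 1) * qform D (matpow (transpose B) k *v \<xi>))" by (rule sum_distrib_left)
    also have "\<dots> \<le> (\<Sum>k\<le>M. C1 * ?h + C2 * t ^ (2 * M + 3) * (norm \<xi>)\<^sup>2)"
      using t t0 by (intro sum_mono dir) auto
    also have "\<dots> = n * C1 * ?h + n * C2 * t\<^sup>2 * (t ^ (2 * M + 1) * (norm \<xi>)\<^sup>2)"
    proof -
      have "t ^ (2 + (2 * M + 1)) = t\<^sup>2 * t ^ (2 * M + 1)" by (rule power_add)
      moreover have "2 + (2 * M + 1) = 2 * M + 3" by simp
      ultimately have "t ^ (2 * M + 3) = t\<^sup>2 * t ^ (2 * M + 1)" by metis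
      then show ?thesis by (simp add: n_def algebra_simps)
    qed
    also have "n * C2 * t\<^sup>2 * (t ^ (2 * M + 1) * (norm \<xi>)\<^sup>2) \<le> c1 / 2 * (t ^ (2 * M + 1) * (norm \<xi>)\<^sup>2)"
    proof (rule mult_right_mono)
      have "t\<^sup>2 \<le> c1 / (2 * n * C2)" using t by (intro order_trans[OF power_mono t0sq]) auto
      then show "n * C2 * t\<^sup>2 \<le> c1 / 2" using n C by (simp add: field_simps)
    qed (use t in simp)
    finally have "c1 / 2 * (t ^ (2 * M + 1) * (norm \<xi>)\<^sup>2) \<le> n * C1 * ?h" by (simp add: algebra_simps)
    then show ?thesis using n C by (simp add: c2_def field_simps)
  qed
  have "c2 * t0 ^ (2 * M + 1) * t ^ (2 * M + 1) * (norm \<xi>)\<^sup>2 \<le> qform Q \<xi> - qform Q (flow t \<xi>)" if t: "t \<in> {0..1}" for t \<xi>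
  proof (cases "t = 0")
    case True
    then show ?thesis by (simp add: flow_0)
  next
    case False
    show ?thesis
    proof (cases "t \<le> t0")
      case True
      have "c2 * t0 ^ (2 * M + 1) * t ^ (2 * M + 1) * (norm \<xi>)\<^sup>2 \<le> c2 * 1 * t ^ (2 * M + 1) * (norm \<xi>)\<^sup>2"
        using c2 t0 t by (intro mult_right_mono mult_left_mono power_le_one) auto
      also have "\<dots> \<le> qform Q \<xi> - qform Q (flow t \<xi>)" using small[of t \<xi>] True False t by simp
      finally show ?thesis .
    next
      case False
      have "c2 * t0 ^ (2 * M + 1) * t ^ (2 * M + 1) * (norm \<xi>)\<^sup>2 \<le> c2 * t0 ^ (2 * M + 1) * 1 * (norm \<xi>)\<^sup>2"
        using c2 t0 t by (intro mult_right_mono mult_left_mono power_le_one) auto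
      also have "\<dots> \<le> qform Q \<xi> - qform Q (flow t0 \<xi>)" using small[of t0 \<xi>] t0 by simp
      also have "\<dots> \<le> qform Q \<xi> - qform Q (flow t \<xi>)" using qform_flow_antimono[of t0 t \<xi>] False by simp
      finally show ?thesis .
    qed
  qed
  moreover have "c2 * t0 ^ (2 * M + 1) > 0" using c2 t0 by simp
  ultimately show ?thesis by blast
qed

text \<open>The gain at t = 1 is at most \<open>qform Q \<xi>\<close>, as \<open>Q\<close> is
  non-negative at \<open>flow 1 \<xi>\<close>; so the invariant law is non-degenerate.\<close>

lemma qform_Q_lower_bound:
  assumes pd: "pd_matrix (\<Sum>k\<le>M. matpow B k ** D ** matpow (transpose B) k)"
  shows "\<exists>c>0. \<forall>\<xi>. c * (norm \<xi>)\<^sup>2 \<le> qform Q \<xi>"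
proof -
  obtain c where c: "c > 0" "\<forall>t\<in>{0..1}. \<forall>\<xi>. c * t ^ (2 * M + 1) * (norm \<xi>)\<^sup>2 \<le> qform Q \<xi> - qform Q (flow t \<xi>)"
    using flow_gain[OF pd] by blast
  have "c * (norm \<xi>)\<^sup>2 \<le> qform Q \<xi>" for \<xi>
    using c(2)[rule_format, of 1 \<xi>] qform_Q_nonneg[of "flow 1 \<xi>"] by simp
  then show ?thesis using c(1) by blast
qed

text \<open>For t \<le> 1 the gain and 1 - x \<le> exp (- x) give the exponent g t^(2 M + 1); for
  longer times the bound at t = 1 is iterated. One expression covers both because 1 - exp (- t) is
  at most 1 and at most t.\<close>

lemma flow_contraction_hypoelliptic:
  assumes pd: "pd_matrix (\<Sum>k\<le>M. matpow B k ** D ** matpow (transpose B) k)"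
  shows "\<exists>\<kappa>>0. \<forall>t\<ge>0. \<forall>\<xi>. qform Q (flow t \<xi>) \<le> exp (- \<kappa> * t * (1 - exp (- t)) ^ (2 * M)) * qform Q \<xi>"
proof -
  obtain c where c: "c > 0" "\<forall>t\<in>{0..1}. \<forall>\<xi>. c * t ^ (2 * M + 1) * (norm \<xi>)\<^sup>2 \<le> qform Q \<xi> - qform Q (flow t \<xi>)"
    using flow_gain[OF pd] by blast
  obtain K where K: "K > 0" "\<And>\<xi>. qform Q \<xi> \<le> K * (norm \<xi>)\<^sup>2" using qform_bound[of Q] by blast
  define g where "g = c / K"
  have g: "g > 0" using c K by (simp add: g_def)
  have short: "qform Q (flow t \<xi>) \<le> exp (- (g * t ^ (2 * M + 1))) * qform Q \<xi>" if t: "t \<in> {0..1}" for t \<xi>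
  proof -
    have "g * t ^ (2 * M + 1) * qform Q \<xi> \<le> g * t ^ (2 * M + 1) * (K * (norm \<xi>)\<^sup>2)"
      using g t K(2) by (intro mult_left_mono) auto
    also have "\<dots> = c * t ^ (2 * M + 1) * (norm \<xi>)\<^sup>2" using K(1) by (simp add: g_def)
    also have "\<dots> \<le> qform Q \<xi> - qform Q (flow t \<xi>)" using c(2) t by blast
    finally have "qform Q (flow t \<xi>) \<le> (1 + - (g * t ^ (2 * M + 1))) * qform Q \<xi>" by (simp add: algebra_simps)
    also have "\<dots> \<le> exp (- (g * t ^ (2 * M + 1))) * qform Q \<xi>"
      by (intro mult_right_mono exp_ge_add_one_self qform_Q_nonneg)
    finally show ?thesis .
  qed
  have long: "qform Q (flow (real n) \<xi>) \<le> exp (- (g * real n)) * qform Q \<xi>" for n \<xi>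
  proof (induction n)
    case 0
    then show ?case by (simp add: flow_0)
  next
    case (Suc n)
    have "qform Q (flow (real (Suc n)) \<xi>) = qform Q (flow 1 (flow (real n) \<xi>))"
      using flow_add[of "real n" 1 \<xi>] by (simp add: add.commute)
    also have "\<dots> \<le> exp (- g) * qform Q (flow (real n) \<xi>)" using short[of 1] by simp
    also have "\<dots> \<le> exp (- g) * (exp (- (g * real n)) * qform Q \<xi>)" using Suc by (intro mult_left_mono) auto
    also have "\<dots> = exp (- (g * real (Suc n))) * qform Q \<xi>"
      by (simp add: mult.assoc[symmetric] exp_add[symmetric] algebra_simps)
    finally show ?case .
  qed
  \<comment> \<open>Halving g pays for replacing t by its integer part, which is at least t / 2 when
    t \<ge> 1.\<close>
  have "qform Q (flow t \<xi>) \<le> exp (- (g / 2) * t * (1 - exp (- t)) ^ (2 * M)) * qform Q \<xi>" if t: "t \<ge> 0" for t \<xi>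
  proof -
    have e: "0 \<le> 1 - exp (- t)" "1 - exp (- t) \<le> 1" "1 - exp (- t) \<le> t"
      using t exp_ge_add_one_self[of "- t"] by auto
    have "\<exists>r. qform Q (flow t \<xi>) \<le> exp (- r) * qform Q \<xi> \<and> (g / 2) * t * (1 - exp (- t)) ^ (2 * M) \<le> r"
    proof (cases "t \<le> 1")
      case True
      have "(g / 2) * t * (1 - exp (- t)) ^ (2 * M) \<le> g * t * t ^ (2 * M)"
        using g t e by (intro mult_mono power_mono) auto
      then show ?thesis using short[of t \<xi>] True t by (intro exI[of _ "g * t ^ (2 * M + 1)"]) (simp add: mult.assoc)
    next
      case False
      define n where "n = nat \<lfloor>t\<rfloor>"
      have "1 \<le> \<lfloor>t\<rfloor>" using False by linarith
      then have "real n = of_int \<lfloor>t\<rfloor>" "1 \<le> real_of_int \<lfloor>t\<rfloor>" by (simp_all add: n_def)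
      then have n: "real n \<le> t" "t / 2 \<le> real n" by linarith+
      have "qform Q (flow t \<xi>) \<le> exp (- (g * real n)) * qform Q \<xi>"
        using qform_flow_antimono[OF n(1)] long[of n \<xi>] by (rule order_trans)
      moreover have "(g / 2) * t * (1 - exp (- t)) ^ (2 * M) \<le> (g / 2) * t * 1"
        using g t e by (intro mult_left_mono power_le_one) auto
      moreover have "(g / 2) * t \<le> g * real n" using g n(2) mult_left_mono[of "t / 2" "real n" g] by simp
      ultimately show ?thesis by (intro exI[of _ "g * real n"]) auto
    qed
    then obtain r where r: "qform Q (flow t \<xi>) \<le> exp (- r) * qform Q \<xi>" "(g / 2) * t * (1 - exp (- t)) ^ (2 * M) \<le> r" by blast
    have "exp (- r) * qform Q \<xi> \<le> exp (- (g / 2) * t * (1 - exp (- t)) ^ (2 * M)) * qform Q \<xi>"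
      using r(2) by (intro mult_right_mono qform_Q_nonneg) simp
    then show ?thesis using r(1) by linarith
  qed
  then show ?thesis using g by (intro exI[of _ "g / 2"]) auto
qed

text \<open>\<open>Q\<close> is comparable with the squared Euclidean norm from both sides, so the
  square of the entrywise bound on exp (- t B) passes to the form of \<open>Q\<close>.\<close>

lemma flow_contraction_spectral:
  assumes pd: "pd_matrix (\<Sum>k\<le>M. matpow B k ** D ** matpow (transpose B) k)"
    and C: "C \<ge> 0" "\<And>t i j. t \<ge> 0 \<Longrightarrow> \<bar>mexp B (- t) $ i $ j\<bar> \<le> C * ((1 + t ^ (N - 1)) * exp (- \<rho> * t))"
  shows "\<exists>c\<ge>1. \<forall>t\<ge>0. \<forall>\<xi>. qform Q (flow t \<xi>) \<le> c * (1 + t ^ (2 * (N - 1))) * exp (- 2 * \<rho> * t) * qform Q \<xi>"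
proof -
  obtain K where K: "K > 0" "\<And>\<xi>. qform Q \<xi> \<le> K * (norm \<xi>)\<^sup>2" using qform_bound[of Q] by blast
  obtain l where l: "l > 0" "\<And>\<xi>. l * (norm \<xi>)\<^sup>2 \<le> qform Q \<xi>" using qform_Q_lower_bound[OF pd] by blast
  obtain L where L: "L > 0" "\<And>X y. norm ((X::real^'n^'n) *v y) \<le> norm X * norm y * L"
    using bounded_bilinear.pos_bounded[OF bounded_bilinear_matrix_vector_mult] by blast
  define m where "m = real CARD('n) * (real CARD('n) * C)"
  have m: "m \<ge> 0" using C(1) by (simp add: m_def)
  define c where "c = 2 * (m * L)\<^sup>2 * K / l"
  have c: "c \<ge> 0" using K l by (simp add: c_def)
  have "qform Q (flow t \<xi>) \<le> c * (1 + t ^ (2 * (N - 1))) * exp (- 2 * \<rho> * t) * qform Q \<xi>" if t: "t \<ge> 0" for t \<xi>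
  proof -
    define u where "u = (1 + t ^ (N - 1)) * exp (- \<rho> * t)"
    have u: "u \<ge> 0" using t by (simp add: u_def)
    let ?E = "transpose (mexp B (- t))"
    have "norm ?E \<le> (\<Sum>i\<in>UNIV. norm (?E $ i))" by (simp add: norm_vec_def L2_set_le_sum)
    also have "\<dots> \<le> (\<Sum>i\<in>(UNIV::'n set). \<Sum>j\<in>(UNIV::'n set). C * u)"
    proof (rule sum_mono)
      fix i
      have "norm (?E $ i) \<le> (\<Sum>j\<in>UNIV. \<bar>?E $ i $ j\<bar>)" by (rule norm_le_l1_cart)
      also have "\<dots> \<le> (\<Sum>j\<in>(UNIV::'n set). C * u)"
        using C(2)[OF t] by (intro sum_mono) (simp add: transpose_def u_def)
      finally show "norm (?E $ i) \<le> (\<Sum>j\<in>(UNIV::'n set). C * u)" .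
    qed
    also have "\<dots> = m * u" by (simp add: m_def)
    finally have E: "norm ?E \<le> m * u" .
    have "norm (flow t \<xi>) \<le> norm ?E * norm \<xi> * L" unfolding flow_def by (rule L(2))
    also have "\<dots> \<le> m * u * norm \<xi> * L" using E L(1) by (intro mult_right_mono) auto
    finally have f: "norm (flow t \<xi>) \<le> m * u * norm \<xi> * L" .
    have "qform Q (flow t \<xi>) \<le> K * (norm (flow t \<xi>))\<^sup>2" by (rule K(2))
    also have "\<dots> \<le> K * (m * u * norm \<xi> * L)\<^sup>2" using f K(1) by (intro mult_left_mono power_mono) auto
    also have "\<dots> = (m * L)\<^sup>2 * K * u\<^sup>2 * (norm \<xi>)\<^sup>2" by (simp add: power_mult_distrib mult_ac)
    also have "\<dots> \<le> (m * L)\<^sup>2 * K * u\<^sup>2 * (qform Q \<xi> / l)"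
      using l K(1) by (intro mult_left_mono) (auto simp: field_simps)
    also have "\<dots> \<le> (m * L)\<^sup>2 * K * (2 * (1 + t ^ (2 * (N - 1))) * exp (- 2 * \<rho> * t)) * (qform Q \<xi> / l)"
    proof (intro mult_right_mono mult_left_mono)
      have "(1 + t ^ (N - 1))\<^sup>2 \<le> 2 * (1 + t ^ (2 * (N - 1)))"
      proof -
        have "0 \<le> (1 - t ^ (N - 1))\<^sup>2" by simp
        moreover have "t ^ (2 * (N - 1)) = (t ^ (N - 1))\<^sup>2" by (simp add: power_mult[symmetric] mult.commute)
        ultimately show ?thesis by (simp add: power2_eq_square algebra_simps)
      qed
      moreover have "(exp (- \<rho> * t))\<^sup>2 = exp (- 2 * \<rho> * t)" by (simp add: power2_eq_square exp_add[symmetric])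
      ultimately show "u\<^sup>2 \<le> 2 * (1 + t ^ (2 * (N - 1))) * exp (- 2 * \<rho> * t)"
        by (simp add: u_def power_mult_distrib)
    qed (use K l qform_Q_nonneg in auto)
    also have "\<dots> = c * (1 + t ^ (2 * (N - 1))) * exp (- 2 * \<rho> * t) * qform Q \<xi>" by (simp add: c_def)
    finally show ?thesis .
  qed
  \<comment> \<open>Passing to c + 1 secures a constant of at least 1, since the contraction factor
    has to be positive later on.\<close>
  moreover have "c * (1 + t ^ (2 * (N - 1))) * exp (- 2 * \<rho> * t) * qform Q \<xi> \<le> (c + 1) * (1 + t ^ (2 * (N - 1))) * exp (- 2 * \<rho> * t) * qform Q \<xi>"
    if "t \<ge> 0" for t \<xi>
    using that qform_Q_nonneg by (intro mult_right_mono) auto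
  ultimately have "qform Q (flow t \<xi>) \<le> (c + 1) * (1 + t ^ (2 * (N - 1))) * exp (- 2 * \<rho> * t) * qform Q \<xi>"
    if "t \<ge> 0" for t \<xi> using that order_trans by blast
  then show ?thesis using c by (intro exI[of _ "c + 1"]) auto
qed

end

section \<open>Differentiating along a Feller semigroup\<close>

definition bdd_measurable :: "('a::euclidean_space \<Rightarrow> real) \<Rightarrow> bool" where
  "bdd_measurable u \<longleftrightarrow> u \<in> borel_measurable borel \<and> (\<exists>C. \<forall>y. \<bar>u y\<bar> \<le> C)"

lemma bdd_measurableI: "u \<in> borel_measurable borel \<Longrightarrow> (\<And>y. \<bar>u y\<bar> \<le> C) \<Longrightarrow> bdd_measurable u"
  by (auto simp: bdd_measurable_def)

lemma bdd_measurable_add: "bdd_measurable u \<Longrightarrow> bdd_measurable v \<Longrightarrow> bdd_measurable (\<lambda>y. u y + v y)"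
proof -
  assume "bdd_measurable u" "bdd_measurable v"
  then obtain C C' where m: "u \<in> borel_measurable borel" "v \<in> borel_measurable borel" and "\<And>y. \<bar>u y\<bar> \<le> C" "\<And>y. \<bar>v y\<bar> \<le> C'"
    by (auto simp: bdd_measurable_def)
  then have "\<bar>u y + v y\<bar> \<le> C + C'" for y by (meson abs_triangle_ineq add_mono order_trans)
  then show ?thesis by (intro bdd_measurableI borel_measurable_add m)
qed

lemma bdd_measurable_cmult: "bdd_measurable u \<Longrightarrow> bdd_measurable (\<lambda>y. c * u y)"
proof -
  assume "bdd_measurable u"
  then obtain C where m: "u \<in> borel_measurable borel" and "\<And>y. \<bar>u y\<bar> \<le> C" by (auto simp: bdd_measurable_def)
  then have "\<bar>c * u y\<bar> \<le> \<bar>c\<bar> * C" for y by (simp add: abs_mult mult_left_mono)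
  then show ?thesis using m by (intro bdd_measurableI borel_measurable_times) auto
qed

lemma bdd_measurable_diff: "bdd_measurable u \<Longrightarrow> bdd_measurable v \<Longrightarrow> bdd_measurable (\<lambda>y. u y - v y)"
  using bdd_measurable_add[of u "\<lambda>y. - 1 * v y"] bdd_measurable_cmult[of v "- 1"] by simp

lemma bdd_measurable_divide: "bdd_measurable u \<Longrightarrow> bdd_measurable (\<lambda>y. u y / c)"
  using bdd_measurable_cmult[of u "1 / c"] by simp

lemma integrable_bdd_measurable:
  assumes "borel_prob M" "bdd_measurable u"
  shows "integrable M u"
proof -
  interpret prob_space M using assms by simp
  obtain C where m: "u \<in> borel_measurable borel" and C: "\<And>y. \<bar>u y\<bar> \<le> C" using assms(2) by (auto simp: bdd_measurable_def)
  show ?thesis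
    by (rule integrable_const_bound[where B = C]) (use m C assms(1) in \<open>auto cong: measurable_cong_sets\<close>)
qed

lemma kernel_borel_prob:
  assumes "k \<in> borel \<rightarrow>\<^sub>M prob_algebra borel"
  shows "borel_prob (k x)"
  using measurable_space[OF assms, of x] by (auto simp: space_prob_algebra)

lemma kernel_integral_bdd_measurable:
  assumes k: "k \<in> borel \<rightarrow>\<^sub>M prob_algebra borel" and u: "bdd_measurable u"
  shows "bdd_measurable (\<lambda>x. \<integral>y. u y \<partial>k x)"
proof -
  obtain C where m: "u \<in> borel_measurable borel" and C: "\<And>y. \<bar>u y\<bar> \<le> C" using u by (auto simp: bdd_measurable_def)
  show ?thesis
  proof (rule bdd_measurableI)
    show "(\<lambda>x. \<integral>y. u y \<partial>k x) \<in> borel_measurable borel"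
      using integral_measurable_subprob_algebra[OF m] by (rule measurable_compose[OF measurable_prob_algebraD[OF k]])
    fix x
    interpret prob_space "k x" using kernel_borel_prob[OF k] by simp
    have i: "integrable (k x) u" by (rule integrable_bdd_measurable[OF kernel_borel_prob[OF k] u])
    have "u y \<le> C" "- C \<le> u y" for y using C[of y] by auto
    then show "\<bar>\<integral>y. u y \<partial>k x\<bar> \<le> C"
      using integral_le_const[OF i, of C] integral_ge_const[OF i, of "- C"] by auto
  qed
qed

lemma integral_bind_bdd_measurable:
  assumes \<mu>: "borel_prob \<mu>" and k: "k \<in> borel \<rightarrow>\<^sub>M prob_algebra borel" and u: "bdd_measurable u"
  shows "(\<integral>y. u y \<partial>(\<mu> \<bind> k)) = (\<integral>x. \<integral>y. u y \<partial>k x \<partial>\<mu>)"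
proof -
  interpret prob_space \<mu> using \<mu> by simp
  obtain C where m: "u \<in> borel_measurable borel" and C: "\<And>y. \<bar>u y\<bar> \<le> C" using u by (auto simp: bdd_measurable_def)
  have [simp]: "borel_measurable \<mu> = borel_measurable borel" by (rule measurable_cong_sets) (use \<mu> in auto)
  have k\<mu>: "k \<in> \<mu> \<rightarrow>\<^sub>M prob_algebra borel" using k \<mu> by (simp cong: measurable_cong_sets)
  have bp: "borel_prob (\<mu> \<bind> k)"
    using prob_space_bind'[OF _ k\<mu>] \<mu> sets_bind'[OF _ k\<mu>] prob_space_axioms by (auto simp: space_prob_algebra)
  \<comment> \<open>Shifting by the bound makes the integrand non-negative, where the formula for
    integrals over a composed kernel applies.\<close>
  let ?v = "\<lambda>y. u y + C"
  have v: "bdd_measurable ?v" by (rule bdd_measurableI[of _ "2 * C"]) (use m C in \<open>auto simp: abs_le_iff, (smt (verit) C)+\<close>)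
  have v0: "0 \<le> ?v y" for y using C[of y] by auto
  have "ennreal (\<integral>y. ?v y \<partial>(\<mu> \<bind> k)) = (\<integral>\<^sup>+y. ?v y \<partial>(\<mu> \<bind> k))"
    by (rule nn_integral_eq_integral[symmetric]) (use integrable_bdd_measurable[OF bp v] v0 in auto)
  also have "\<dots> = (\<integral>\<^sup>+x. \<integral>\<^sup>+y. ?v y \<partial>k x \<partial>\<mu>)"
    by (rule nn_integral_bind[of _ borel]) (use m measurable_prob_algebraD[OF k\<mu>] in auto)
  also have "\<dots> = (\<integral>\<^sup>+x. ennreal (\<integral>y. ?v y \<partial>k x) \<partial>\<mu>)"
    by (intro nn_integral_cong nn_integral_eq_integral) (use integrable_bdd_measurable[OF kernel_borel_prob[OF k] v] v0 in auto)
  also have "\<dots> = ennreal (\<integral>x. \<integral>y. ?v y \<partial>k x \<partial>\<mu>)"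
    by (rule nn_integral_eq_integral)
      (use integrable_bdd_measurable[OF \<mu> kernel_integral_bdd_measurable[OF k v]] v0 in \<open>auto intro: integral_nonneg_AE\<close>)
  finally have e: "(\<integral>y. ?v y \<partial>(\<mu> \<bind> k)) = (\<integral>x. \<integral>y. ?v y \<partial>k x \<partial>\<mu>)"
    using v0 by (simp add: integral_nonneg_AE)
  interpret b: prob_space "\<mu> \<bind> k" using bp by simp
  have "(\<integral>y. ?v y \<partial>k x) = (\<integral>y. u y \<partial>k x) + C" for x
  proof -
    interpret kx: prob_space "k x" using kernel_borel_prob[OF k] by simp
    show ?thesis using integrable_bdd_measurable[OF kernel_borel_prob[OF k] u] by (simp add: kx.prob_space)
  qed
  then show ?thesis
    using e integrable_bdd_measurable[OF bp u] integrable_bdd_measurable[OF \<mu> kernel_integral_bdd_measurable[OF k u]]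
    by (simp add: b.prob_space prob_space)
qed

locale feller =
  fixes K :: "real \<Rightarrow> real^'n \<Rightarrow> (real^'n) measure"
  assumes feller: "feller_semigroup K"
begin

abbreviation "P \<equiv> semigroup_op K"

lemma kernel: "t \<ge> 0 \<Longrightarrow> K t \<in> borel \<rightarrow>\<^sub>M prob_algebra borel"
  using feller by (simp add: feller_semigroup_def markov_semigroup_def)

lemma kernel_prob: "t \<ge> 0 \<Longrightarrow> borel_prob (K t x)"
  using kernel_borel_prob[OF kernel] .

lemma op_bdd_measurable: "t \<ge> 0 \<Longrightarrow> bdd_measurable u \<Longrightarrow> bdd_measurable (P t u)"
  unfolding semigroup_op_def using kernel_integral_bdd_measurable[OF kernel] by blast

lemma op_add: "s \<ge> 0 \<Longrightarrow> t \<ge> 0 \<Longrightarrow> bdd_measurable u \<Longrightarrow> P (s + t) u x = P s (P t u) x"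
  unfolding semigroup_op_def using integral_bind_bdd_measurable[OF kernel_prob kernel, of s t u x] feller
  by (simp add: feller_semigroup_def markov_semigroup_def)

lemma op_0: "bdd_measurable u \<Longrightarrow> P 0 u x = u x"
  using feller unfolding semigroup_op_def feller_semigroup_def markov_semigroup_def bdd_measurable_def
  by (auto simp: integral_return)

lemma op_linear:
  assumes "t \<ge> 0" "bdd_measurable u" "bdd_measurable v"
  shows "P t (\<lambda>y. u y + v y) x = P t u x + P t v x" "P t (\<lambda>y. u y - v y) x = P t u x - P t v x"
  using integrable_bdd_measurable[OF kernel_prob[OF assms(1)]] assms(2,3) by (auto simp: semigroup_op_def)

lemma op_divide: "P t (\<lambda>y. u y / c) x = P t u x / c"
  by (simp add: semigroup_op_def)

lemma op_contraction:
  assumes t: "t \<ge> 0" and u: "bdd_measurable u" "bdd_measurable v" and le: "\<And>y. \<bar>u y - v y\<bar> \<le> e"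
  shows "\<bar>P t u x - P t v x\<bar> \<le> e"
proof -
  interpret prob_space "K t x" using kernel_prob[OF t] by simp
  have i: "integrable (K t x) (\<lambda>y. u y - v y)"
    by (rule integrable_bdd_measurable[OF kernel_prob[OF t] bdd_measurable_diff[OF u]])
  have "u y - v y \<le> e" "- e \<le> u y - v y" for y using le[of y] by auto
  then have "\<bar>P t (\<lambda>y. u y - v y) x\<bar> \<le> e"
    unfolding semigroup_op_def using integral_le_const[OF i, of e] integral_ge_const[OF i, of "- e"] by auto
  then show ?thesis using op_linear(2)[OF t u] by simp
qed

lemma op_strongly_continuous:
  assumes "u \<in> C0" "e > 0"
  shows "\<exists>\<delta>>0. \<forall>h. 0 < h \<and> h < \<delta> \<longrightarrow> (\<forall>y. \<bar>P h u y - u y\<bar> < e)"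
proof -
  have "uniform_limit UNIV (\<lambda>t. P t u) u (at_right 0)"
    using feller assms(1) by (simp add: feller_semigroup_def)
  then have "\<forall>\<^sub>F t in at_right 0. \<forall>y\<in>UNIV. dist (P t u y) (u y) < e"
    using assms(2) by (simp add: uniform_limit_iff)
  then show ?thesis by (auto simp: eventually_at_right_field dist_real_def)
qed

text \<open>Both one-sided difference quotients are written with \<open>P h (f s) - f s\<close> for the fixed function
  \<open>f s\<close>, since the generator limit is only known for one function at a time.\<close>

lemma op_time_derivative:
  assumes s: "0 \<le> s" and f: "\<And>r. bdd_measurable (f r)"
    and gen: "uniform_limit UNIV (\<lambda>t y. (P t (f s) y - f s y) / t) u0 (at_right 0)"
    and tim: "\<And>e. e > 0 \<Longrightarrow> \<exists>\<delta>>0. \<forall>h. h \<noteq> 0 \<and> \<bar>h\<bar> < \<delta> \<longrightarrow> (\<forall>y. \<bar>(f (s + h) y - f s y) / h - u1 y\<bar> \<le> e)"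
    and u: "u0 \<in> C0" "bdd_measurable u0" "u1 \<in> C0" "bdd_measurable u1"
  shows "((\<lambda>r. P r (f r) x) has_real_derivative P s (\<lambda>y. u0 y + u1 y) x) (at s within {0..})"
  unfolding has_field_derivative_iff
proof (rule tendstoI)
  fix e :: real assume e: "e > 0"
  let ?u = "\<lambda>y. u0 y + u1 y"
  have uC: "?u \<in> C0" using u(1,3) unfolding C0_def by (auto intro!: continuous_intros tendsto_add_zero)
  have ub: "bdd_measurable ?u" by (rule bdd_measurable_add) fact+
  have e4: "e / 4 > 0" using e by simp
  have "\<forall>\<^sub>F t in at_right 0. \<forall>y\<in>UNIV. dist ((P t (f s) y - f s y) / t) (u0 y) < e / 4"
    using gen e4 unfolding uniform_limit_iff by blast
  then obtain d1 where d1: "d1 > 0" "\<And>h y. 0 < h \<Longrightarrow> h < d1 \<Longrightarrow> \<bar>(P h (f s) y - f s y) / h - u0 y\<bar> < e / 4"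
    by (auto simp: eventually_at_right_field dist_real_def)
  obtain d2 where d2: "d2 > 0" "\<And>h y. h \<noteq> 0 \<Longrightarrow> \<bar>h\<bar> < d2 \<Longrightarrow> \<bar>(f (s + h) y - f s y) / h - u1 y\<bar> \<le> e / 4"
    using tim[OF e4] by blast
  \<comment> \<open>Strong continuity compares the limits at times r and s: the backward quotient
    uses it for the sum, the forward one for \<open>u1\<close>.\<close>
  obtain d3 where d3: "d3 > 0" "\<And>h y. 0 < h \<Longrightarrow> h < d3 \<Longrightarrow> \<bar>P h ?u y - ?u y\<bar> < e / 4"
    using op_strongly_continuous[OF uC e4] by blast
  obtain d4 where d4: "d4 > 0" "\<And>h y. 0 < h \<Longrightarrow> h < d4 \<Longrightarrow> \<bar>P h u1 y - u1 y\<bar> < e / 4"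
    using op_strongly_continuous[OF u(3) e4] by blast
  define d where "d = Min {d1, d2, d3, d4}"
  have d: "d > 0" "d \<le> d1" "d \<le> d2" "d \<le> d3" "d \<le> d4" using d1(1) d2(1) d3(1) d4(1) by (auto simp: d_def)
  have Pq: "bdd_measurable (\<lambda>y. (P h (f s) y - f s y) / h)" if "h > 0" for h
    using that by (intro bdd_measurable_divide bdd_measurable_diff op_bdd_measurable f) auto
  have fq: "bdd_measurable (\<lambda>y. (f (s + h) y - f s y) / h)" for h
    by (intro bdd_measurable_divide bdd_measurable_diff f)
  have "dist ((P r (f r) x - P s (f s) x) / (r - s)) (P s ?u x) < e" if r: "r \<ge> 0" "r \<noteq> s" "\<bar>r - s\<bar> < d" for r
  proof (cases "r > s")
    case True
    define h where "h = r - s"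
    have h: "0 < h" "h < d" "r = s + h" using True r by (auto simp: h_def)
    \<comment> \<open>The change of \<open>f\<close> is taken under \<open>P r\<close>, the change
      of the semigroup under \<open>P s\<close>.\<close>
    have 1: "P r (f r) x - P r (f s) x = h * P r (\<lambda>y. (f (s + h) y - f s y) / h) x"
      using h(1) unfolding h(3)[symmetric] by (simp add: op_divide op_linear(2)[OF r(1) f f])
    have 2: "P r (f s) x - P s (f s) x = h * P s (\<lambda>y. (P h (f s) y - f s y) / h) x"
      using h s by (simp add: op_divide op_linear(2)[OF s op_bdd_measurable[OF _ f] f] op_add[OF s _ f])
    have q: "(P r (f r) x - P s (f s) x) / (r - s) = P r (\<lambda>y. (f (s + h) y - f s y) / h) x + P s (\<lambda>y. (P h (f s) y - f s y) / h) x"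
    proof -
      have "P r (f r) x - P s (f s) x = h * (P r (\<lambda>y. (f (s + h) y - f s y) / h) x + P s (\<lambda>y. (P h (f s) y - f s y) / h) x)"
        using 1 2 by (simp add: distrib_left)
      then show ?thesis using h by simp
    qed
    have a: "\<bar>P r (\<lambda>y. (f (s + h) y - f s y) / h) x - P r u1 x\<bar> \<le> e / 4"
      by (rule op_contraction[OF r(1) fq u(4)]) (use d2(2)[of h] h d in auto)
    have b: "\<bar>P r u1 x - P s u1 x\<bar> \<le> e / 4"
    proof -
      have "\<bar>P s (P h u1) x - P s u1 x\<bar> \<le> e / 4"
        by (rule op_contraction[OF s op_bdd_measurable u(4)]) (use h d d4(2)[of h] u(4) in \<open>auto intro: less_imp_le\<close>)
      then show ?thesis using op_add[OF s _ u(4), of h] h by simp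
    qed
    have c: "\<bar>P s (\<lambda>y. (P h (f s) y - f s y) / h) x - P s u0 x\<bar> \<le> e / 4"
      by (rule op_contraction[OF s Pq u(2)]) (use h d d1(2)[of h] in \<open>auto intro: less_imp_le\<close>)
    show ?thesis unfolding q op_linear(1)[OF s u(2,4)] dist_real_def using a b c e by linarith
  next
    case False
    define h where "h = s - r"
    have h: "0 < h" "h < d" "r + h = s" "s + - h = r" and rs: "r - s = - h" using False r by (auto simp: h_def)
    \<comment> \<open>Going backward, P s = P r P h puts the whole quotient under
      \<open>P r\<close>, with the generator quotient still taken at \<open>f s\<close>.\<close>
    let ?q = "\<lambda>y. (P h (f s) y - f s y) / h + (f (s + - h) y - f s y) / (- h)"
    have qb: "bdd_measurable ?q" by (rule bdd_measurable_add[OF Pq[OF h(1)] fq])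
    have q: "(P r (f r) x - P s (f s) x) / (r - s) = P r ?q x"
    proof -
      have "?q = (\<lambda>y. (P h (f s) y - f r y) / h)" unfolding h(4) using h(1) by (simp add: fun_eq_iff field_simps)
      then have "P r ?q x = (P r (P h (f s)) x - P r (f r) x) / h"
        using h(1) by (simp add: op_divide op_linear(2)[OF r(1) op_bdd_measurable[OF _ f] f])
      also have "P r (P h (f s)) x = P s (f s) x" using op_add[OF r(1) _ f[of s], of h x] h(1) unfolding h(3) by simp
      finally show ?thesis unfolding rs using h(1) by (simp add: field_simps)
    qed
    have a: "\<bar>P r ?q x - P r ?u x\<bar> \<le> e / 2"
    proof (rule op_contraction[OF r(1) qb ub])
      fix y
      have "\<bar>(P h (f s) y - f s y) / h - u0 y\<bar> < e / 4" using d1(2)[of h y] h(1,2) d by simp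
      moreover have "\<bar>(f (s + - h) y - f s y) / (- h) - u1 y\<bar> \<le> e / 4" using d2(2)[of "- h" y] h(1,2) d by simp
      ultimately show "\<bar>?q y - ?u y\<bar> \<le> e / 2" by linarith
    qed
    have b: "\<bar>P s ?u x - P r ?u x\<bar> \<le> e / 4"
    proof -
      have "\<bar>P r (P h ?u) x - P r ?u x\<bar> \<le> e / 4"
        by (rule op_contraction[OF r(1) op_bdd_measurable ub]) (use h d d3(2)[of h] ub in \<open>auto intro: less_imp_le\<close>)
      then show ?thesis using op_add[OF r(1) _ ub, of h] h(1) unfolding h(3) by simp
    qed
    show ?thesis unfolding q dist_real_def using a b e by linarith
  qed
  then show "\<forall>\<^sub>F r in at s within {0..}. dist ((P r (f r) x - P s (f s) x) / (r - s)) (P s ?u x) < e"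
    unfolding eventually_at using d(1) by (intro exI[of _ d]) (auto simp: dist_real_def)
qed

end

text \<open>By the mean value theorem the quotient is \<open>f'\<close> at a time within |h| of s.
  Off the ball everything vanishes, and on the compact cylinder \<open>f'\<close> is uniformly
  continuous.\<close>

lemma uniform_difference_quotient:
  fixes f :: "real \<Rightarrow> 'a::euclidean_space \<Rightarrow> real"
  assumes df: "\<And>s y. ((\<lambda>s. f s y) has_real_derivative f' s y) (at s)"
    and cont: "continuous_on UNIV (\<lambda>p. f' (fst p) (snd p))"
    and supp: "\<And>s y. R < norm y \<Longrightarrow> f s y = 0" "\<And>s y. R < norm y \<Longrightarrow> f' s y = 0" and e: "e > 0"
  shows "\<exists>\<delta>>0. \<forall>h. h \<noteq> 0 \<and> \<bar>h\<bar> < \<delta> \<longrightarrow> (\<forall>y. \<bar>(f (s + h) y - f s y) / h - f' s y\<bar> \<le> e)"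
proof -
  have "uniformly_continuous_on (cball s 1 \<times> cball 0 R) (\<lambda>p. f' (fst p) (snd p))"
    by (intro compact_uniformly_continuous continuous_on_subset[OF cont] compact_Times) auto
  then have "\<exists>d>0. \<forall>p\<in>cball s 1 \<times> cball 0 R. \<forall>q\<in>cball s 1 \<times> cball 0 R. dist q p < d \<longrightarrow>
      dist (f' (fst q) (snd q)) (f' (fst p) (snd p)) < e"
    using e unfolding uniformly_continuous_on_def by (elim allE[of _ e] impE)
  then obtain d where d: "d > 0" "\<forall>p\<in>cball s 1 \<times> cball 0 R. \<forall>q\<in>cball s 1 \<times> cball 0 R. dist q p < d \<longrightarrow>
      dist (f' (fst q) (snd q)) (f' (fst p) (snd p)) < e"
    by (elim exE conjE)
  have "\<bar>(f (s + h) y - f s y) / h - f' s y\<bar> \<le> e" if h: "h \<noteq> 0" "\<bar>h\<bar> < min d 1" for h y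
  proof (cases "R < norm y")
    case True
    then show ?thesis using supp e by simp
  next
    case False
    have "\<exists>r. \<bar>r - s\<bar> \<le> \<bar>h\<bar> \<and> f (s + h) y - f s y = h * f' r y"
    proof (cases "h > 0")
      case True
      then obtain z where "s < z" "z < s + h" "f (s + h) y - f s y = (s + h - s) * f' z y"
        using MVT2[of s "s + h" "\<lambda>s. f s y" "\<lambda>s. f' s y"] df by auto
      then show ?thesis by (intro exI[of _ z]) auto
    next
      case False
      then have "s + h < s" using h by simp
      then obtain z where "s + h < z" "z < s" "f s y - f (s + h) y = (s - (s + h)) * f' z y"
        using MVT2[of "s + h" s "\<lambda>s. f s y" "\<lambda>s. f' s y"] df by auto
      then show ?thesis by (intro exI[of _ z]) (auto simp: algebra_simps)
    qed
    then obtain r where r: "\<bar>r - s\<bar> \<le> \<bar>h\<bar>" "f (s + h) y - f s y = h * f' r y" by blast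
    have "dist (f' (fst (r, y)) (snd (r, y))) (f' (fst (s, y)) (snd (s, y))) < e"
      by (rule d(2)[rule_format]) (use r(1) h False in \<open>auto simp: dist_real_def dist_Pair_Pair abs_minus_commute\<close>)
    then show ?thesis using r(2) h by (simp add: dist_real_def)
  qed
  then show ?thesis using d(1) by (intro exI[of _ "min d 1"]) auto
qed

text \<open>At u = 0 the difference quotient is at most |h|^n, which tends to 0. Applied twice, it
  makes the cube of a positive part twice continuously differentiable.\<close>

lemma max_0_power_derivative:
  assumes "n \<ge> 1"
  shows "((\<lambda>u::real. max 0 u ^ Suc n) has_real_derivative real (Suc n) * max 0 u ^ n) (at u)"
proof -
  consider "u < 0" | "u > 0" | "u = 0" by linarith
  then show ?thesis
  proof cases
    case 1
    have "((\<lambda>u::real. 0) has_real_derivative 0) (at u)" by simp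
    then have "((\<lambda>u::real. max 0 u ^ Suc n) has_real_derivative 0) (at u)"
      by (rule has_field_derivative_transform_within_open[where S = "{..<0}"]) (use 1 in auto)
    then show ?thesis using 1 assms by (simp add: power_0_left)
  next
    case 2
    have "((\<lambda>u::real. u ^ Suc n) has_real_derivative real (Suc n) * u ^ n) (at u)"
      using DERIV_pow[of "Suc n" u] by simp
    then have "((\<lambda>u::real. max 0 u ^ Suc n) has_real_derivative real (Suc n) * u ^ n) (at u)"
      by (rule has_field_derivative_transform_within_open[where S = "{0<..}"]) (use 2 in auto)
    then show ?thesis using 2 by simp
  next
    case 3
    have "((\<lambda>h::real. max 0 h ^ Suc n / h) \<longlongrightarrow> 0) (at 0)"
    proof (rule Lim_null_comparison)
      show "\<forall>\<^sub>F h in at 0. norm (max 0 h ^ Suc n / h) \<le> \<bar>h\<bar> ^ n"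
        unfolding eventually_at_filter by (rule always_eventually) (auto simp: max_def power_0_left)
      show "((\<lambda>h::real. \<bar>h\<bar> ^ n) \<longlongrightarrow> 0) (at 0)"
        using assms by (auto intro!: tendsto_eq_intros)
    qed
    then show ?thesis using 3 assms by (simp add: has_field_derivative_iff power_0_left)
  qed
qed

section \<open>Identification of the transition probabilities\<close>

text \<open>The positive part of a polynomial; its cube is the compactly supported C^2 factor that
  multiplies the plane waves.\<close>

definition cutoff :: "real \<Rightarrow> 'a::real_inner \<Rightarrow> real" where
  "cutoff R y = max 0 (1 - (y \<bullet> y) / R\<^sup>2)"

lemma cutoff_power_has_derivative:
  assumes "n \<ge> 1"
  shows "((\<lambda>y. cutoff R y ^ Suc n) has_derivative (\<lambda>k. real (Suc n) * cutoff R y ^ n * (- 2 * (y \<bullet> k) / R\<^sup>2))) (at y)"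
proof -
  have "((\<lambda>y. 1 - (y \<bullet> y) / R\<^sup>2) has_derivative (\<lambda>k. - 2 * (y \<bullet> k) / R\<^sup>2)) (at y)"
    unfolding divide_inverse by (auto intro!: derivative_eq_intros simp: inner_commute algebra_simps)
  from DERIV_compose_FDERIV[OF max_0_power_derivative[OF assms] this]
  show ?thesis by (simp add: cutoff_def mult.commute)
qed

lemma cutoff_bounds: "0 \<le> cutoff R y" "cutoff R y \<le> 1"
  by (auto simp: cutoff_def)

lemma cutoff_outside: "0 < R \<Longrightarrow> R < norm y \<Longrightarrow> cutoff R y = 0"
proof -
  assume "0 < R" "R < norm y"
  then have "R\<^sup>2 < y \<bullet> y" unfolding power2_norm_eq_inner[symmetric] by (intro power_strict_mono) auto
  then show ?thesis using \<open>0 < R\<close> by (simp add: cutoff_def max_def field_simps)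
qed

lemma continuous_on_cutoff [continuous_intros]:
  "continuous_on S f \<Longrightarrow> continuous_on S (\<lambda>x. cutoff R (f x))"
  unfolding cutoff_def divide_inverse by (intro continuous_intros)

lemma cutoff_tendsto: "(\<lambda>n. cutoff (real (Suc n)) y) \<longlonglongrightarrow> 1"
proof -
  have "(\<lambda>n. (1 / real (Suc n))\<^sup>2) \<longlonglongrightarrow> 0\<^sup>2"
    using LIMSEQ_inverse_real_of_nat by (intro tendsto_power) (simp add: inverse_eq_divide)
  then have "(\<lambda>n. max 0 (1 - (y \<bullet> y) * (1 / real (Suc n))\<^sup>2)) \<longlonglongrightarrow> max 0 (1 - (y \<bullet> y) * 0\<^sup>2)"
    by (intro tendsto_max tendsto_diff tendsto_mult tendsto_const)
  then show ?thesis by (simp add: cutoff_def power_divide)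
qed

lemma compact_support_C0:
  fixes u :: "real^'n \<Rightarrow> real"
  assumes u: "continuous_on UNIV u" "\<And>y. R < norm y \<Longrightarrow> u y = 0"
  shows "u \<in> C0" "bdd_measurable u"
proof -
  have "\<forall>\<^sub>F y in at_infinity. u y = 0"
    unfolding eventually_at_infinity using u(2) by (intro exI[of _ "R + 1"]) auto
  then show "u \<in> C0" using u(1) by (auto simp: C0_def intro: tendsto_eventually)
  have "compact (u ` cball 0 R)" by (intro compact_continuous_image continuous_on_subset[OF u(1)]) auto
  then obtain C where C: "\<And>x. x \<in> u ` cball 0 R \<Longrightarrow> norm x \<le> C" using compact_imp_bounded bounded_iff by metis
  have "\<bar>u y\<bar> \<le> max 0 C" for y
    using C[of "u y"] u(2)[of y] by (cases "R < norm y") auto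
  then show "bdd_measurable u" by (intro bdd_measurableI borel_measurable_continuous_onI u(1))
qed

lemma grad_eqI:
  assumes "(f has_derivative (\<lambda>k. G \<bullet> k)) (at x)"
  shows "grad f x = G"
  unfolding grad_def frechet_derivative_at[OF assms, symmetric] by (simp add: vec_eq_iff inner_axis)

context
  fixes R c b :: real and v :: "real^'n"
begin

text \<open>A real plane wave with a phase: b = 0 and b = pi / 2 give the real and the imaginary
  part of the characteristic function. Amplitude \<open>c\<close> and frequency \<open>v\<close>
  will depend on time.\<close>

definition wave :: "real^'n \<Rightarrow> real" where
  "wave y = c * (cutoff R y ^ 3 * cos (v \<bullet> y - b))"

definition wave_grad :: "real^'n \<Rightarrow> real^'n" where
  "wave_grad y = (- (6 / R\<^sup>2) * c * (cutoff R y ^ 2 * cos (v \<bullet> y - b))) *\<^sub>R y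
     + (- c * (cutoff R y ^ 3 * sin (v \<bullet> y - b))) *\<^sub>R v"

definition wave_hess :: "real^'n \<Rightarrow> real^'n \<Rightarrow> real^'n" where
  "wave_hess y k =
     (24 / R ^ 4 * c * (cutoff R y * cos (v \<bullet> y - b)) * (y \<bullet> k)
       + 6 / R\<^sup>2 * c * (cutoff R y ^ 2 * sin (v \<bullet> y - b)) * (v \<bullet> k)) *\<^sub>R y
     + (- (6 / R\<^sup>2) * c * (cutoff R y ^ 2 * cos (v \<bullet> y - b))) *\<^sub>R k
     + (6 / R\<^sup>2 * c * (cutoff R y ^ 2 * sin (v \<bullet> y - b)) * (y \<bullet> k)
       - c * (cutoff R y ^ 3 * cos (v \<bullet> y - b)) * (v \<bullet> k)) *\<^sub>R v"

lemma cutoff_derivs: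
  "((\<lambda>y. cutoff R y ^ 3) has_derivative (\<lambda>k. 3 * cutoff R y ^ 2 * (- 2 * (y \<bullet> k) / R\<^sup>2))) (at y)"
  "((\<lambda>y. cutoff R y ^ 2) has_derivative (\<lambda>k. 2 * cutoff R y * (- 2 * (y \<bullet> k) / R\<^sup>2))) (at y)"
  for y :: "real^'n"
  using cutoff_power_has_derivative[of 2 R y] cutoff_power_has_derivative[of 1 R y] by (simp_all add: numeral_eq_Suc)

lemma phase_derivs:
  "((\<lambda>y. cos (v \<bullet> y - b)) has_derivative (\<lambda>k. - sin (v \<bullet> y - b) * (v \<bullet> k))) (at y)"
  "((\<lambda>y. sin (v \<bullet> y - b)) has_derivative (\<lambda>k. cos (v \<bullet> y - b) * (v \<bullet> k))) (at y)"
  by (rule derivative_eq_intros refl | simp add: fun_eq_iff mult.commute)+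

lemma wave_has_derivative: "(wave has_derivative (\<lambda>k. wave_grad y \<bullet> k)) (at y)"
  unfolding wave_def[abs_def] wave_grad_def
  by (rule has_derivative_eq_rhs, (rule has_derivative_mult_right has_derivative_mult cutoff_derivs phase_derivs)+)
    (simp add: fun_eq_iff inner_add_left algebra_simps)

lemma wave_grad_has_derivative: "(wave_grad has_derivative wave_hess y) (at y)"
  unfolding wave_grad_def[abs_def] wave_hess_def[abs_def]
  by (rule has_derivative_eq_rhs,
     (rule has_derivative_add has_derivative_scaleR has_derivative_mult_right has_derivative_mult cutoff_derivs
       phase_derivs has_derivative_ident has_derivative_const)+)
    (simp add: fun_eq_iff algebra_simps power2_eq_square power4_eq_xxxx scaleR_add_left)

lemma grad_wave: "grad wave = wave_grad"
  using grad_eqI[OF wave_has_derivative] by blast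

lemma wave_C2c:
  assumes R: "R > 0"
  shows "wave \<in> C2c"
  unfolding C2c_def
proof (intro CollectI conjI allI)
  show "wave differentiable at x" for x using wave_has_derivative differentiableI by blast
  show "grad wave differentiable at x" for x unfolding grad_wave using wave_grad_has_derivative differentiableI by blast
  fix k
  have e: "frechet_derivative (grad wave) (at x) k = wave_hess x k" for x
    unfolding grad_wave frechet_derivative_at[OF wave_grad_has_derivative, symmetric] ..
  have "continuous_on UNIV (\<lambda>x. wave_hess x k)"
    using R unfolding wave_hess_def by (auto intro!: continuous_intros)
  then show "continuous_on UNIV (\<lambda>x. frechet_derivative (grad wave) (at x) k)" unfolding e .
next
  have "{x. wave x \<noteq> 0} \<subseteq> cball 0 R"
    using cutoff_outside[OF R] by (force simp: wave_def)
  then have "bounded {x. wave x \<noteq> 0}" using bounded_subset bounded_cball by blast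
  then show "compact (closure {x. wave x \<noteq> 0})" by (simp add: compact_closure)
qed

text \<open>The terms of the generator in which a derivative falls on the cutoff; each carries a
  factor R^-2 or R^-4.\<close>

definition wave_error :: "real^'n^'n \<Rightarrow> real^'n^'n \<Rightarrow> real^'n \<Rightarrow> real" where
  "wave_error B D y =
     c * cos (v \<bullet> y - b) * (6 / R\<^sup>2 * cutoff R y ^ 2 * ((B *v y) \<bullet> y) - 6 / R\<^sup>2 * cutoff R y ^ 2 * (\<Sum>i\<in>UNIV. D $ i $ i)
       + 24 / R ^ 4 * cutoff R y * (y \<bullet> (D *v y)))
     + c * sin (v \<bullet> y - b) * (6 / R\<^sup>2 * cutoff R y ^ 2) * (v \<bullet> (D *v y) + y \<bullet> (D *v v))"

text \<open>The time derivative of the wave when the frequency moves by v' = B^T v and the amplitude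
  by c' = (v \<bullet> D v) c, as the backward equation requires of an exact plane wave.\<close>

definition wave_drift :: "real^'n^'n \<Rightarrow> real^'n^'n \<Rightarrow> real^'n \<Rightarrow> real" where
  "wave_drift B D y = c * (cutoff R y ^ 3 * ((v \<bullet> (D *v v)) * cos (v \<bullet> y - b) - sin (v \<bullet> y - b) * (v \<bullet> (B *v y))))"

text \<open>Where no derivative hits the cutoff, the generator acts as on a pure plane wave and is
  cancelled by the drift.\<close>

lemma OU_generator_wave: "OU_generator B D wave y + wave_drift B D y = wave_error B D y"
proof -
  have "((\<lambda>y. D *v wave_grad y) has_derivative (\<lambda>k. D *v wave_hess y k)) (at y)"
    by (rule bounded_linear.has_derivative[OF bounded_bilinear.bounded_linear_right[OF bounded_bilinear_matrix_vector_mult] wave_grad_has_derivative])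
  from frechet_derivative_at[OF this, symmetric]
  have "divergence (\<lambda>y. D *v grad wave y) y = (\<Sum>i\<in>UNIV. (D *v wave_hess y (axis i 1)) $ i)"
    unfolding divergence_def grad_wave by (rule ssubst) (rule refl)
  also have "\<dots> = (\<Sum>i\<in>UNIV.
       (24 / R ^ 4 * c * (cutoff R y * cos (v \<bullet> y - b))) * (y $ i * (D *v y) $ i)
       + (6 / R\<^sup>2 * c * (cutoff R y ^ 2 * sin (v \<bullet> y - b))) * (v $ i * (D *v y) $ i)
       + (- (6 / R\<^sup>2) * c * (cutoff R y ^ 2 * cos (v \<bullet> y - b))) * D $ i $ i
       + (6 / R\<^sup>2 * c * (cutoff R y ^ 2 * sin (v \<bullet> y - b))) * (y $ i * (D *v v) $ i)
       - (c * (cutoff R y ^ 3 * cos (v \<bullet> y - b))) * (v $ i * (D *v v) $ i))" (is "_ = (\<Sum>i\<in>UNIV. ?t i)")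
  proof (rule sum.cong[OF refl])
    fix i
    have "(D *v axis i 1) $ i = D $ i $ i" by (simp add: matrix_vector_mult_basis column_def)
    then show "(D *v wave_hess y (axis i 1)) $ i = ?t i"
      unfolding wave_hess_def matrix_vector_right_distrib matrix_vector_mult_scaleR vector_add_component vector_scaleR_component
      by (simp add: inner_axis distrib_right left_diff_distrib mult.assoc)
  qed
  also have "\<dots> =
       24 / R ^ 4 * c * (cutoff R y * cos (v \<bullet> y - b)) * (y \<bullet> (D *v y))
       + 6 / R\<^sup>2 * c * (cutoff R y ^ 2 * sin (v \<bullet> y - b)) * (v \<bullet> (D *v y))
       + (- (6 / R\<^sup>2) * c * (cutoff R y ^ 2 * cos (v \<bullet> y - b))) * (\<Sum>i\<in>UNIV. D $ i $ i)
       + 6 / R\<^sup>2 * c * (cutoff R y ^ 2 * sin (v \<bullet> y - b)) * (y \<bullet> (D *v v))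
       - c * (cutoff R y ^ 3 * cos (v \<bullet> y - b)) * (v \<bullet> (D *v v))" (is "_ = ?r")
    by (simp only: sum.distrib sum_subtractf sum_distrib_left[symmetric] inner_vec_def inner_real_def)
  finally have div: "divergence (\<lambda>y. D *v grad wave y) y = ?r" .
  show ?thesis
    unfolding OU_generator_def div
    unfolding grad_wave wave_grad_def wave_drift_def wave_error_def inner_add_right inner_scaleR_right
    by (simp add: algebra_simps add_divide_distrib inner_commute[of v "B *v y"])
qed

lemma wave_continuous: "continuous_on S wave" "continuous_on S (wave_drift B D)" "continuous_on S (wave_error B D)"
  unfolding wave_def[abs_def] wave_drift_def[abs_def] wave_error_def[abs_def]
  by (intro continuous_intros linear_continuous_on_compose[OF _ matrix_vector_mul_linear])+

lemma wave_outside: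
  assumes "R > 0" "R < norm y"
  shows "wave y = 0" "wave_drift B D y = 0" "wave_error B D y = 0"
  using cutoff_outside[OF assms] by (simp_all add: wave_def wave_drift_def wave_error_def)

text \<open>Quadratic growth in y is compensated by R^-2 on the support |y| \<le> R, which gives a
  bound uniform in R; at fixed y the right side tends to 0. Both serve dominated convergence as the
  cutoff is removed.\<close>

lemma wave_error_bound:
  assumes R: "R \<ge> 1" and c: "\<bar>c\<bar> \<le> 1"
  shows "\<bar>wave_error B D y\<bar> \<le> 1 / R\<^sup>2 * (6 * \<bar>(B *v y) \<bullet> y\<bar> + 6 * \<bar>\<Sum>i\<in>UNIV. D $ i $ i\<bar> + 24 * \<bar>y \<bullet> (D *v y)\<bar> + 6 * \<bar>v \<bullet> (D *v y)\<bar> + 6 * \<bar>y \<bullet> (D *v v)\<bar>)"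
proof -
  let ?W = "cutoff R y"
  have W: "0 \<le> ?W" "?W \<le> 1" "0 \<le> ?W ^ 2" "?W ^ 2 \<le> 1" using cutoff_bounds[of R y] by (auto intro: power_le_one)
  have "R\<^sup>2 \<le> R ^ 4" using R by (intro power_increasing) auto
  then have R2: "0 \<le> 1 / R\<^sup>2" "1 / R ^ 4 \<le> 1 / R\<^sup>2" using R by (simp_all add: frac_le)
  have k: "\<bar>c * cos (v \<bullet> y - b)\<bar> \<le> 1" "\<bar>c * sin (v \<bullet> y - b)\<bar> \<le> 1"
    unfolding abs_mult using c by (intro mult_le_one; simp)+
  have b1: "\<bar>6 / R\<^sup>2 * ?W ^ 2 * x\<bar> \<le> 1 / R\<^sup>2 * (6 * \<bar>x\<bar>)" for x
  proof -
    have "\<bar>6 / R\<^sup>2 * ?W ^ 2 * x\<bar> = (1 / R\<^sup>2 * (6 * \<bar>x\<bar>)) * ?W ^ 2" using R2 W by (simp add: abs_mult)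
    also have "\<dots> \<le> (1 / R\<^sup>2 * (6 * \<bar>x\<bar>)) * 1" using W R2 by (intro mult_left_mono mult_nonneg_nonneg) auto
    finally show ?thesis by simp
  qed
  have b2: "\<bar>24 / R ^ 4 * ?W * x\<bar> \<le> 1 / R\<^sup>2 * (24 * \<bar>x\<bar>)" for x
  proof -
    have "\<bar>24 / R ^ 4 * ?W * x\<bar> = (1 / R ^ 4 * (24 * \<bar>x\<bar>)) * ?W" using R W by (simp add: abs_mult)
    also have "\<dots> \<le> (1 / R\<^sup>2 * (24 * \<bar>x\<bar>)) * 1" using W R2 by (intro mult_mono mult_right_mono) auto
    finally show ?thesis by simp
  qed
  define z1 where "z1 = 6 / R\<^sup>2 * ?W ^ 2 * ((B *v y) \<bullet> y) - 6 / R\<^sup>2 * ?W ^ 2 * (\<Sum>i\<in>UNIV. D $ i $ i) + 24 / R ^ 4 * ?W * (y \<bullet> (D *v y))"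
  define z2 where "z2 = 6 / R\<^sup>2 * ?W ^ 2 * (v \<bullet> (D *v y)) + 6 / R\<^sup>2 * ?W ^ 2 * (y \<bullet> (D *v v))"
  have e: "wave_error B D y = (c * cos (v \<bullet> y - b)) * z1 + (c * sin (v \<bullet> y - b)) * z2"
    unfolding wave_error_def z1_def z2_def by (simp add: distrib_left mult.assoc)
  have "\<bar>wave_error B D y\<bar> \<le> \<bar>z1\<bar> + \<bar>z2\<bar>"
  proof -
    have "\<bar>(c * cos (v \<bullet> y - b)) * z1\<bar> \<le> 1 * \<bar>z1\<bar>" "\<bar>(c * sin (v \<bullet> y - b)) * z2\<bar> \<le> 1 * \<bar>z2\<bar>"
      unfolding abs_mult[of _ z1] abs_mult[of _ z2] using k by (intro mult_right_mono; simp)+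
    then show ?thesis unfolding e by linarith
  qed
  also have "\<dots> \<le> 1 / R\<^sup>2 * (6 * \<bar>(B *v y) \<bullet> y\<bar>) + 1 / R\<^sup>2 * (6 * \<bar>\<Sum>i\<in>UNIV. D $ i $ i\<bar>) + 1 / R\<^sup>2 * (24 * \<bar>y \<bullet> (D *v y)\<bar>)
      + 1 / R\<^sup>2 * (6 * \<bar>v \<bullet> (D *v y)\<bar>) + 1 / R\<^sup>2 * (6 * \<bar>y \<bullet> (D *v v)\<bar>)"
  proof -
    have "\<bar>p - q + r\<bar> + \<bar>s + t\<bar> \<le> p' + q' + r' + s' + t'"
      if "\<bar>p\<bar> \<le> p'" "\<bar>q\<bar> \<le> q'" "\<bar>r\<bar> \<le> r'" "\<bar>s\<bar> \<le> s'" "\<bar>t\<bar> \<le> t'" for p q r s t p' q' r' s' t' :: real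
      using that by linarith
    from this[OF b1 b1 b2 b1 b1] show ?thesis unfolding z1_def z2_def .
  qed
  finally show ?thesis by (simp only: distrib_left)
qed

end

locale ornstein_uhlenbeck = hurwitz B D + feller K
  for B D :: "real^'n^'n" and K :: "real \<Rightarrow> real^'n \<Rightarrow> (real^'n) measure" +
  assumes OU: "OU_semigroup B D K"
begin

text \<open>\<open>(s, y) \<mapsto> exp (- rate s) cos (flow (T - s) \<xi> \<bullet> y - b)\<close> solves the backward equation; after
  multiplication by the cutoff it is an admissible test function, up to an error that vanishes as
  \<open>R \<rightarrow> \<infinity>\<close>.\<close>

lemma kernel_cos:
  assumes T: "T \<ge> 0"
  shows "(\<integral>y. cos (\<xi> \<bullet> y - b) \<partial>K T x) = exp (- (qform Q \<xi> - qform Q (flow T \<xi>)) / 2) * cos (flow T \<xi> \<bullet> x - b)"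
proof -
  \<comment> \<open>Everything is run in the remaining time T - s: at s = T the wave has frequency
    \<xi> and amplitude 1, and at s = 0 it is the claimed value up to the cutoff.\<close>
  define rate where "rate s = (qform Q \<xi> - qform Q (flow (T - s) \<xi>)) / 2" for s
  define V where "V s = flow (T - s) \<xi>" for s
  have dV: "(V has_vector_derivative transpose B *v V s) (at s)" for s
  proof -
    have "((\<lambda>s. T - s) has_vector_derivative (- 1)) (at s)" by (auto intro!: derivative_eq_intros)
    from vector_diff_chain_at[OF this flow_has_vector_derivative[of \<xi> "T - s"]]
    show ?thesis by (simp add: V_def[abs_def] o_def del: transpose_matrix_vector)
  qed
  have dr: "(rate has_real_derivative - qform D (V s)) (at s)" for s
  proof -
    have "((\<lambda>s. qform Q (flow (T - s) \<xi>)) has_real_derivative (- 2 * qform D (flow (T - s) \<xi>)) * (- 1)) (at s)"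
      by (rule DERIV_chain2[OF qform_flow_derivative]) (auto intro!: derivative_eq_intros)
    then show ?thesis unfolding rate_def[abs_def] V_def by (auto intro!: derivative_eq_intros)
  qed
  have cV: "continuous_on S V" for S
    using dV by (auto intro!: continuous_at_imp_continuous_on has_vector_derivative_continuous)
  have cr: "continuous_on S rate" for S
    using dr by (auto intro!: continuous_at_imp_continuous_on DERIV_isCont)
  define f where "f n s = wave (real (Suc n)) (exp (- rate s)) b (V s)" for n s
  define f' where "f' n s = wave_drift (real (Suc n)) (exp (- rate s)) b (V s) B D" for n s
  define er where "er n s = wave_error (real (Suc n)) (exp (- rate s)) b (V s) B D" for n s
  have R: "real (Suc n) > 0" "real (Suc n) \<ge> 1" for n by simp_all
  have df: "((\<lambda>s. f n s y) has_real_derivative f' n s y) (at s)" for n s y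
  proof -
    have "((\<lambda>s. V s \<bullet> y) has_vector_derivative (transpose B *v V s) \<bullet> y) (at s)"
      by (rule bounded_linear.has_vector_derivative[OF bounded_linear_inner_left dV])
    then have dV': "((\<lambda>s. V s \<bullet> y) has_real_derivative V s \<bullet> (B *v y)) (at s)"
      by (simp add: has_real_derivative_iff_has_vector_derivative inner_matrix_transpose del: transpose_matrix_vector)
    show ?thesis unfolding f_def f'_def wave_def wave_drift_def
      by (rule derivative_eq_intros dV' dr refl)+ (simp add: qform_def algebra_simps)
  qed
  have cont_f': "continuous_on UNIV (\<lambda>p. f' n (fst p) (snd p))" for n
  proof -
    have "continuous_on UNIV (\<lambda>p. V (fst p))" "continuous_on UNIV (\<lambda>p. rate (fst p))"
      by (rule continuous_on_compose2[OF cV[of UNIV] continuous_on_fst[OF continuous_on_id]], simp)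
        (rule continuous_on_compose2[OF cr[of UNIV] continuous_on_fst[OF continuous_on_id]], simp)
    then show ?thesis unfolding f'_def wave_drift_def
      by (intro continuous_intros linear_continuous_on_compose[OF _ matrix_vector_mul_linear])
  qed
  note cs = compact_support_C0[OF wave_continuous(1) wave_outside(1)[OF R(1)]]
    compact_support_C0[OF wave_continuous(2) wave_outside(2)[OF R(1)]]
    compact_support_C0[OF wave_continuous(3) wave_outside(3)[OF R(1)]]
  have ou: "OU_generator B D (f n s) = (\<lambda>y. er n s y - f' n s y)" for n s
  proof
    show "OU_generator B D (f n s) y = er n s y - f' n s y" for y
      using OU_generator_wave[of B D "real (Suc n)" "exp (- rate s)" b "V s" y] unfolding f_def f'_def er_def by linarith
  qed
  have ouC: "(\<lambda>y. er n s y - f' n s y) \<in> C0" "bdd_measurable (\<lambda>y. er n s y - f' n s y)" for n s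
  proof -
    have c: "continuous_on UNIV (\<lambda>y. er n s y - f' n s y)" unfolding er_def f'_def by (intro continuous_intros wave_continuous)
    have z: "er n s y - f' n s y = 0" if "real (Suc n) < norm y" for y
      unfolding er_def f'_def using wave_outside[OF R(1) that] by simp
    show "(\<lambda>y. er n s y - f' n s y) \<in> C0" "bdd_measurable (\<lambda>y. er n s y - f' n s y)" using compact_support_C0[OF c z] by auto
  qed
  \<comment> \<open>The generator contributes \<open>er n s - f' n s\<close> and the time dependence
    \<open>f' n s\<close>, so only the error is left.\<close>
  have dF: "((\<lambda>s. P s (f n s) x) has_real_derivative P s (er n s) x) (at s within {0..})" if s: "s \<ge> 0" for n s
  proof -
    have gen: "uniform_limit UNIV (\<lambda>t y. (P t (f n s) y - f n s y) / t) (\<lambda>y. er n s y - f' n s y) (at_right 0)"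
      using OU wave_C2c[OF R(1), of n "exp (- rate s)" b "V s"] unfolding OU_semigroup_def ou[symmetric] f_def by blast
    have "((\<lambda>s. P s (f n s) x) has_real_derivative P s (\<lambda>y. (er n s y - f' n s y) + f' n s y) x) (at s within {0..})"
    proof (rule op_time_derivative[where f = "f n", OF s _ gen _ ouC])
      show "bdd_measurable (f n r)" for r unfolding f_def by (rule cs(2))
      show "f' n s \<in> C0" unfolding f'_def by (rule cs(3))
      show "bdd_measurable (f' n s)" unfolding f'_def by (rule cs(4))
      show "\<exists>\<delta>>0. \<forall>h. h \<noteq> 0 \<and> \<bar>h\<bar> < \<delta> \<longrightarrow> (\<forall>y. \<bar>(f n (s + h) y - f n s y) / h - f' n s y\<bar> \<le> e)" if "e > 0" for e
      proof (rule uniform_difference_quotient[OF df cont_f' _ _ that])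
        show "f n s y = 0" "f' n s y = 0" if "real (Suc n) < norm y" for s y
          unfolding f_def f'_def using wave_outside[OF R(1) that] by auto
      qed
    qed
    then show ?thesis by simp
  qed
  have int: "((\<lambda>s. P s (er n s) x) has_integral (P T (f n T) x - P 0 (f n 0) x)) {0..T}" for n
  proof (rule fundamental_theorem_of_calculus[OF T])
    fix s assume "s \<in> {0..T}"
    then have "((\<lambda>s. P s (f n s) x) has_real_derivative P s (er n s) x) (at s within {0..T})"
      by (intro DERIV_subset[OF dF]) auto
    then show "((\<lambda>s. P s (f n s) x) has_vector_derivative P s (er n s) x) (at s within {0..T})"
      by (simp add: has_real_derivative_iff_has_vector_derivative)
  qed
  have rate0: "rate s \<ge> 0" if "s \<in> {0..T}" for s
    using qform_flow_antimono[of 0 "T - s" \<xi>] that by (simp add: rate_def flow_0)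
  obtain KB where KB: "\<And>y. norm (B *v y) \<le> norm y * KB" "KB > 0"
    using bounded_linear.pos_bounded[OF bounded_bilinear.bounded_linear_right[OF bounded_bilinear_matrix_vector_mult, of B]] by blast
  obtain KD where KD: "\<And>y. norm (D *v y) \<le> norm y * KD" "KD > 0"
    using bounded_linear.pos_bounded[OF bounded_bilinear.bounded_linear_right[OF bounded_bilinear_matrix_vector_mult, of D]] by blast
  have "compact (V ` {0..T})" by (intro compact_continuous_image cV) simp
  then obtain L where L: "\<And>s. s \<in> {0..T} \<Longrightarrow> norm (V s) \<le> L"
    using compact_imp_bounded bounded_iff by (metis image_eqI)
  have L0: "L \<ge> 0" using L[of 0] T norm_ge_zero order_trans by (metis atLeastAtMost_iff order_refl)
  define \<tau> where "\<tau> = \<bar>\<Sum>i\<in>UNIV. D $ i $ i\<bar>"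
  define C where "C = 6 * KB + 6 * \<tau> + 24 * KD + 6 * (L * KD) + 6 * (L * KD)"
  have er_le: "\<bar>er n s y\<bar> \<le> (1 / (real (Suc n))\<^sup>2) * (6 * (KB * (norm y)\<^sup>2) + 6 * \<tau> + 24 * (KD * (norm y)\<^sup>2) + 6 * (L * KD * norm y) + 6 * (L * KD * norm y))"
    if s: "s \<in> {0..T}" for n s y
  proof -
    have 1: "\<bar>(B *v y) \<bullet> y\<bar> \<le> KB * (norm y)\<^sup>2"
      using Cauchy_Schwarz_ineq2[of "B *v y" y] mult_right_mono[OF KB(1)[of y], of "norm y"] by (simp add: power2_eq_square mult_ac)
    have 2: "\<bar>y \<bullet> (D *v y)\<bar> \<le> KD * (norm y)\<^sup>2"
      using Cauchy_Schwarz_ineq2[of y "D *v y"] mult_left_mono[OF KD(1)[of y], of "norm y"] by (simp add: power2_eq_square mult_ac)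
    have 3: "\<bar>V s \<bullet> (D *v y)\<bar> \<le> L * KD * norm y"
    proof -
      have "\<bar>V s \<bullet> (D *v y)\<bar> \<le> norm (V s) * norm (D *v y)" by (rule Cauchy_Schwarz_ineq2)
      also have "\<dots> \<le> L * (norm y * KD)" using L[OF s] KD L0 by (intro mult_mono) auto
      finally show ?thesis by (simp add: mult_ac)
    qed
    have 4: "\<bar>y \<bullet> (D *v V s)\<bar> \<le> L * KD * norm y"
    proof -
      have "\<bar>y \<bullet> (D *v V s)\<bar> \<le> norm y * norm (D *v V s)" by (rule Cauchy_Schwarz_ineq2)
      also have "\<dots> \<le> norm y * (norm (V s) * KD)" by (intro mult_left_mono KD) simp
      also have "\<dots> \<le> norm y * (L * KD)" using L[OF s] KD by (intro mult_left_mono mult_right_mono) auto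
      finally show ?thesis by (simp add: mult_ac)
    qed
    have "\<bar>er n s y\<bar> \<le> 1 / (real (Suc n))\<^sup>2 * (6 * \<bar>(B *v y) \<bullet> y\<bar> + 6 * \<bar>\<Sum>i\<in>UNIV. D $ i $ i\<bar> + 24 * \<bar>y \<bullet> (D *v y)\<bar> + 6 * \<bar>V s \<bullet> (D *v y)\<bar> + 6 * \<bar>y \<bullet> (D *v V s)\<bar>)"
      unfolding er_def by (rule wave_error_bound[OF R(2)]) (use rate0[OF s] in simp)
    also have "\<dots> \<le> (1 / (real (Suc n))\<^sup>2) * (6 * (KB * (norm y)\<^sup>2) + 6 * \<tau> + 24 * (KD * (norm y)\<^sup>2) + 6 * (L * KD * norm y) + 6 * (L * KD * norm y))"
      using 1 2 3 4 by (intro mult_left_mono add_mono) (auto simp: \<tau>_def)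
    finally show ?thesis .
  qed
  \<comment> \<open>Outside the ball the error is 0; inside, all powers of |y| up to 2 are at most
    the square of the radius, which cancels the prefactor, so \<open>C\<close> is free of n.\<close>
  have er_bound: "\<bar>er n s y\<bar> \<le> C" if s: "s \<in> {0..T}" for n s y
  proof (cases "real (Suc n) < norm y")
    case True
    have "0 \<le> C" using KB KD L0 by (simp add: C_def \<tau>_def)
    then show ?thesis using wave_outside(3)[OF R(1) True] by (simp add: er_def)
  next
    case False
    let ?R = "real (Suc n)"
    have y: "norm y \<le> ?R" "(norm y)\<^sup>2 \<le> ?R\<^sup>2" "norm y \<le> ?R\<^sup>2" "1 \<le> ?R\<^sup>2"
    proof -
      show 1: "norm y \<le> ?R" using False by simp
      show "(norm y)\<^sup>2 \<le> ?R\<^sup>2" using 1 by (intro power_mono) auto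
      show "1 \<le> ?R\<^sup>2" using R(2) by (rule one_le_power)
      have "?R * 1 \<le> ?R * ?R" by (intro mult_left_mono R(2)) simp
      then show "norm y \<le> ?R\<^sup>2" using 1 unfolding power2_eq_square mult_1_right by (rule order_trans[rotated])
    qed
    have "\<bar>er n s y\<bar> \<le> (1 / ?R\<^sup>2) * (6 * (KB * (norm y)\<^sup>2) + 6 * \<tau> + 24 * (KD * (norm y)\<^sup>2) + 6 * (L * KD * norm y) + 6 * (L * KD * norm y))"
      by (rule er_le[OF s])
    also have "\<dots> \<le> (1 / ?R\<^sup>2) * (6 * (KB * ?R\<^sup>2) + 6 * (\<tau> * ?R\<^sup>2) + 24 * (KD * ?R\<^sup>2) + 6 * (L * KD * ?R\<^sup>2) + 6 * (L * KD * ?R\<^sup>2))"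
    proof (intro mult_left_mono add_mono)
      have "\<tau> * 1 \<le> \<tau> * ?R\<^sup>2" by (intro mult_left_mono y(4)) (simp add: \<tau>_def)
      then show "\<tau> \<le> \<tau> * ?R\<^sup>2" by simp
    qed (use y KB KD L0 in auto)
    also have "\<dots> = (1 / ?R\<^sup>2) * (C * ?R\<^sup>2)" unfolding C_def by (simp only: distrib_right mult.assoc)
    also have "\<dots> = C" by simp
    finally show ?thesis .
  qed
  have erb: "bdd_measurable (er n s)" for n s unfolding er_def by (rule cs(6))
  have er_lim: "(\<lambda>n. er n s y) \<longlonglongrightarrow> 0" if s: "s \<in> {0..T}" for s y
  proof (rule Lim_null_comparison)
    let ?M = "6 * (KB * (norm y)\<^sup>2) + 6 * \<tau> + 24 * (KD * (norm y)\<^sup>2) + 6 * (L * KD * norm y) + 6 * (L * KD * norm y)"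
    show "\<forall>\<^sub>F n in sequentially. norm (er n s y) \<le> (1 / real (Suc n))\<^sup>2 * ?M"
      using er_le[OF s] by (auto simp: power_divide simp del: of_nat_Suc)
    have "(\<lambda>n. (1 / real (Suc n))\<^sup>2 * ?M) \<longlonglongrightarrow> 0\<^sup>2 * ?M"
      using LIMSEQ_inverse_real_of_nat by (intro tendsto_intros) (simp add: inverse_eq_divide)
    then show "(\<lambda>n. (1 / real (Suc n))\<^sup>2 * ?M) \<longlonglongrightarrow> 0" by simp
  qed
  have Pmeas: "u \<in> borel_measurable (K s x)" if "s \<ge> 0" "bdd_measurable u" for u s
    using borel_measurable_integrable[OF integrable_bdd_measurable[OF kernel_prob[OF that(1)] that(2)]] .
  have Per: "(\<lambda>n. P s (er n s) x) \<longlonglongrightarrow> 0" if s: "s \<in> {0..T}" for s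
  proof -
    have s0: "s \<ge> 0" using s by simp
    interpret k: prob_space "K s x" using kernel_prob[OF s0] by simp
    have "(\<lambda>n. \<integral>y. er n s y \<partial>K s x) \<longlonglongrightarrow> (\<integral>y. 0 \<partial>K s x)"
      by (rule integral_dominated_convergence[where w = "\<lambda>_. C"])
        (use er_lim[OF s] er_bound[OF s] Pmeas[OF s0 erb] in auto)
    then show ?thesis by (simp add: semigroup_op_def)
  qed
  \<comment> \<open>Removal of the cutoff: the integrated error vanishes, so the values at times 0
    and T agree in the limit.\<close>
  have "(\<lambda>n. integral {0..T} (\<lambda>s. P s (er n s) x)) \<longlonglongrightarrow> integral {0..T} (\<lambda>s. 0)"
  proof (rule dominated_convergence(2)[where h = "\<lambda>_. C"])
    show "(\<lambda>s. P s (er n s) x) integrable_on {0..T}" for n using int by blast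
    show "(\<lambda>_. C) integrable_on {0..T}" by (rule integrable_const_ivl)
    show "norm (P s (er n s) x) \<le> C" if "s \<in> {0..T}" for n s
    proof -
      have "\<bar>P s (er n s) x - P s (\<lambda>_. 0) x\<bar> \<le> C"
        by (rule op_contraction) (use that erb er_bound[OF that] in \<open>auto intro: bdd_measurableI[of _ 0]\<close>)
      then show ?thesis by (simp add: semigroup_op_def)
    qed
  qed (use Per in auto)
  then have lim0: "(\<lambda>n. P T (f n T) x - P 0 (f n 0) x) \<longlonglongrightarrow> 0"
    unfolding integral_unique[OF int] by simp
  have fb: "bdd_measurable (f n s)" for n s unfolding f_def by (rule cs(2))
  have VT: "V T = \<xi>" "rate T = 0" "V 0 = flow T \<xi>" "rate 0 = (qform Q \<xi> - qform Q (flow T \<xi>)) / 2"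
    by (simp_all add: V_def rate_def flow_0)
  have "(\<lambda>n. P 0 (f n 0) x) \<longlonglongrightarrow> exp (- rate 0) * (1 ^ 3 * cos (V 0 \<bullet> x - b))"
    unfolding op_0[OF fb] unfolding f_def wave_def by (intro tendsto_intros cutoff_tendsto)
  from tendsto_add[OF lim0 this] have "(\<lambda>n. P T (f n T) x) \<longlonglongrightarrow> exp (- rate 0) * cos (V 0 \<bullet> x - b)" by simp
  moreover have "(\<lambda>n. P T (f n T) x) \<longlonglongrightarrow> (\<integral>y. cos (\<xi> \<bullet> y - b) \<partial>K T x)"
    unfolding semigroup_op_def
  proof (rule integral_dominated_convergence[where w = "\<lambda>_. 1"])
    interpret k: prob_space "K T x" using kernel_prob[OF T] by simp
    show "integrable (K T x) (\<lambda>_. 1::real)" by simp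
    show "(\<lambda>y. cos (\<xi> \<bullet> y - b)) \<in> borel_measurable (K T x)"
      by (rule Pmeas[OF T bdd_measurableI[of _ 1]]) auto
    show "f n T \<in> borel_measurable (K T x)" for n by (rule Pmeas[OF T fb])
    show "AE y in K T x. (\<lambda>n. f n T y) \<longlonglongrightarrow> cos (\<xi> \<bullet> y - b)"
    proof (rule AE_I2)
      fix y :: "real^'n"
      have "(\<lambda>n. f n T y) \<longlonglongrightarrow> exp (- rate T) * (1 ^ 3 * cos (V T \<bullet> y - b))"
        unfolding f_def wave_def by (intro tendsto_intros cutoff_tendsto)
      then show "(\<lambda>n. f n T y) \<longlonglongrightarrow> cos (\<xi> \<bullet> y - b)" by (simp add: VT)
    qed
    show "AE y in K T x. norm (f n T y) \<le> 1" for n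
    proof (rule AE_I2)
      fix y :: "real^'n"
      have "\<bar>cutoff (real (Suc n)) y ^ 3\<bar> \<le> 1" using cutoff_bounds[of "real (Suc n)" y] by (simp add: power_le_one)
      then have "\<bar>cutoff (real (Suc n)) y ^ 3\<bar> * \<bar>cos (\<xi> \<bullet> y - b)\<bar> \<le> 1 * 1" by (intro mult_mono) auto
      then show "norm (f n T y) \<le> 1" by (simp add: f_def wave_def VT abs_mult)
    qed
  qed
  ultimately have "(\<integral>y. cos (\<xi> \<bullet> y - b) \<partial>K T x) = exp (- rate 0) * cos (V 0 \<bullet> x - b)" by (rule LIMSEQ_unique[symmetric])
  then show ?thesis by (simp only: VT minus_divide_left)
qed

theorem kernel_cf:
  assumes T: "T \<ge> 0"
  shows "cf (K T x) \<xi> = cis (flow T \<xi> \<bullet> x) * complex_of_real (exp (- (qform Q \<xi> - qform Q (flow T \<xi>)) / 2))"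
proof -
  interpret k: prob_space "K T x" using kernel_prob[OF T] by simp
  note [measurable_cong] = kernel_prob[OF T, of x, THEN conjunct2]
  have i: "integrable (K T x) (\<lambda>y. cis (\<xi> \<bullet> y))" by (rule k.integrable_cis) measurable
  have "Re (cf (K T x) \<xi>) = (\<integral>y. cos (\<xi> \<bullet> y - 0) \<partial>K T x)"
    unfolding cf_def using integral_Re[OF i] by simp
  moreover have "Im (cf (K T x) \<xi>) = (\<integral>y. cos (\<xi> \<bullet> y - pi / 2) \<partial>K T x)"
    unfolding cf_def using integral_Im[OF i] by (simp add: cos_diff)
  ultimately show ?thesis
    unfolding kernel_cos[OF T] by (simp add: complex_eq_iff cos_diff)
qed

end

section \<open>The invariant measure and the conclusion\<close>

lemma exp_decay_dominates:
  fixes \<rho> :: real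
  assumes "\<rho> > 0"
  shows "((\<lambda>t. (1 + t ^ m) * exp (- \<rho> * t)) \<longlongrightarrow> 0) at_top"
proof -
  have e: "((\<lambda>t. exp (- (\<rho> / 2) * t)) \<longlongrightarrow> 0) at_top"
  proof (rule filterlim_compose[OF exp_at_bot])
    show "filterlim (\<lambda>t. - (\<rho> / 2) * t) at_bot at_top"
      using assms filterlim_tendsto_neg_mult_at_bot[OF tendsto_const[of "- (\<rho> / 2)"] _ filterlim_ident] by simp
  qed
  obtain C where C: "C \<ge> 0" "\<And>t. t \<ge> 0 \<Longrightarrow> t ^ m * exp (- (\<rho> / 2) * t) \<le> C"
    using power_exp_bound[of "\<rho> / 2" m] assms by auto
  show ?thesis
  proof (rule Lim_null_comparison)
    show "\<forall>\<^sub>F t in at_top. norm ((1 + t ^ m) * exp (- \<rho> * t)) \<le> (1 + C) * exp (- (\<rho> / 2) * t)"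
      using eventually_ge_at_top[of 0]
    proof eventually_elim
      case (elim t)
      \<comment> \<open>Half of the exponential absorbs the power, the other half tends to
        0.\<close>
      have x: "exp (- \<rho> * t) = exp (- (\<rho> / 2) * t) * exp (- (\<rho> / 2) * t)" by (simp add: exp_add[symmetric])
      have "exp (- (\<rho> / 2) * t) \<le> 1" using elim assms by simp
      moreover have "t ^ m * exp (- (\<rho> / 2) * t) \<le> C" by (rule C(2)[OF elim])
      ultimately have "(1 + t ^ m) * exp (- (\<rho> / 2) * t) \<le> 1 + C" unfolding distrib_right mult_1_left by (rule add_mono)
      then have "((1 + t ^ m) * exp (- (\<rho> / 2) * t)) * exp (- (\<rho> / 2) * t) \<le> (1 + C) * exp (- (\<rho> / 2) * t)"
        by (rule mult_right_mono) simp
      then show ?case using elim unfolding x by (simp add: abs_mult mult.assoc)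
    qed
    show "((\<lambda>t. (1 + C) * exp (- (\<rho> / 2) * t)) \<longlongrightarrow> 0) at_top" by (rule tendsto_mult_right_zero[OF e])
  qed
qed

lemma hurwitz_if_bound:
  fixes B D :: "real^'n^'n"
  assumes D: "psd_matrix D" and \<rho>: "\<rho> > 0"
    and C: "\<And>t i j. t \<ge> 0 \<Longrightarrow> \<bar>mexp B (- t) $ i $ j\<bar> \<le> C * ((1 + t ^ m) * exp (- \<rho> * t))"
  shows "hurwitz B D"
proof
  fix i j
  show "((\<lambda>t. mexp B (- t) $ i $ j) \<longlongrightarrow> 0) at_top"
  proof (rule Lim_null_comparison)
    show "\<forall>\<^sub>F t in at_top. norm (mexp B (- t) $ i $ j) \<le> C * ((1 + t ^ m) * exp (- \<rho> * t))"
      using eventually_ge_at_top[of 0] by eventually_elim (unfold real_norm_def, rule C)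
    show "((\<lambda>t. C * ((1 + t ^ m) * exp (- \<rho> * t))) \<longlongrightarrow> 0) at_top"
      by (rule tendsto_mult_right_zero[OF exp_decay_dominates[OF \<rho>]])
  qed
qed (rule D)

lemma cf_eq_cos:
  assumes \<nu>: "borel_prob \<nu>"
  shows "Re (cf \<nu> \<xi>) = (\<integral>y. cos (\<xi> \<bullet> y - 0) \<partial>\<nu>)" "Im (cf \<nu> \<xi>) = (\<integral>y. cos (\<xi> \<bullet> y - pi / 2) \<partial>\<nu>)"
proof -
  interpret prob_space \<nu> using \<nu> by simp
  note [measurable_cong] = \<nu>[THEN conjunct2]
  have i: "integrable \<nu> (\<lambda>y. cis (\<xi> \<bullet> y))" by (rule integrable_cis) measurable
  show "Re (cf \<nu> \<xi>) = (\<integral>y. cos (\<xi> \<bullet> y - 0) \<partial>\<nu>)" "Im (cf \<nu> \<xi>) = (\<integral>y. cos (\<xi> \<bullet> y - pi / 2) \<partial>\<nu>)"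
    unfolding cf_def using integral_Re[OF i] integral_Im[OF i] by (simp_all add: cos_diff)
qed

context ornstein_uhlenbeck
begin

lemma cf_bind:
  assumes \<nu>: "borel_prob \<nu>" and t: "t \<ge> 0" and inv: "borel_prob (\<nu> \<bind> K t)"
  shows "cf (\<nu> \<bind> K t) \<xi> = cf \<nu> (flow t \<xi>) * complex_of_real (exp (- (qform Q \<xi> - qform Q (flow t \<xi>)) / 2))"
proof -
  have e: "(\<integral>y. cos (\<xi> \<bullet> y - b) \<partial>(\<nu> \<bind> K t)) = exp (- (qform Q \<xi> - qform Q (flow t \<xi>)) / 2) * (\<integral>x. cos (flow t \<xi> \<bullet> x - b) \<partial>\<nu>)" for b
  proof -
    have "bdd_measurable (\<lambda>y. cos (\<xi> \<bullet> y - b))" by (rule bdd_measurableI[of _ 1]) auto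
    from integral_bind_bdd_measurable[OF \<nu> kernel[OF t] this] show ?thesis unfolding kernel_cos[OF t] by simp
  qed
  show ?thesis
    using e[of 0] e[of "pi / 2"] unfolding cf_eq_cos[OF inv, symmetric] cf_eq_cos[OF \<nu>, symmetric]
    by (simp add: complex_eq_iff mult.commute)
qed

lemma borel_prob_bind:
  assumes \<nu>: "borel_prob \<nu>" and t: "t \<ge> 0"
  shows "borel_prob (\<nu> \<bind> K t)"
proof -
  have "K t \<in> \<nu> \<rightarrow>\<^sub>M prob_algebra borel" using kernel[OF t] \<nu> by (simp cong: measurable_cong_sets)
  then show ?thesis
    using prob_space_bind'[of \<nu> \<nu> "K t" borel] sets_bind'[of \<nu> \<nu> "K t" borel] \<nu> by (auto simp: space_prob_algebra)
qed

text \<open>In the exponent the term \<open>qform Q (flow t \<xi>)\<close> from the transported law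
  cancels against the one in the transition probability.\<close>

lemma gaussian_invariant:
  assumes \<mu>: "centered_gaussian Q \<mu>"
  shows "invariant_measure K \<mu>"
  unfolding invariant_measure_def
proof (intro conjI allI impI)
  show "prob_space \<mu>" "sets \<mu> = sets borel" using centered_gaussianD(1,2)[OF \<mu>] .
  then have bp: "borel_prob \<mu>" by simp
  fix t :: real assume t: "0 \<le> t"
  show "\<mu> \<bind> K t = \<mu>"
  proof (rule cf_unique[OF borel_prob_bind[OF bp t] bp])
    fix \<xi>
    have g: "cf \<mu> \<xi> = complex_of_real (exp (- qform Q \<xi> / 2))" for \<xi>
      using \<mu> by (simp add: centered_gaussian_def qform_def)
    show "cf (\<mu> \<bind> K t) \<xi> = cf \<mu> \<xi>"
      unfolding cf_bind[OF bp t borel_prob_bind[OF bp t]] g of_real_mult[symmetric] exp_add[symmetric] by (simp add: field_simps)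
  qed
qed

text \<open>Invariance at time n expresses \<open>cf \<nu> \<xi>\<close> by the value of
  \<open>cf \<nu>\<close> at \<open>flow (real n) \<xi>\<close>. The lower bound on \<open>Q\<close>
  forces these frequencies to 0, where \<open>cf \<nu>\<close> tends to 1, and the remaining factor
  tends to \<open>cf \<mu> \<xi>\<close>.\<close>

lemma invariant_unique:
  assumes \<mu>: "centered_gaussian Q \<mu>" and l: "l > 0" "\<And>\<xi>. l * (norm \<xi>)\<^sup>2 \<le> qform Q \<xi>" and \<nu>: "invariant_measure K \<nu>"
  shows "\<nu> = \<mu>"
proof (rule cf_unique)
  show \<mu>p: "borel_prob \<mu>" using centered_gaussianD(1,2)[OF \<mu>] by simp
  show \<nu>p: "borel_prob \<nu>" using \<nu> by (simp add: invariant_measure_def)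
  interpret prob_space \<nu> using \<nu>p by simp
  note [measurable_cong] = \<nu>p[THEN conjunct2]
  fix \<xi>
  have qlim: "(\<lambda>n. qform Q (flow (real n) \<xi>)) \<longlonglongrightarrow> 0"
    by (rule filterlim_compose[OF qform_flow_tendsto filterlim_real_sequentially])
  have "(\<lambda>n. (norm (flow (real n) \<xi>))\<^sup>2) \<longlonglongrightarrow> 0"
  proof (rule Lim_null_comparison)
    show "\<forall>\<^sub>F n in sequentially. norm ((norm (flow (real n) \<xi>))\<^sup>2) \<le> qform Q (flow (real n) \<xi>) / l"
      using l by (auto simp: field_simps)
    show "(\<lambda>n. qform Q (flow (real n) \<xi>) / l) \<longlonglongrightarrow> 0" using tendsto_divide[OF qlim tendsto_const[of l]] l by simp
  qed
  then have "(\<lambda>n. sqrt ((norm (flow (real n) \<xi>))\<^sup>2)) \<longlonglongrightarrow> sqrt 0" by (rule tendsto_real_sqrt)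
  then have flim: "(\<lambda>n. flow (real n) \<xi>) \<longlonglongrightarrow> 0" by (simp add: tendsto_norm_zero_iff)
  have "(\<lambda>n. cf \<nu> (flow (real n) \<xi>)) \<longlonglongrightarrow> (\<integral>x. 1 \<partial>\<nu>)"
    unfolding cf_def
  proof (rule integral_dominated_convergence[where w = "\<lambda>_. 1"])
    show "AE x in \<nu>. (\<lambda>n. cis (flow (real n) \<xi> \<bullet> x)) \<longlonglongrightarrow> 1"
    proof (rule AE_I2)
      fix x
      have "(\<lambda>n. flow (real n) \<xi> \<bullet> x) \<longlonglongrightarrow> 0 \<bullet> x" by (intro tendsto_intros flim)
      then have "(\<lambda>n. cis (flow (real n) \<xi> \<bullet> x)) \<longlonglongrightarrow> cis (0 \<bullet> x)"
        by (intro continuous_on_tendsto_compose[OF continuous_on_cis[OF continuous_on_id[of UNIV]]]) auto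
      then show "(\<lambda>n. cis (flow (real n) \<xi> \<bullet> x)) \<longlonglongrightarrow> 1" by simp
    qed
  qed auto
  moreover have "(\<lambda>n. complex_of_real (exp (- (qform Q \<xi> - qform Q (flow (real n) \<xi>)) / 2))) \<longlonglongrightarrow> complex_of_real (exp (- (qform Q \<xi> - 0) / 2))"
    by (intro tendsto_intros qlim) auto
  ultimately have "(\<lambda>n. cf \<nu> (flow (real n) \<xi>) * complex_of_real (exp (- (qform Q \<xi> - qform Q (flow (real n) \<xi>)) / 2)))
      \<longlonglongrightarrow> (\<integral>x. 1 \<partial>\<nu>) * complex_of_real (exp (- (qform Q \<xi> - 0) / 2))"
    by (rule tendsto_mult)
  moreover have "cf \<nu> (flow (real n) \<xi>) * complex_of_real (exp (- (qform Q \<xi> - qform Q (flow (real n) \<xi>)) / 2)) = cf \<nu> \<xi>" for n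
    using cf_bind[OF \<nu>p _ borel_prob_bind[OF \<nu>p], of "real n" \<xi>] \<nu> by (simp add: invariant_measure_def)
  ultimately have "(\<lambda>n::nat. cf \<nu> \<xi>) \<longlonglongrightarrow> complex_of_real (exp (- (qform Q \<xi> - 0) / 2))"
    by (simp add: prob_space)
  then show "cf \<nu> \<xi> = cf \<mu> \<xi>"
    using \<mu> by (simp add: LIMSEQ_const_iff centered_gaussian_def qform_def)
qed

lemma entropy_contraction:
  assumes \<mu>: "centered_gaussian Q \<mu>" and a: "admissible a" and t: "t \<ge> 0" and \<theta>: "0 < \<theta>" "\<theta> \<le> 1"
    and le: "\<And>\<xi>. qform Q (flow t \<xi>) \<le> \<theta> * qform Q \<xi>"
    and f: "\<And>x. 0 \<le> f x" "integrable \<mu> f" "Ent a \<mu> f < \<infinity>"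
  shows "Ent a \<mu> (semigroup_op K t f) \<le> ereal \<theta> * Ent a \<mu> f"
proof -
  have "Ent a \<mu> (\<lambda>x. \<integral>y. f y \<partial>K t x) \<le> ereal \<theta> * Ent a \<mu> f"
  proof (rule kernel_entropy_from_bounded[OF _ kernel[OF t] _ a _ \<theta>(2) _ f])
    show "borel_prob \<mu>" using centered_gaussianD(1,2)[OF \<mu>] by simp
    show "\<mu> \<bind> K t = \<mu>" using gaussian_invariant[OF \<mu>] t by (simp add: invariant_measure_def)
    show "0 \<le> \<theta>" using \<theta> by simp
    fix g :: "real^'n \<Rightarrow> real" and l u :: real
    assume g: "0 < l" "g \<in> borel_measurable borel" "\<And>x. g x \<in> {l..u}"
    show "(\<integral>x. a (\<integral>y. g y \<partial>K t x) \<partial>\<mu>) \<le> (1 - \<theta>) * a (\<integral>x. g x \<partial>\<mu>) + \<theta> * (\<integral>x. a (g x) \<partial>\<mu>)"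
    proof (rule gaussian_kernel_entropy_bounded[OF \<mu> a g Q(2) \<theta>, where A = "mexp B (- t)"])
      show "(transpose (mexp B (- t)) *v \<xi>) \<bullet> (Q *v (transpose (mexp B (- t)) *v \<xi>)) \<le> \<theta> * (\<xi> \<bullet> (Q *v \<xi>))" for \<xi>
        using le[of \<xi>] unfolding qform_def flow_def .
      show "borel_prob (K t x)" for x by (rule kernel_prob[OF t])
      show "cf (K t x) \<xi> = cis (\<xi> \<bullet> (mexp B (- t) *v x)) * complex_of_real (exp (- (\<xi> \<bullet> (Q *v \<xi>) -
          (transpose (mexp B (- t)) *v \<xi>) \<bullet> (Q *v (transpose (mexp B (- t)) *v \<xi>))) / 2))" for x \<xi>
        unfolding kernel_cf[OF t] qform_def flow_def inner_matrix_transpose[of \<xi> "mexp B (- t)" x] ..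
    qed
  qed
  then show ?thesis unfolding semigroup_op_def[abs_def] .
qed

end

theorem corollary12:
  fixes B D :: "real^'n^'n"
    and K :: "real \<Rightarrow> real^'n \<Rightarrow> (real^'n) measure"
    and \<rho> :: real and M N :: nat
  assumes D: "psd_matrix D"
    and K: "OU_semigroup B D K"
    and ker: "kernel_nondegenerate B D"
    and M: "M = num_brackets B D"
    and \<rho>: "\<rho> = min_re_spectrum B" "\<rho> > 0"
    and N: "N = max_jordan_block B \<rho>"
  shows "\<exists>\<mu>. invariant_measure K \<mu> \<and> (\<forall>\<nu>. invariant_measure K \<nu> \<longrightarrow> \<nu> = \<mu>) \<and>
    (\<exists>c>0. \<exists>\<kappa>>0. \<forall>a f t.
       admissible a \<and> (\<forall>x. 0 \<le> f x) \<and> integrable \<mu> f \<and> Ent a \<mu> f < \<infinity> \<and> 0 \<le> t \<longrightarrow>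
       Ent a \<mu> (semigroup_op K t f)
         \<le> ereal (min (c * (1 + t ^ (2 * (N - 1))) * exp (- 2 * \<rho> * t))
                       (exp (- \<kappa> * t * (1 - exp (- t)) ^ (2 * M)))) * Ent a \<mu> f)"
proof -
  from mexp_jordan_bound[OF \<rho>(1) N] obtain C where "C \<ge> 0"
    and "\<forall>t\<ge>0. \<forall>i j. \<bar>mexp B (- t) $ i $ j\<bar> \<le> C * ((1 + t ^ (N - 1)) * exp (- \<rho> * t))"
    by (elim exE conjE)
  note C = this(1) this(2)[rule_format]
  interpret hurwitz B D by (rule hurwitz_if_bound[OF D \<rho>(2) C(2)])
  interpret feller K using K by unfold_locales (simp add: OU_semigroup_def)
  interpret ornstein_uhlenbeck B D K by unfold_locales (rule K)
  have pd: "pd_matrix (\<Sum>k\<le>M. matpow B k ** D ** matpow (transpose B) k)"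
    unfolding M by (rule bracket_matrix_pd[OF D ker])
  obtain \<mu> where \<mu>: "centered_gaussian Q \<mu>" using centered_gaussian_exists[OF psd_Q] by blast
  obtain l where l: "l > 0" "\<And>\<xi>. l * (norm \<xi>)\<^sup>2 \<le> qform Q \<xi>" using qform_Q_lower_bound[OF pd] by blast
  from flow_contraction_hypoelliptic[OF pd] obtain \<kappa> where "\<kappa> > 0"
    and "\<forall>t\<ge>0. \<forall>\<xi>. qform Q (flow t \<xi>) \<le> exp (- \<kappa> * t * (1 - exp (- t)) ^ (2 * M)) * qform Q \<xi>"
    by (elim exE conjE)
  note \<kappa> = this(1) this(2)[rule_format]
  have "\<exists>c\<ge>1. \<forall>t\<ge>0. \<forall>\<xi>. qform Q (flow t \<xi>) \<le> c * (1 + t ^ (2 * (N - 1))) * exp (- 2 * \<rho> * t) * qform Q \<xi>"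
    by (rule flow_contraction_spectral[OF pd C(1)]) (rule C(2))
  then obtain c where "c \<ge> 1"
    and "\<forall>t\<ge>0. \<forall>\<xi>. qform Q (flow t \<xi>) \<le> c * (1 + t ^ (2 * (N - 1))) * exp (- 2 * \<rho> * t) * qform Q \<xi>"
    by (elim exE conjE)
  note c = this(1) this(2)[rule_format]
  have "Ent a \<mu> (semigroup_op K t f)
      \<le> ereal (min (c * (1 + t ^ (2 * (N - 1))) * exp (- 2 * \<rho> * t)) (exp (- \<kappa> * t * (1 - exp (- t)) ^ (2 * M)))) * Ent a \<mu> f"
    if a: "admissible a" and f: "\<And>x. 0 \<le> f x" "integrable \<mu> f" "Ent a \<mu> f < \<infinity>" and t: "t \<ge> 0" for a f t
  proof (rule entropy_contraction[OF \<mu> a t _ _ _ f])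
    \<comment> \<open>The minimum itself serves as \<theta>: c \<ge> 1 makes it positive, and the
      second term keeps it at most 1 even where the first one is large.\<close>
    let ?x = "c * (1 + t ^ (2 * (N - 1))) * exp (- 2 * \<rho> * t)" and ?y = "exp (- \<kappa> * t * (1 - exp (- t)) ^ (2 * M))"
    have "1 + t ^ (2 * (N - 1)) > 0" using t by (simp add: add_pos_nonneg)
    then show "0 < min ?x ?y" using c(1) by simp
    have "0 \<le> \<kappa> * t * (1 - exp (- t)) ^ (2 * M)" using \<kappa>(1) t by simp
    then have "?y \<le> 1" by simp
    then show "min ?x ?y \<le> 1" by linarith
    show "qform Q (flow t \<xi>) \<le> min ?x ?y * qform Q \<xi>" for \<xi>
    proof (cases "?x \<le> ?y")
      case True
      then have "min ?x ?y = ?x" by (rule min_absorb1)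
      then show ?thesis using c(2)[OF t, of \<xi>] by (simp only:)
    next
      case False
      then have "min ?x ?y = ?y" by simp
      then show ?thesis using \<kappa>(2)[OF t, of \<xi>] by (simp only:)
    qed
  qed
  note entropy = this
  show ?thesis
  proof (intro exI[of _ \<mu>] conjI allI impI)
    show "invariant_measure K \<mu>" by (rule gaussian_invariant[OF \<mu>])
    show "\<nu> = \<mu>" if "invariant_measure K \<nu>" for \<nu> by (rule invariant_unique[OF \<mu> l that])
    show "\<exists>c>0. \<exists>\<kappa>>0. \<forall>a f t.
       admissible a \<and> (\<forall>x. 0 \<le> f x) \<and> integrable \<mu> f \<and> Ent a \<mu> f < \<infinity> \<and> 0 \<le> t \<longrightarrow>
       Ent a \<mu> (semigroup_op K t f)
         \<le> ereal (min (c * (1 + t ^ (2 * (N - 1))) * exp (- 2 * \<rho> * t))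
                       (exp (- \<kappa> * t * (1 - exp (- t)) ^ (2 * M)))) * Ent a \<mu> f"
    proof (rule exI[of _ c], rule conjI, use c(1) in simp, rule exI[of _ \<kappa>], intro conjI allI impI)
      show "\<kappa> > 0" by (rule \<kappa>(1))
    qed (elim conjE, rule entropy, auto)
  qed
qed

end
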